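(* Let $A$ and $V$ be bounded self-adjoint operators on a separable complex Hilbert space $\mathcal H$. Suppose that the spectrum of $A$ has a part $\omega$ separated from the remainder of the spectrum $\Omega$ in the sense that $$\operatorname{spec}(A)=\omega\cup\Omega\quad\text{and}\quad\operatorname{dist}(\omega,\Omega)=d>0$$ (with $\omega,\Omega$ nonempty, so that $d<\infty$). If $$\|V\|<\frac{\sinh(1)}{e}\,d,$$ then $$\bigl\|\mathsf E_A(\omega)-\mathsf E_{A+V}\bigl(\mathcal O_{d/2}(\omega)\bigr)\bigr\|\le\sin\biggl(\frac{\pi}{4}\log\frac{d}{d-2\|V\|}\biggr)<1,$$ where $\mathcal O_{d/2}(\omega)$ denotes the open $d/2$-neighborhood of $\omega$ in $\mathbb R$.
   Context: $\mathsf E_B(\Delta)$ denotes the spectral projection of the self-adjoint operator $B$ for the Borel set $\Delta\subset\mathbb R$; $\operatorname{dist}(\omega,\Omega)=\inf\{|\lambda-\mu|:\lambda\in\omega,\ \mu\in\Omega\}$; $\log$ is the natural logarithm. *)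

theory Defs
  imports "HOL-Analysis.Analysis"
begin

(* Complex Hilbert spaces are built on top of the library class real_inner: the real inner product
   is the real part of the complex one, so the norm is sqrt (Re (cinner x x)) and positive
   definiteness of cinner is inherited from that of inner.  The complex inner product is
   antilinear in its first argument. *)

class complex_vector = real_vector +
  fixes scaleC :: "complex \<Rightarrow> 'a \<Rightarrow> 'a"  (infixr "*\<^sub>C" 75)
  assumes scaleC_add_right: "a *\<^sub>C (x + y) = a *\<^sub>C x + a *\<^sub>C y"
    and scaleC_add_left: "(a + b) *\<^sub>C x = a *\<^sub>C x + b *\<^sub>C x"
    and scaleC_scaleC: "a *\<^sub>C (b *\<^sub>C x) = (a * b) *\<^sub>C x"
    and scaleC_of_real: "complex_of_real r *\<^sub>C x = r *\<^sub>R x"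

class complex_inner = complex_vector + real_inner +
  fixes cinner :: "'a \<Rightarrow> 'a \<Rightarrow> complex"
  assumes cinner_commute: "cinner x y = cnj (cinner y x)"
    and cinner_add_right: "cinner x (y + z) = cinner x y + cinner x z"
    and cinner_scaleC_right: "cinner x (c *\<^sub>C y) = c * cinner x y"
    and Re_cinner: "Re (cinner x y) = inner x y"

class chilbert_space = complex_inner + complete_space

(* A bounded operator is a complex-linear element of 'a \<Rightarrow>\<^sub>L 'a, the library type of bounded
   real-linear maps; the norm of that type is the operator norm. *)

definition clinear_op :: "('a::chilbert_space \<Rightarrow>\<^sub>L 'a) \<Rightarrow> bool" where
  "clinear_op A \<longleftrightarrow> (\<forall>c x. A (c *\<^sub>C x) = c *\<^sub>C A x)"

definition selfadjoint_op :: "('a::chilbert_space \<Rightarrow>\<^sub>L 'a) \<Rightarrow> bool" where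
  "selfadjoint_op A \<longleftrightarrow> clinear_op A \<and> (\<forall>x y. cinner (A x) y = cinner x (A y))"

definition orthogonal_projection :: "('a::chilbert_space \<Rightarrow>\<^sub>L 'a) \<Rightarrow> bool" where
  "orthogonal_projection P \<longleftrightarrow> selfadjoint_op P \<and> P o\<^sub>L P = P"

definition op_resolvent_set :: "('a::chilbert_space \<Rightarrow>\<^sub>L 'a) \<Rightarrow> complex set" where
  "op_resolvent_set A = {z. \<exists>R :: 'a \<Rightarrow>\<^sub>L 'a. clinear_op R \<and>
     (\<forall>x. R (A x - z *\<^sub>C x) = x) \<and> (\<forall>x. A (R x) - z *\<^sub>C R x = x)}"

definition op_spectrum :: "('a::chilbert_space \<Rightarrow>\<^sub>L 'a) \<Rightarrow> complex set" where
  "op_spectrum A = - op_resolvent_set A"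

(* Projection-valued measures on the Borel sets of the real line, countably additive in the strong
   operator topology.  The values on non-Borel sets are unconstrained. *)

definition projection_valued_measure :: "(real set \<Rightarrow> 'a::chilbert_space \<Rightarrow>\<^sub>L 'a) \<Rightarrow> bool" where
  "projection_valued_measure E \<longleftrightarrow>
     (\<forall>\<Delta>\<in>sets borel. orthogonal_projection (E \<Delta>)) \<and>
     E UNIV = id_blinfun \<and>
     (\<forall>S :: nat \<Rightarrow> real set. range S \<subseteq> sets borel \<longrightarrow> disjoint_family S \<longrightarrow>
        (\<forall>x. (\<lambda>n. E (S n) x) sums E (\<Union>n. S n) x))"

definition scalar_measure ::
    "(real set \<Rightarrow> 'a::chilbert_space \<Rightarrow>\<^sub>L 'a) \<Rightarrow> 'a \<Rightarrow> real measure" where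
  "scalar_measure E x =
     measure_of UNIV (sets borel) (\<lambda>\<Delta>. ennreal (Re (cinner x (E \<Delta> x))))"

(* B is the integral of the identity function with respect to E, in the weak sense (by polarization
   it is enough to consider the diagonal of the sesquilinear forms). *)

definition is_spectral_measure ::
    "('a::chilbert_space \<Rightarrow>\<^sub>L 'a) \<Rightarrow> (real set \<Rightarrow> 'a \<Rightarrow>\<^sub>L 'a) \<Rightarrow> bool" where
  "is_spectral_measure B E \<longleftrightarrow> projection_valued_measure E \<and>
     (\<forall>x. has_bochner_integral (scalar_measure E x) complex_of_real (cinner x (B x)))"

(* By the spectral theorem, a self-adjoint B has a spectral measure, whose values on the Borel sets
   are unique; only for Borel sets is this description definite. *)

definition spectral_projection ::
    "('a::chilbert_space \<Rightarrow>\<^sub>L 'a) \<Rightarrow> real set \<Rightarrow> 'a \<Rightarrow>\<^sub>L 'a" where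
  "spectral_projection B \<Delta> = (THE P. \<exists>E. is_spectral_measure B E \<and> P = E \<Delta>)"

definition open_nbhd :: "real \<Rightarrow> real set \<Rightarrow> real set" where
  "open_nbhd r S = (\<Union>s\<in>S. ball s r)"

end

theory Submission
  imports Defs "HOL-Probability.Probability"
begin

text \<open>
  Join \<open>A\<close> to \<open>A + V\<close> by the operators \<open>A + t V\<close>. The gap between the two parts of the spectrum is
  at least \<open>d - 2 t \<parallel>V\<parallel>\<close> at time \<open>t\<close>, so for \<open>s\<close> close to \<open>t\<close> the two spectral projections differ
  in norm by at most \<open>\<pi>/2 \<sqdot> \<bar>s - t\<bar> \<parallel>V\<parallel> / (d - (s + t) \<parallel>V\<parallel>)\<close>. Since \<open>arcsin \<parallel>P - Q\<parallel>\<close> is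
  subadditive along chains of projections, the total angle is at most the integral of
  \<open>\<pi>/2 \<sqdot> \<parallel>V\<parallel> / (d - 2 t \<parallel>V\<parallel>)\<close> over \<open>[0,1]\<close>, which is \<open>\<pi>/4 \<sqdot> log (d / (d - 2 \<parallel>V\<parallel>))\<close>.

  The constant \<open>\<pi>/2\<close> is that of the Sz.-Nagy extremal problem. After rounding the spectra to a
  grid, a vector pair from two separated spectral subspaces is recovered from the form of
  \<open>A - B\<close> by a Schur multiplier \<open>1/n\<close> on \<open>\<bar>n\<bar> \<ge> N\<close>, and \<open>1/n\<close> is a sine transform of total mass
  \<open>\<pi>/(2N)\<close>.

  Spectral measures exist because the discrete measures given by Bernstein polynomials of the
  operator converge weakly, by Helly's theorem, to measures with the right moments. They are unique
  because the estimate above with \<open>A = B\<close> makes separated spectral subspaces of two spectral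
  measures orthogonal.
\<close>

section \<open>Sine transforms with small total mass\<close>

text \<open>With v = norm V, a single comparison of A with A + V gives at best pi / 2 * v / (d - v),
  which stays below 1 only for v < 2 d / (pi + 2), about 0.389 d. Adding angles along a subdivided
  path reaches sinh(1) / e, about 0.432: since sinh(1) / e = (1 - exp (-2)) / 2, the hypothesis says
  exactly that log (d / (d - 2 v)) < 2, that is, that the total angle is below pi / 2. The two parts
  of the spectrum may interlace, so no interval or half-line need separate them; this is why the
  estimate rests on an extremal problem rather than on an ordering argument with constant 1.
  Sampling at roots of unity replaces Fourier integrals by finite sums, which is possible because
  the rounding makes all frequencies integers. \<open>spectral_projection\<close> is a definite
  description, hence both existence and uniqueness of spectral measures have to be established. The
  estimates use the real inner product; complex linearity is carried along separately.\<close>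

lemma sum_cis_period:
  fixes n :: int and M :: nat
  assumes "M > 0"
  shows "(\<Sum>m<M. cis (2 * pi * of_int n * real m / real M)) = (if int M dvd n then of_nat M else 0)"
proof -
  define z where "z = cis (2 * pi * of_int n / real M)"
  have p: "cis (2 * pi * of_int n * real m / real M) = z ^ m" for m
    unfolding z_def Complex.DeMoivre by (intro arg_cong[of _ _ cis]) (simp add: field_simps)
  have z1: "z = 1 \<longleftrightarrow> int M dvd n"
  proof
    assume "z = 1"
    then have "cos (2 * pi * of_int n / real M) = 1"
      unfolding z_def by (metis cis.simps(1) one_complex.simps(1))
    then obtain k :: int where "2 * pi * of_int n / real M = of_int k * 2 * pi"
      using cos_one_2pi_int by blast
    then have "pi * (of_int n - of_int k * real M) = 0" using assms by (simp add: field_simps)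
    then have "of_int n = of_int k * real M" by simp
    then have "n = k * int M" by (metis of_int_eq_iff of_int_mult of_int_of_nat_eq)
    then show "int M dvd n" by simp
  next
    assume "int M dvd n"
    then obtain k where "n = int M * k" by auto
    then have "2 * pi * of_int n / real M = 2 * pi * of_int k" using assms by simp
    then show "z = 1" unfolding z_def by (simp add: cis_multiple_2pi)
  qed
  have zM: "z ^ M = 1"
  proof -
    have "z ^ M = cis (2 * pi * of_int n)" unfolding z_def Complex.DeMoivre using assms by simp
    then show ?thesis by (simp add: cis_multiple_2pi)
  qed
  show ?thesis
  proof (cases "int M dvd n")
    case True
    then show ?thesis using z1 by (simp add: p)
  next
    case False
    then show ?thesis using z1 zM by (simp add: p geometric_sum)
  qed
qed

lemma sum_cos_period:
  fixes n :: int
  assumes "M > 0"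
  shows "(\<Sum>m<M. cos (2 * pi * of_int n * real m / real M)) = (if int M dvd n then real M else 0)"
  using arg_cong[OF sum_cis_period[OF assms, of n], of Re] by simp

text \<open>The condition \<open>n + k < M\<close> rules out aliasing: neither n + k nor a nonzero n
  - k can be a multiple of \<open>M\<close>, so \<open>M\<close> nodes reproduce the orthogonality
  of the sine integrals.\<close>

lemma sum_sin_sin_period:
  assumes "0 < n" "0 < k" "n + k < M"
  shows "(\<Sum>m<M. sin (real n * (2 * pi * real m / real M)) * sin (real k * (2 * pi * real m / real M)))
    = (if n = k then real M / 2 else 0)"
proof -
  have M: "M > 0" using assms by simp
  have e: "sin (real n * (2 * pi * real m / real M)) * sin (real k * (2 * pi * real m / real M))
    = (cos (2 * pi * of_int (int n - int k) * real m / real M)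
      - cos (2 * pi * of_int (int n + int k) * real m / real M)) / 2" for m
    unfolding sin_times_sin
    by (intro arg_cong2[of _ _ _ _ "\<lambda>a b. (cos a - cos b) / 2"]) (simp_all add: algebra_simps diff_divide_distrib add_divide_distrib)
  have "\<not> int M dvd (int n + int k)"
  proof
    assume "int M dvd (int n + int k)"
    then have "int M \<le> int n + int k" using assms by (intro zdvd_imp_le) auto
    then show False using assms by simp
  qed
  moreover have "int M dvd (int n - int k) \<longleftrightarrow> n = k"
  proof
    assume d: "int M dvd (int n - int k)"
    show "n = k"
    proof (rule ccontr)
      assume "n \<noteq> k"
      then have "int M \<le> \<bar>int n - int k\<bar>" using d
        by (metis abs_of_nat dvd_imp_le_int right_minus_eq of_nat_eq_iff)
      then show False using assms by simp
    qed
  qed simp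
  ultimately show ?thesis
    unfolding e sum_divide_distrib[symmetric] sum_subtractf sum_cos_period[OF M] by simp
qed

text \<open>The factor 2 sin(a / 2) makes the sum telescope, and for odd \<open>k\<close> the far
  end contributes cos(a / 2) a second time. For large \<open>K\<close> the cotangent behaves like 2
  K / (pi k), the sampled form of the integral of sin(k x) over [0, pi].\<close>

lemma sum_sin_half_period:
  assumes "K > 0" "odd k" "k < 2 * K"
  shows "(\<Sum>m<K. sin (pi * real k * real m / real K)) = cot (pi * real k / (2 * real K))"
proof -
  define a where "a = pi * real k / real K"
  have k0: "k > 0" using assms(2) by (cases k) auto
  have s: "sin (a / 2) \<noteq> 0"
  proof -
    have "0 < a / 2" "a / 2 < pi" unfolding a_def using assms k0 by (auto simp: field_simps)
    then show ?thesis using sin_gt_zero by fastforce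
  qed
  have t: "2 * sin (a / 2) * (\<Sum>m<n. sin (a * real m)) = cos (a / 2) - cos (a * real n - a / 2)" for n
  proof (induction n)
    case (Suc n)
    have "2 * sin (a / 2) * sin (a * real n) = cos (a * real n - a / 2) - cos (a * real n + a / 2)"
      by (simp add: cos_diff cos_add)
    then show ?case using Suc by (simp add: algebra_simps)
  qed simp
  have "cos (a * real K - a / 2) = - cos (a / 2)"
  proof -
    have "a * real K = pi * real k" unfolding a_def using assms by simp
    moreover have "cos (pi * real k) = - 1" "sin (pi * real k) = 0"
      using assms(2) by (auto simp: cos_npi2 sin_npi2)
    ultimately show ?thesis by (simp add: cos_diff)
  qed
  then have "sin (a / 2) * (\<Sum>m<K. sin (a * real m)) = cos (a / 2)" using t[of K] by simp
  then have "(\<Sum>m<K. sin (a * real m)) = cot (a / 2)" using s by (simp add: cot_def field_simps)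
  then show ?thesis unfolding a_def by (simp add: mult_ac)
qed

lemma sum_lessThan_add:
  fixes f :: "nat \<Rightarrow> 'a::comm_monoid_add"
  shows "(\<Sum>m<a + b. f m) = (\<Sum>m<a. f m) + (\<Sum>m<b. f (m + a))"
  by (induction b) (simp_all add: ac_simps)

lemma sum_lessThan_mult:
  fixes f :: "nat \<Rightarrow> 'a::comm_monoid_add"
  shows "(\<Sum>m<a * b. f m) = (\<Sum>q<a. \<Sum>m<b. f (m + b * q))"
proof (induction a)
  case (Suc a)
  have e: "Suc a * b = a * b + b" by simp
  show ?case unfolding e sum_lessThan_add Suc by (simp add: mult.commute)
qed simp

text \<open>These are the sine coefficients of the square wave sgn(sin(N \<theta>)). The wave has
  period \<open>2 * K\<close> in m, so adding up its \<open>N\<close> periods leaves only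
  frequencies n = N k; inside a period it changes sign after \<open>K\<close> nodes, which cancels
  even k. The sine is treated as the imaginary part of \<open>cis\<close> because a shift multiplies
  \<open>cis\<close> by a constant, whereas it mixes sine and cosine.\<close>

lemma sum_sin_square_wave:
  fixes N K n :: nat
  assumes "N > 0" "K > 0" "n < N * K"
  shows "(\<Sum>m<2 * N * K. sin (real n * (2 * pi * real m / real (2 * N * K))) * sgn (sin (pi * real m / real K)))
    = (if N dvd n \<and> odd (n div N) then 2 * real N * cot (pi * real (n div N) / (2 * real K)) else 0)"
proof -
  define M where "M = 2 * N * K"
  define s where "s m = sgn (sin (pi * real m / real K))" for m
  define t where "t m = cis (real n * (2 * pi * real m / real M))" for m
  have M: "M > 0" and MN: "M = N * (2 * K)" using assms by (auto simp: M_def)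
  have sh: "s (m + K) = - s m" for m
  proof -
    have "pi * real (m + K) / real K = pi * real m / real K + pi"
      using assms by (simp add: field_simps)
    then show ?thesis unfolding s_def by (simp add: sgn_minus)
  qed
  have sp: "s (m + 2 * K * q) = s m" for m q
  proof (induction q)
    case (Suc q)
    have e: "m + 2 * K * Suc q = (m + 2 * K * q) + K + K" by simp
    show ?case unfolding e sh using Suc by simp
  qed simp
  \<comment> \<open>At \<open>m = 0\<close> the sign is \<open>sgn 0 = 0\<close>; this is harmless
    because the sine it multiplies vanishes there too.\<close>
  have s1: "s m = 1 \<or> m = 0" if "m < K" for m
  proof (cases "m = 0")
    case False
    then have "0 < pi * real m / real K" "pi * real m / real K < pi" using that by (auto simp: field_simps)
    then show ?thesis unfolding s_def using sin_gt_zero by fastforce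
  qed simp
  have tp: "t (m + 2 * K * q) = t m * cis (2 * pi * of_int (int n) * real q / real N)" for m q
    unfolding t_def cis_mult M_def using assms by (intro arg_cong[of _ _ cis]) (simp add: field_simps)
  have "(\<Sum>m<M. t m * of_real (s m))
      = (\<Sum>q<N. \<Sum>m<2*K. t (m + 2 * K * q) * of_real (s (m + 2 * K * q)))"
    unfolding MN by (rule sum_lessThan_mult)
  also have "\<dots> = (\<Sum>q<N. \<Sum>m<2*K. cis (2 * pi * of_int (int n) * real q / real N) * (t m * of_real (s m)))"
    unfolding sp tp by (simp only: mult_ac)
  also have "\<dots> = (\<Sum>q<N. cis (2 * pi * of_int (int n) * real q / real N)) * (\<Sum>m<2*K. t m * of_real (s m))"
    by (simp only: sum_distrib_left[symmetric] sum_distrib_right[symmetric])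
  finally have tot: "(\<Sum>m<M. t m * of_real (s m))
      = (if int N dvd int n then of_nat N else 0) * (\<Sum>m<2*K. t m * of_real (s m))"
    by (simp only: sum_cis_period[OF assms(1)])
  have im: "Im (t m * of_real (s m)) = sin (real n * (2 * pi * real m / real M)) * s m" for m
    by (simp add: t_def)
  have *: "(\<Sum>m<M. sin (real n * (2 * pi * real m / real M)) * s m) = Im (\<Sum>m<M. t m * of_real (s m))"
    by (simp only: Im_sum im)
  show ?thesis
  proof (cases "N dvd n")
    case False
    then show ?thesis using * tot unfolding s_def M_def by simp
  next
    case True
    then obtain k where nk: "n = N * k" by auto
    have k: "n div N = k" "k < K" using nk assms by auto
    define u where "u m = sin (pi * real k * real m / real K)" for m
    have tu: "sin (real n * (2 * pi * real m / real M)) = u m" for m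
      unfolding u_def nk M_def using assms by (intro arg_cong[of _ _ sin]) (simp add: field_simps)
    have ush: "u (m + K) = (-1) ^ k * u m" for m
    proof -
      have "pi * real k * real (m + K) / real K = pi * real k * real m / real K + pi * real k"
        using assms by (simp add: field_simps)
      moreover have "cos (pi * real k) = (-1) ^ k" "sin (pi * real k) = 0"
        by (simp_all add: cos_npi2 sin_npi2)
      ultimately show ?thesis unfolding u_def by (simp add: sin_add)
    qed
    have us: "u m * s m = u m" if "m < K" for m
      using s1[OF that] by (auto simp: u_def)
    have "(\<Sum>m<M. sin (real n * (2 * pi * real m / real M)) * s m) = real N * (\<Sum>m<2*K. u m * s m)"
    proof -
      have "Im (of_nat N * z) = real N * Im z" for z by simp
      moreover have "Im (\<Sum>m<2*K. t m * of_real (s m)) = (\<Sum>m<2*K. u m * s m)"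
        by (simp only: Im_sum im tu)
      ultimately show ?thesis unfolding * tot using True by (simp only: int_dvd_int_iff if_True)
    qed
    also have "(\<Sum>m<2*K. u m * s m) = (\<Sum>m<K. u m * s m) + (\<Sum>m<K. u (m + K) * s (m + K))"
      using sum_lessThan_add[of _ K K] by (simp add: mult_2)
    also have "\<dots> = (\<Sum>m<K. u m * s m) - (-1) ^ k * (\<Sum>m<K. u m * s m)"
      by (simp add: ush sh sum_distrib_left sum_negf mult_ac)
    also have "(\<Sum>m<K. u m * s m) = (\<Sum>m<K. u m)" by (intro sum.cong) (auto simp: us)
    finally have "(\<Sum>m<M. sin (real n * (2 * pi * real m / real M)) * s m)
      = real N * ((\<Sum>m<K. u m) - (-1) ^ k * (\<Sum>m<K. u m))" .
    moreover have "(\<Sum>m<K. u m) = cot (pi * real k / (2 * real K))" if "odd k"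
      unfolding u_def using sum_sin_half_period[OF assms(2) that] k by simp
    ultimately show ?thesis using True k unfolding s_def M_def by (cases "odd k") (simp_all)
  qed
qed

section \<open>Bounds for cotangents, odd squares and convex cosine sums\<close>

lemma cot_le_inverse:
  fixes x :: real
  assumes "0 < x" "x < pi / 2"
  shows "cot x \<le> 1 / x"
proof -
  have c: "0 < cos x" "0 < sin x" using assms cos_gt_zero_pi[of x] sin_gt_zero[of x] by auto
  have "x \<le> tan x"
    using arctan_le_self[of "tan x"] arctan_tan[of x] assms c by (simp add: tan_def)
  then show ?thesis using c assms by (simp add: tan_def cot_def field_simps)
qed

text \<open>The even terms make up a quarter of the full sum pi^2 / 6. The remaining pi^2 / 8 is the
  origin of the pi / 2 in the mass of the weights.\<close>

lemma sum_inverse_odd_squares_le: "(\<Sum>k\<in>{k. odd k \<and> k < n}. 1 / (real k)^2) \<le> pi^2 / 8"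
proof -
  define a where "a k = 1 / (real k)^2" for k :: nat
  have sa: "(\<lambda>k. a (Suc k)) sums (pi^2 / 6)"
    using inverse_squares_sums unfolding a_def by (simp add: add.commute)
  have h: "(\<Sum>k\<in>{k. odd k \<and> k < 2 * m}. a k) = (\<Sum>k<2 * m. a (Suc k)) - (\<Sum>k<m. a (Suc k)) / 4" for m
  proof (induction m)
    case (Suc m)
    have "{k. odd k \<and> k < 2 * Suc m} = insert (2 * m + 1) {k. odd k \<and> k < 2 * m}"
      by (auto elim!: oddE)
    then have "(\<Sum>k\<in>{k. odd k \<and> k < 2 * Suc m}. a k) = a (2 * m + 1) + (\<Sum>k\<in>{k. odd k \<and> k < 2 * m}. a k)"
      by simp
    moreover have "a (Suc (Suc (2 * m))) = a (Suc m) / 4"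
      unfolding a_def by (simp add: power2_eq_square field_simps)
    ultimately show ?case using Suc by (simp add: add_divide_distrib)
  qed simp
  have "(\<lambda>m. (\<Sum>k<2 * m. a (Suc k)) - (\<Sum>k<m. a (Suc k)) / 4) \<longlonglongrightarrow> pi^2 / 6 - (pi^2 / 6) / 4"
  proof (intro tendsto_intros)
    have l: "(\<lambda>m. \<Sum>k<m. a (Suc k)) \<longlonglongrightarrow> pi^2 / 6" using sa by (simp add: sums_def)
    show "(\<lambda>m. \<Sum>k<m. a (Suc k)) \<longlonglongrightarrow> pi^2 / 6" by (rule l)
    show "(\<lambda>m. \<Sum>k<2 * m. a (Suc k)) \<longlonglongrightarrow> pi^2 / 6"
      using LIMSEQ_subseq_LIMSEQ[OF l, of "\<lambda>m. 2 * m"] by (simp add: strict_mono_def o_def)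
  qed simp
  then have "(\<lambda>m. \<Sum>k\<in>{k. odd k \<and> k < 2 * m}. a k) \<longlonglongrightarrow> pi^2 / 8" by (simp add: h)
  moreover have "(\<Sum>k\<in>{k. odd k \<and> k < n}. a k) \<le> (\<Sum>k\<in>{k. odd k \<and> k < 2 * m}. a k)" if "n \<le> m" for m
    using that by (intro sum_mono2) (auto simp: a_def)
  ultimately show ?thesis unfolding a_def
    by (intro LIMSEQ_le_const) (auto simp: a_def)
qed

text \<open>Summation by parts, done twice, turns the cosine sum into a combination of the Fejer
  kernels \<open>F\<close> with the second differences of \<open>G\<close> as coefficients. These
  are nonnegative by convexity, and each kernel is the squared modulus of a sum of unit complex
  numbers.\<close>

lemma fejer_convex_nonneg:
  fixes G :: "nat \<Rightarrow> real"
  assumes convex: "\<And>n. 2 * G (n + 1) \<le> G n + G (n + 2)" and zero: "\<And>n. R \<le> n \<Longrightarrow> G n = 0"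
  shows "0 \<le> G 0 + 2 * (\<Sum>r=1..R. G r * cos (real r * \<theta>))"
proof -
  define c where "c r = (if r = 0 then 1 else 2 * cos (real r * \<theta>))" for r :: nat
  define D where "D n = (\<Sum>r\<le>n. c r)" for n
  define F where "F n = (\<Sum>j\<le>n. D j)" for n
  have D: "D n = 1 + 2 * (\<Sum>k<n. cos (real (n - k) * \<theta>))" for n
  proof -
    have "(\<Sum>k<n. cos (real (n - k) * \<theta>)) = (\<Sum>r=1..n. cos (real r * \<theta>))"
      by (rule sum.reindex_bij_witness[of _ "\<lambda>r. n - r" "\<lambda>k. n - k"]) auto
    moreover have "{..n} = insert 0 {1..n}" by auto
    ultimately show ?thesis unfolding D_def by (simp add: c_def sum_distrib_left)
  qed
  have F: "F n = (\<Sum>k\<le>n. cos (real k * \<theta>))^2 + (\<Sum>k\<le>n. sin (real k * \<theta>))^2" for n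
  proof (induction n)
    case 0
    show ?case by (simp add: F_def D_def c_def)
  next
    case (Suc n)
    define C S where "C = (\<Sum>k\<le>n. cos (real k * \<theta>))" and "S = (\<Sum>k\<le>n. sin (real k * \<theta>))"
    define x where "x = real (Suc n) * \<theta>"
    have "(\<Sum>k<Suc n. cos (real (Suc n - k) * \<theta>)) = (\<Sum>k\<le>n. cos (x - real k * \<theta>))"
      unfolding x_def lessThan_Suc_atMost
      by (intro sum.cong) (auto simp: of_nat_diff algebra_simps)
    also have "\<dots> = cos x * C + sin x * S"
      by (simp add: cos_diff sum.distrib sum_distrib_left C_def S_def)
    finally have "F (Suc n) = C^2 + S^2 + 1 + 2 * (cos x * C + sin x * S)"
      using Suc D[of "Suc n"] by (simp add: F_def C_def S_def)
    also have "\<dots> = (C + cos x)^2 + (S + sin x)^2"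
      using sin_cos_squared_add[of x] by (simp add: power2_eq_square algebra_simps)
    finally show ?case by (simp add: C_def S_def x_def)
  qed
  have abel: "(\<Sum>r\<le>m. c r * G r) = (\<Sum>r\<le>m. F r * (G r - 2 * G (r + 1) + G (r + 2)))
      + F m * (G (m + 1) - G (m + 2)) + D m * G (m + 1)" for m
  proof (induction m)
    case 0
    show ?case by (simp add: F_def D_def c_def algebra_simps numeral_2_eq_2)
  next
    case (Suc m)
    have "F (Suc m) = F m + D (Suc m)" "D (Suc m) = D m + c (Suc m)" by (simp_all add: F_def D_def)
    then show ?case using Suc by (simp add: algebra_simps numeral_2_eq_2)
  qed
  \<comment> \<open>At \<open>m = R\<close> the boundary terms contain only \<open>G (R + 1)\<close>
    and \<open>G (R + 2)\<close>, which vanish.\<close>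
  have "(\<Sum>r\<le>R. c r * G r) = (\<Sum>r\<le>R. F r * (G r - 2 * G (r + 1) + G (r + 2)))"
    unfolding abel by (simp add: zero)
  also have "\<dots> \<ge> 0"
    using convex by (intro sum_nonneg mult_nonneg_nonneg) (auto simp: F algebra_simps)
  also have "(\<Sum>r\<le>R. c r * G r) = G 0 + 2 * (\<Sum>r=1..R. G r * cos (real r * \<theta>))"
  proof -
    have "{..R} = insert 0 {1..R}" by auto
    then show ?thesis by (simp add: c_def sum_distrib_left mult_ac)
  qed
  finally show ?thesis .
qed

lemma sum_int_symmetric:
  fixes h :: "int \<Rightarrow> 'a::comm_monoid_add"
  shows "(\<Sum>r=-int R..int R. h r) = h 0 + (\<Sum>r=1..R. h (int r) + h (- int r))"
proof (induction R)
  case (Suc R)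
  have "{-int (Suc R)..int (Suc R)} = insert (int (Suc R)) (insert (- int (Suc R)) {-int R..int R})" by auto
  then show ?case using Suc by (simp add: ac_simps)
qed simp

text \<open>Multiplying by sin(N \<theta>) shifts the evenly extended coefficients by
  \<open>N\<close>; folding frequency -n onto n, with the sign of the odd sine, subtracts the
  reflected copy.\<close>

lemma sin_times_cosine_sum:
  fixes G :: "nat \<Rightarrow> real"
  assumes zero: "\<And>n. R \<le> n \<Longrightarrow> G n = 0"
  shows "sin (real N * \<theta>) * (G 0 + 2 * (\<Sum>r=1..R. G r * cos (real r * \<theta>)))
    = (\<Sum>n=1..N + R. (G (nat \<bar>int n - int N\<bar>) - G (n + N)) * sin (real n * \<theta>))"
proof -
  define H where "H i = G (nat \<bar>i\<bar>)" for i :: int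
  have p: "2 * (sin (real N * \<theta>) * cos (real r * \<theta>)) = sin (of_int (int r + int N) * \<theta>) + sin (of_int (- int r + int N) * \<theta>)" for r
    unfolding sin_times_cos by (simp add: algebra_simps)
  have "sin (real N * \<theta>) * (G 0 + 2 * (\<Sum>r=1..R. G r * cos (real r * \<theta>)))
    = sin (real N * \<theta>) * G 0 + (\<Sum>r=1..R. G r * (2 * (sin (real N * \<theta>) * cos (real r * \<theta>))))"
    by (simp add: distrib_left sum_distrib_left mult_ac)
  also have "\<dots> = (\<Sum>r=-int R..int R. H r * sin (of_int (r + int N) * \<theta>))"
    unfolding sum_int_symmetric p by (simp add: H_def distrib_left)
  also have "\<dots> = (\<Sum>n=int N - int R..int N + int R. H (n - int N) * sin (of_int n * \<theta>))"
    by (rule sum.reindex_bij_witness[of _ "\<lambda>n. n - int N" "\<lambda>r. r + int N"]) auto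
  also have "\<dots> = (\<Sum>n=-int (N + R)..int (N + R). H (n - int N) * sin (of_int n * \<theta>))"
    by (intro sum.mono_neutral_left) (auto simp: H_def intro!: zero)
  also have "\<dots> = (\<Sum>n=1..N + R. (G (nat \<bar>int n - int N\<bar>) - G (n + N)) * sin (real n * \<theta>))"
  proof -
    have "nat \<bar>- int n - int N\<bar> = n + N" for n by simp
    then show ?thesis unfolding sum_int_symmetric by (simp add: H_def algebra_simps)
  qed
  finally show ?thesis .
qed

lemma Digamma_concave: "concave_on {0<..} (Digamma :: real \<Rightarrow> real)"
  by (rule f''_le0_imp_concave[where f' = "Polygamma 1" and f'' = "Polygamma 2"])
     (auto intro!: derivative_eq_intros Polygamma_real_even_neg less_imp_le elim!: nonpos_Ints_cases simp: numeral_2_eq_2)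

lemma Digamma_midpoint:
  fixes x h :: real
  assumes "0 < x" "0 < h"
  shows "Digamma x + Digamma (x + 2 * h) \<le> 2 * Digamma (x + h)"
proof -
  have "convex_on {0<..} (\<lambda>x. - Digamma x :: real)" using Digamma_concave by (simp add: concave_on_def)
  from convex_onD[OF this, of "1/2" x "x + 2 * h"] assms show ?thesis
    by (simp add: algebra_simps)
qed

text \<open>
  The weights sample \<open>f \<theta> = sin (N \<theta>) \<rho> \<theta>\<close> at roots of unity, where \<open>\<rho>\<close> has the cosine coefficients
  \<open>G\<close>. Convexity of \<open>G\<close> makes \<open>\<rho>\<close> nonnegative, so \<open>\<bar>f\<bar> = f sgn (sin (N \<theta>))\<close> and the mass of \<open>f\<close> only
  involves its sine coefficients \<open>\<phi>\<close> at odd multiples of \<open>N\<close>. The Digamma function is the convex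
  solution of \<open>g x - g (x + 2 N) = 1 / (x + N)\<close>, which is what \<open>\<phi> n = 1 / n\<close> requires.
\<close>

lemma sylvester_weights:
  fixes N D :: nat
  assumes "N > 0"
  obtains M :: nat and w \<theta> :: "nat \<Rightarrow> real" where
    "\<forall>n::int. int N \<le> \<bar>n\<bar> \<longrightarrow> \<bar>n\<bar> \<le> int D \<longrightarrow> (\<Sum>m<M. w m * sin (of_int n * \<theta> m)) = 1 / of_int n"
    "(\<Sum>m<M. \<bar>w m\<bar>) \<le> pi / (2 * real N)"
proof -
  \<comment> \<open>\<open>R\<close> is past n + N for every n \<le> \<open>D\<close>, so cutting
    off at \<open>R\<close> leaves the prescribed coefficients intact. \<open>K\<close> exceeds the
    top frequency \<open>L\<close>, which keeps 2 L below \<open>M\<close> and prevents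
    aliasing.\<close>
  define R where "R = D + N + 1"
  define K where "K = R + N + 1"
  define M where "M = 2 * N * K"
  define L where "L = N + R"
  define \<theta> where "\<theta> m = 2 * pi * real m / real M" for m
  define g where "g x = - Digamma ((x + real N) / (2 * real N)) / (2 * real N)" for x :: real
  \<comment> \<open>Subtracting the value at \<open>R\<close> and clipping at 0 gives finite
    support; convexity survives because a maximum of convex sequences is convex.\<close>
  define G where "G n = max 0 (g (real n) - g (real R))" for n :: nat
  define \<phi> where "\<phi> n = G (nat \<bar>int n - int N\<bar>) - G (n + N)" for n :: nat
  define f where "f m = (\<Sum>n=1..L. \<phi> n * sin (real n * \<theta> m))" for m
  define s where "s m = sgn (sin (pi * real m / real K))" for m
  have N: "real N > 0" using assms by simp
  have K: "K > 0" by (simp add: K_def)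
  have M: "M > 0" using assms K by (simp add: M_def)
  have Lnk: "L < N * K" using assms unfolding L_def K_def by (cases N) auto
  have gstep: "g x - g (x + 2 * real N) = 1 / (x + real N)" if "x \<ge> 0" for x
  proof -
    have e: "(x + 2 * real N + real N) / (2 * real N) = (x + real N) / (2 * real N) + 1"
      using N by (simp add: field_simps)
    have nz: "(x + real N) / (2 * real N) \<noteq> 0" using N that by auto
    have "Digamma ((x + 2 * real N + real N) / (2 * real N)) = Digamma ((x + real N) / (2 * real N)) + 1 / ((x + real N) / (2 * real N))"
      unfolding e by (rule Digamma_plus1[OF nz])
    then show ?thesis unfolding g_def using N that by (simp add: field_simps)
  qed
  have ganti: "g y \<le> g x" if "0 \<le> x" "x \<le> y" for x y
    unfolding g_def using N that by (intro divide_right_mono) (auto intro!: Digamma_real_mono divide_right_mono)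
  have gconv: "2 * g (real n + 1) \<le> g (real n) + g (real n + 2)" for n
  proof -
    define x where "x = (real n + real N) / (2 * real N)"
    define h where "h = 1 / (2 * real N)"
    have e: "(real n + 1 + real N) / (2 * real N) = x + h" "(real n + 2 + real N) / (2 * real N) = x + 2 * h"
      unfolding x_def h_def using N by (simp_all add: field_simps)
    have "0 < x" "0 < h" using N by (auto simp: x_def h_def)
    from Digamma_midpoint[OF this] show ?thesis
      unfolding g_def e unfolding x_def[symmetric] using N by (simp add: field_simps)
  qed
  have Gz: "G n = 0" if "R \<le> n" for n
    using ganti[of "real R" "real n"] that by (simp add: G_def)
  have Gconv: "2 * G (n + 1) \<le> G n + G (n + 2)" for n
    using gconv[of n] by (auto simp: G_def max_def algebra_simps)
  have \<phi>1: "\<phi> n = 1 / real n" if "N \<le> n" "n \<le> D" for n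
  proof -
    have a: "nat \<bar>int n - int N\<bar> = n - N" using that by auto
    have "g (real R) \<le> g (real (n + N))" using that by (intro ganti) (auto simp: R_def)
    moreover have "g (real (n + N)) \<le> g (real (n - N))" by (intro ganti) auto
    moreover have "g (real (n - N)) - g (real (n + N)) = 1 / real n"
      using gstep[of "real (n - N)"] that by (simp add: of_nat_diff add.commute)
    ultimately show ?thesis unfolding \<phi>_def a by (simp add: G_def)
  qed
  \<comment> \<open>Beyond \<open>D\<close> the clipping can only shrink the difference. An upper
    bound is enough there, since the cotangents that multiply these coefficients are
    nonnegative.\<close>
  have \<phi>2: "\<phi> n \<le> 1 / real n" if "N \<le> n" for n
  proof -
    have a: "nat \<bar>int n - int N\<bar> = n - N" using that by auto
    have "g (real (n - N)) - g (real (n + N)) = 1 / real n"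
      using gstep[of "real (n - N)"] that by (simp add: of_nat_diff add.commute)
    moreover have "g (real (n + N)) \<le> g (real (n - N))" by (intro ganti) auto
    ultimately show ?thesis unfolding \<phi>_def a G_def by linarith
  qed
  have f_eq: "f m = sin (real N * \<theta> m) * (G 0 + 2 * (\<Sum>r=1..R. G r * cos (real r * \<theta> m)))" for m
    unfolding f_def \<phi>_def L_def by (rule sin_times_cosine_sum[symmetric]) (rule Gz)
  have Nth: "real N * \<theta> m = pi * real m / real K" for m
    unfolding \<theta>_def M_def using N K by (simp add: field_simps)
  have fabs: "\<bar>f m\<bar> = f m * s m" for m
  proof -
    have p: "0 \<le> G 0 + 2 * (\<Sum>r=1..R. G r * cos (real r * \<theta> m))"
      by (rule fejer_convex_nonneg[OF Gconv Gz])
    have "\<bar>f m\<bar> = \<bar>sin (real N * \<theta> m)\<bar> * (G 0 + 2 * (\<Sum>r=1..R. G r * cos (real r * \<theta> m)))"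
      unfolding f_eq abs_mult using p by simp
    also have "\<dots> = f m * s m"
      unfolding f_eq s_def Nth by (simp add: abs_sgn mult_ac)
    finally show ?thesis .
  qed
  have coef: "(\<Sum>m<M. f m * sin (real k * \<theta> m)) = (if k \<in> {1..L} then \<phi> k * (real M / 2) else 0)"
    if "0 < k" "k \<le> L" for k
  proof -
    have LM: "2 * L < M" using Lnk unfolding M_def by simp
    have "(\<Sum>m<M. f m * sin (real k * \<theta> m))
      = (\<Sum>n=1..L. \<phi> n * (\<Sum>m<M. sin (real n * \<theta> m) * sin (real k * \<theta> m)))"
      unfolding f_def sum_distrib_right sum_distrib_left by (subst sum.swap) (simp add: mult_ac)
    also have "\<dots> = (\<Sum>n=1..L. \<phi> n * (if n = k then real M / 2 else 0))"
      unfolding \<theta>_def using that LM by (intro sum.cong refl arg_cong2[of _ _ _ _ "(*)"] sum_sin_sin_period) auto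
    also have "\<dots> = (\<Sum>n=1..L. if n = k then \<phi> n * (real M / 2) else 0)"
      by (intro sum.cong) auto
    finally show ?thesis by (simp add: sum.delta)
  qed
  have "(\<Sum>m<M. \<bar>f m\<bar>) = (\<Sum>n=1..L. \<phi> n * (\<Sum>m<M. sin (real n * \<theta> m) * s m))"
    unfolding fabs unfolding f_def sum_distrib_right sum_distrib_left by (subst sum.swap) (simp add: mult_ac)
  also have "\<dots> = (\<Sum>n=1..L. \<phi> n * (if N dvd n \<and> odd (n div N) then 2 * real N * cot (pi * real (n div N) / (2 * real K)) else 0))"
    unfolding \<theta>_def s_def M_def using Lnk
    by (intro sum.cong refl arg_cong2[of _ _ _ _ "(*)"] sum_sin_square_wave assms K) auto
  also have "\<dots> = (\<Sum>n\<in>(\<lambda>k. N * k) ` {k. odd k \<and> k \<le> L div N}. \<phi> n * (2 * real N * cot (pi * real (n div N) / (2 * real K))))"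
  proof (intro sum.mono_neutral_cong_right ballI)
    show "(\<lambda>k. N * k) ` {k. odd k \<and> k \<le> L div N} \<subseteq> {1..L}"
    proof clarify
      fix k assume k: "odd k" "k \<le> L div N"
      have "N * k \<le> L" using k(2) by (metis div_le_mono2 le_trans mult.commute mult_le_mono1 div_times_less_eq_dividend)
      moreover have "k \<noteq> 0" using k by (auto elim: oddE)
      ultimately show "N * k \<in> {1..L}" using assms by (simp add: Suc_le_eq)
    qed
  next
    fix n assume n: "n \<in> {1..L} - (\<lambda>k. N * k) ` {k. odd k \<and> k \<le> L div N}"
    then have "\<not> (N dvd n \<and> odd (n div N))"
      by (auto elim!: dvdE simp: image_iff div_le_mono) (metis assms div_le_mono nonzero_mult_div_cancel_left less_numeral_extra(3))
    then show "\<phi> n * (if N dvd n \<and> odd (n div N) then 2 * real N * cot (pi * real (n div N) / (2 * real K)) else 0) = 0" by auto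
  qed (use assms in auto)
  also have "\<dots> = (\<Sum>k\<in>{k. odd k \<and> k \<le> L div N}. \<phi> (N * k) * (2 * real N * cot (pi * real k / (2 * real K))))"
    by (subst sum.reindex) (use assms in \<open>auto simp: inj_on_def\<close>)
  also have "\<dots> \<le> (\<Sum>k\<in>{k. odd k \<and> k \<le> L div N}. (4 * real K / pi) * (1 / (real k)^2))"
  proof (intro sum_mono)
    fix k assume "k \<in> {k. odd k \<and> k \<le> L div N}"
    then have k: "odd k" "k \<le> L div N" by auto
    have k0: "k > 0" using k by (auto elim: oddE)
    have "L div N < K" using Lnk assms by (simp add: less_mult_imp_div_less mult.commute)
    then have kK: "k < K" using k by simp
    have x: "0 < pi * real k / (2 * real K)" "pi * real k / (2 * real K) < pi / 2"
      using k0 kK by (auto simp: field_simps)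
    have c0: "0 \<le> cot (pi * real k / (2 * real K))"
      using x by (simp add: cot_def cos_ge_zero sin_ge_zero)
    have "\<phi> (N * k) * (2 * real N * cot (pi * real k / (2 * real K)))
      \<le> (1 / real (N * k)) * (2 * real N * cot (pi * real k / (2 * real K)))"
      using k0 c0 N by (intro mult_right_mono \<phi>2) auto
    also have "\<dots> \<le> (1 / real (N * k)) * (2 * real N * (1 / (pi * real k / (2 * real K))))"
      using cot_le_inverse[OF x] N by (intro mult_left_mono) auto
    also have "\<dots> = (4 * real K / pi) * (1 / (real k)^2)"
      using N k0 by (simp add: field_simps power2_eq_square)
    finally show "\<phi> (N * k) * (2 * real N * cot (pi * real k / (2 * real K))) \<le> (4 * real K / pi) * (1 / (real k)^2)" .
  qed
  also have "\<dots> \<le> (4 * real K / pi) * (pi^2 / 8)"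
    unfolding sum_distrib_left[symmetric]
    using sum_inverse_odd_squares_le[of "Suc (L div N)"] by (intro mult_left_mono) (auto simp: less_Suc_eq_le)
  finally have fs: "(\<Sum>m<M. \<bar>f m\<bar>) \<le> pi * real K / 2" by (simp add: power2_eq_square)
  define w where "w m = 2 / real M * f m" for m
  have pos: "(\<Sum>m<M. w m * sin (real k * \<theta> m)) = 1 / real k" if "N \<le> k" "k \<le> D" for k
  proof -
    have k: "0 < k" "k \<le> L" using that assms by (auto simp: L_def R_def)
    have "(\<Sum>m<M. w m * sin (real k * \<theta> m)) = 2 / real M * (\<Sum>m<M. f m * sin (real k * \<theta> m))"
      by (simp add: w_def sum_distrib_left mult_ac)
    then show ?thesis unfolding coef[OF k] using k M \<phi>1[OF that] by simp
  qed
  show thesis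
  proof (rule that, intro allI impI)
    fix n :: int assume n: "int N \<le> \<bar>n\<bar>" "\<bar>n\<bar> \<le> int D"
    show "(\<Sum>m<M. w m * sin (of_int n * \<theta> m)) = 1 / of_int n"
    proof (cases "n \<ge> 0")
      case True
      then obtain k where "n = int k" using nonneg_int_cases by blast
      then show ?thesis using pos[of k] n by simp
    next
      case False
      then obtain k where "n = - int k" by (metis int_cases2 of_nat_0_le_iff)
      then show ?thesis using pos[of k] n by (simp add: sum_negf)
    qed
  next
    have "(\<Sum>m<M. \<bar>w m\<bar>) = 2 / real M * (\<Sum>m<M. \<bar>f m\<bar>)"
      by (simp add: w_def abs_mult sum_distrib_left)
    also have "\<dots> \<le> 2 / real M * (pi * real K / 2)" using fs by (intro mult_left_mono) auto
    also have "\<dots> = pi / (2 * real N)" unfolding M_def using N K by (simp add: field_simps)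
    finally show "(\<Sum>m<M. \<bar>w m\<bar>) \<le> pi / (2 * real N)" .
  qed
qed

section \<open>Sylvester equations on an integer grid\<close>

lemma norm_sum_orthogonal:
  fixes u :: "'i \<Rightarrow> 'a::real_inner"
  assumes "finite J" "\<And>i j. i \<in> J \<Longrightarrow> j \<in> J \<Longrightarrow> i \<noteq> j \<Longrightarrow> inner (u i) (u j) = 0"
  shows "(norm (\<Sum>i\<in>J. u i))^2 = (\<Sum>i\<in>J. (norm (u i))^2)"
proof -
  have "(norm (\<Sum>i\<in>J. u i))^2 = (\<Sum>i\<in>J. \<Sum>j\<in>J. inner (u i) (u j))"
    unfolding power2_norm_eq_inner inner_sum_left by (simp only: inner_sum_right)
  also have "\<dots> = (\<Sum>i\<in>J. \<Sum>j\<in>J. if j = i then inner (u i) (u i) else 0)"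
    using assms(2) by (intro sum.cong) auto
  also have "\<dots> = (\<Sum>i\<in>J. (norm (u i))^2)"
    using assms(1) by (simp add: power2_norm_eq_inner)
  finally show ?thesis .
qed

text \<open>The task is to divide the matrix of \<open>Z\<close> entrywise by i - j without losing
  control of the norm. Once 1 / (i - j) is a combination of sin((i - j) \<theta>), the addition
  formula separates the two indices, and for each \<theta> only \<open>Z\<close> between modulated
  copies of the two sums is left. Modulation by sine and cosine together preserves the norm, so the
  cost is \<open>C\<close> times the mass of the weights, whatever the size of
  \<open>J\<close>.\<close>

lemma sylvester_sum_bound:
  fixes u v :: "int \<Rightarrow> 'a::real_inner" and Z :: "'a \<Rightarrow> 'a"
  assumes J: "finite J" and N: "N > 0"
    and u: "\<And>i j. i \<in> J \<Longrightarrow> j \<in> J \<Longrightarrow> i \<noteq> j \<Longrightarrow> inner (u i) (u j) = 0"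
    and v: "\<And>i j. i \<in> J \<Longrightarrow> j \<in> J \<Longrightarrow> i \<noteq> j \<Longrightarrow> inner (v i) (v j) = 0"
    and Z: "linear Z" "\<And>x. norm (Z x) \<le> C * norm x"
    and eq: "\<And>i j. i \<in> J \<Longrightarrow> j \<in> J \<Longrightarrow> inner (u i) (Z (v j)) = of_int (i - j) * inner (u i) (v j)"
    and gap: "\<And>i j. i \<in> J \<Longrightarrow> j \<in> J \<Longrightarrow> u i \<noteq> 0 \<Longrightarrow> v j \<noteq> 0 \<Longrightarrow> int N \<le> \<bar>i - j\<bar>"
  shows "\<bar>inner (\<Sum>i\<in>J. u i) (\<Sum>j\<in>J. v j)\<bar>
    \<le> pi / (2 * real N) * C * norm (\<Sum>i\<in>J. u i) * norm (\<Sum>j\<in>J. v j)"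
proof -
  have "bdd_above ((\<lambda>(i, j). \<bar>i - j\<bar>) ` (J \<times> J))" using J by (intro bdd_above_finite) auto
  then obtain b where "\<forall>x\<in>J \<times> J. (\<lambda>(i, j). \<bar>i - j\<bar>) x \<le> b" unfolding bdd_above_def by blast
  then have b: "\<bar>i - j\<bar> \<le> b" if "i \<in> J" "j \<in> J" for i j using that by auto
  obtain w \<theta> :: "nat \<Rightarrow> real" and M :: nat where
      w: "\<forall>n::int. int N \<le> \<bar>n\<bar> \<longrightarrow> \<bar>n\<bar> \<le> int (nat b) \<longrightarrow> (\<Sum>m<M. w m * sin (of_int n * \<theta> m)) = 1 / of_int n"
    and wb: "(\<Sum>m<M. \<bar>w m\<bar>) \<le> pi / (2 * real N)"
    by (rule sylvester_weights[OF N, of "nat b"]) (rule that)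
  define U where "U c m = (\<Sum>i\<in>J. c (of_int i * \<theta> m) *\<^sub>R u i)" for c :: "real \<Rightarrow> real" and m :: nat
  define W where "W c m = (\<Sum>i\<in>J. c (of_int i * \<theta> m) *\<^sub>R v i)" for c :: "real \<Rightarrow> real" and m :: nat
  define nu nv where "nu = norm (\<Sum>i\<in>J. u i)" and "nv = norm (\<Sum>j\<in>J. v j)"
  have C: "0 \<le> C" if "x \<noteq> 0" for x :: 'a
    using order_trans[OF norm_ge_zero Z(2)[of x]] that by (simp add: zero_le_mult_iff)
  have pythagoras: "(norm (\<Sum>i\<in>J. sin (of_int i * \<theta> m) *\<^sub>R z i))^2 + (norm (\<Sum>i\<in>J. cos (of_int i * \<theta> m) *\<^sub>R z i))^2
      = (norm (\<Sum>i\<in>J. z i))^2"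
    if z: "\<And>i j. i \<in> J \<Longrightarrow> j \<in> J \<Longrightarrow> i \<noteq> j \<Longrightarrow> inner (z i) (z j) = 0" for z :: "int \<Rightarrow> 'a" and m
  proof -
    have "(norm (\<Sum>i\<in>J. c (of_int i * \<theta> m) *\<^sub>R z i))^2 = (\<Sum>i\<in>J. (c (of_int i * \<theta> m))^2 * (norm (z i))^2)" for c
      by (subst norm_sum_orthogonal) (auto simp: J z power_mult_distrib)
    moreover have "(norm (\<Sum>i\<in>J. z i))^2 = (\<Sum>i\<in>J. (norm (z i))^2)" by (rule norm_sum_orthogonal[OF J z])
    ultimately show ?thesis by (simp add: sum.distrib[symmetric] distrib_right[symmetric])
  qed
  have Un: "(norm (U sin m))^2 + (norm (U cos m))^2 = nu^2" for m
    unfolding U_def nu_def by (rule pythagoras) (rule u)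
  have Wn: "(norm (W sin m))^2 + (norm (W cos m))^2 = nv^2" for m
    unfolding W_def nv_def by (rule pythagoras) (rule v)
  have ZW: "Z (W c m) = (\<Sum>j\<in>J. c (of_int j * \<theta> m) *\<^sub>R Z (v j))" for c m
    unfolding W_def by (simp add: linear_sum[OF Z(1)] linear_scale[OF Z(1)])
  have UZW: "inner (U c m) (Z (W d m)) = (\<Sum>i\<in>J. \<Sum>j\<in>J. c (of_int i * \<theta> m) * d (of_int j * \<theta> m) * inner (u i) (Z (v j)))"
    for c d m
    unfolding ZW unfolding U_def inner_sum_left by (simp add: inner_sum_right sum_distrib_left mult_ac)
  define B where "B m = inner (U sin m) (Z (W cos m)) - inner (U cos m) (Z (W sin m))" for m
  have Bs: "B m = (\<Sum>i\<in>J. \<Sum>j\<in>J. sin (of_int (i - j) * \<theta> m) * inner (u i) (Z (v j)))" for m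
    unfolding B_def UZW sum_subtractf[symmetric]
    by (intro sum.cong refl) (simp add: sin_diff algebra_simps)
  have Bb: "\<bar>B m\<bar> \<le> C * nu * nv" for m
  proof -
    define a b c d where "a = norm (U sin m)" and "b = norm (U cos m)" and "c = norm (W cos m)" and "d = norm (W sin m)"
    have "\<bar>inner (U c m) (Z (W d m))\<bar> \<le> C * (norm (U c m) * norm (W d m))" for c d
    proof -
      have "\<bar>inner (U c m) (Z (W d m))\<bar> \<le> norm (U c m) * norm (Z (W d m))" by (rule Cauchy_Schwarz_ineq2)
      also have "\<dots> \<le> norm (U c m) * (C * norm (W d m))" by (intro mult_left_mono Z) auto
      finally show ?thesis by (simp add: mult_ac)
    qed
    from this[of sin cos] this[of cos sin] have "\<bar>B m\<bar> \<le> C * (a * c + b * d)"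
      unfolding B_def a_def b_def c_def d_def by (simp add: distrib_left)
    also have "\<dots> \<le> C * (nu * nv)"
    proof (cases "\<exists>x::'a. x \<noteq> 0")
      case True
      have "(a * c + b * d)^2 \<le> (a^2 + b^2) * (c^2 + d^2)"
        using zero_le_power2[of "a * d - b * c"] by (simp add: power2_eq_square algebra_simps)
      also have "\<dots> = (nu * nv)^2"
        using Un[of m] Wn[of m] by (simp add: a_def b_def c_def d_def power_mult_distrib add.commute)
      finally have "a * c + b * d \<le> nu * nv"
        by (rule power2_le_imp_le) (simp add: nu_def nv_def)
      then show ?thesis using C True by (intro mult_left_mono) auto
    next
      \<comment> \<open>In the zero space the bound on \<open>Z\<close> does not fix the sign of
        \<open>C\<close>, but there all norms vanish.\<close>
      case False
      then have nz: "norm x = 0" for x :: 'a by (metis norm_zero)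
      show ?thesis unfolding a_def b_def c_def d_def nu_def nv_def nz by simp
    qed
    finally show ?thesis by (simp add: mult_ac)
  qed
  have "inner (\<Sum>i\<in>J. u i) (\<Sum>j\<in>J. v j) = (\<Sum>i\<in>J. \<Sum>j\<in>J. inner (u i) (v j))"
    unfolding inner_sum_left by (simp only: inner_sum_right)
  also have "\<dots> = (\<Sum>i\<in>J. \<Sum>j\<in>J. \<Sum>m<M. w m * (sin (of_int (i - j) * \<theta> m) * inner (u i) (Z (v j))))"
  proof (intro sum.cong refl)
    fix i j assume ij: "i \<in> J" "j \<in> J"
    show "inner (u i) (v j) = (\<Sum>m<M. w m * (sin (of_int (i - j) * \<theta> m) * inner (u i) (Z (v j))))"
    proof (cases "u i = 0 \<or> v j = 0")
      case True
      then show ?thesis by (auto simp: linear_0[OF Z(1)])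
    next
      case False
      then have g: "int N \<le> \<bar>i - j\<bar>" using gap ij by auto
      have "(\<Sum>m<M. w m * (sin (of_int (i - j) * \<theta> m) * inner (u i) (Z (v j))))
        = (\<Sum>m<M. w m * sin (of_int (i - j) * \<theta> m)) * inner (u i) (Z (v j))"
        by (simp only: sum_distrib_right mult.assoc)
      also have "\<dots> = 1 / of_int (i - j) * (of_int (i - j) * inner (u i) (v j))"
      proof -
        have "\<bar>i - j\<bar> \<le> int (nat b)" using b[OF ij] by (simp add: order_trans[OF abs_ge_zero])
        from w[rule_format, OF g this] show ?thesis by (simp only: eq[OF ij])
      qed
      also have "\<dots> = inner (u i) (v j)" using g N by simp
      finally show ?thesis by simp
    qed
  qed
  also have "\<dots> = (\<Sum>m<M. w m * B m)"
  proof -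
    have "(\<Sum>i\<in>J. \<Sum>j\<in>J. \<Sum>m<M. h i j m) = (\<Sum>m<M. \<Sum>i\<in>J. \<Sum>j\<in>J. h i j m)" for h :: "int \<Rightarrow> int \<Rightarrow> nat \<Rightarrow> real"
      by (simp only: sum.swap[where A = "{..<M}" and B = J])
    then show ?thesis unfolding Bs by (simp add: sum_distrib_left)
  qed
  finally have "\<bar>inner (\<Sum>i\<in>J. u i) (\<Sum>j\<in>J. v j)\<bar> \<le> (\<Sum>m<M. \<bar>w m\<bar> * \<bar>B m\<bar>)"
    by (metis (no_types, lifting) abs_mult sum.cong sum_abs)
  also have "\<dots> \<le> (\<Sum>m<M. \<bar>w m\<bar>) * (C * nu * nv)"
    unfolding sum_distrib_right by (intro sum_mono mult_left_mono Bb) auto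
  also have "\<dots> \<le> pi / (2 * real N) * (C * nu * nv)"
    using wb Bb[of 0] by (intro mult_right_mono) (auto intro: order_trans[OF abs_ge_zero])
  finally show ?thesis by (simp add: nu_def nv_def mult_ac)
qed

section \<open>Projection-valued measures\<close>

lemma selfadjoint_op_inner: "selfadjoint_op T \<Longrightarrow> inner (T x) y = inner x (T y)"
  unfolding selfadjoint_op_def by (metis Re_cinner)

text \<open>Testing the form at u + w and u - w, where w is T u rescaled to the length of u, gives
  the operator bound with the same \<open>r\<close> by polarization and the parallelogram law. The
  invariant subspace \<open>W\<close> will be the range of a spectral projection, the only place
  where the form is controlled.\<close>

lemma norm_le_numerical_radius:
  fixes T :: "'a::real_inner \<Rightarrow> 'a"
  assumes W: "subspace W" and T: "linear T" "\<And>x y. inner (T x) y = inner x (T y)"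
    and inv: "\<And>v. v \<in> W \<Longrightarrow> T v \<in> W"
    and r: "\<And>v. v \<in> W \<Longrightarrow> \<bar>inner v (T v)\<bar> \<le> r * (norm v)^2"
    and u: "u \<in> W"
  shows "norm (T u) \<le> r * norm u"
proof (cases "T u = 0 \<or> u = 0")
  case True
  show ?thesis
  proof (cases "u = 0")
    case False
    then have "0 \<le> r * (norm u)^2" using r[OF u] by linarith
    then have "0 \<le> r" using False by (simp add: zero_le_mult_iff)
    then show ?thesis using True False by auto
  qed (simp add: linear_0[OF T(1)])
next
  case False
  define w where "w = (norm u / norm (T u)) *\<^sub>R T u"
  have w: "w \<in> W" unfolding w_def by (intro subspace_scale W inv u)
  have nw: "norm w = norm u" unfolding w_def using False by simp
  have i: "inner (T u) w = norm u * norm (T u)"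
    unfolding w_def using False by (simp add: power2_norm_eq_inner[symmetric] power2_eq_square)
  have a: "T (u + w) = T u + T w" "T (u - w) = T u - T w"
    by (simp_all add: linear_add[OF T(1)] linear_diff[OF T(1)])
  have "4 * inner (T u) w = inner (u + w) (T (u + w)) - inner (u - w) (T (u - w))"
    unfolding a using T(2)[of u w] inner_commute[of w "T u"] by (simp add: inner_simps)
  also have "\<dots> \<le> r * (norm (u + w))^2 + r * (norm (u - w))^2"
  proof -
    have "inner (u + w) (T (u + w)) \<le> r * (norm (u + w))^2"
      by (rule order_trans[OF abs_ge_self r[OF subspace_add[OF W u w]]])
    moreover have "- inner (u - w) (T (u - w)) \<le> r * (norm (u - w))^2"
      by (rule order_trans[OF abs_ge_minus_self r[OF subspace_diff[OF W u w]]])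
    ultimately show ?thesis by linarith
  qed
  also have "\<dots> = r * (2 * (norm u)^2 + 2 * (norm w)^2)"
  proof -
    have "(norm (u + w))^2 + (norm (u - w))^2 = 2 * (norm u)^2 + 2 * (norm w)^2"
      by (simp add: power2_norm_eq_inner inner_simps inner_commute[of w u])
    then show ?thesis by (simp only: distrib_left[symmetric])
  qed
  finally have "norm u * norm (T u) \<le> norm u * (r * norm u)"
    unfolding i nw by (simp add: power2_eq_square algebra_simps)
  then show ?thesis using False by simp
qed

lemma selfadjoint_op_eqI:
  fixes S T :: "'a::chilbert_space \<Rightarrow>\<^sub>L 'a"
  assumes "selfadjoint_op S" "selfadjoint_op T" "\<And>x. inner x (S x) = inner x (T x)"
  shows "S = T"
proof (rule blinfun_eqI)
  fix x
  have "norm (blinfun_apply (S - T) x) \<le> 0 * norm x"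
  proof (rule norm_le_numerical_radius[of UNIV])
    show "linear (blinfun_apply (S - T))"
      by (intro bounded_linear.linear blinfun.bounded_linear_right)
  qed (auto simp: blinfun.bilinear_simps inner_simps assms(3) selfadjoint_op_inner[OF assms(1)]
         selfadjoint_op_inner[OF assms(2)])
  then show "S x = T x" by (simp add: blinfun.bilinear_simps)
qed

context
  fixes P :: "'a::chilbert_space \<Rightarrow>\<^sub>L 'a"
  assumes P: "orthogonal_projection P"
begin

lemma orthogonal_projection_inner: "inner (P x) y = inner x (P y)"
  using P unfolding orthogonal_projection_def by (intro selfadjoint_op_inner) simp

lemma orthogonal_projection_idem: "P (P x) = P x"
  using P unfolding orthogonal_projection_def by (metis blinfun_apply_blinfun_compose)

lemma orthogonal_projection_inner_self: "inner x (P x) = (norm (P x))^2"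
  by (metis orthogonal_projection_idem orthogonal_projection_inner power2_norm_eq_inner)

lemma orthogonal_projection_norm_le: "norm (P x) \<le> norm x"
proof -
  have "(norm (P x))^2 \<le> norm x * norm (P x)"
    unfolding orthogonal_projection_inner_self[symmetric] by (rule norm_cauchy_schwarz)
  then show ?thesis by (cases "norm (P x) = 0") (auto simp: power2_eq_square)
qed

end

locale spectral_resolution =
  fixes B :: "'a::chilbert_space \<Rightarrow>\<^sub>L 'a" and E :: "real set \<Rightarrow> 'a \<Rightarrow>\<^sub>L 'a"
  assumes selfadjoint: "selfadjoint_op B" and resolution: "is_spectral_measure B E"
begin

lemma pvm: "projection_valued_measure E"
  using resolution unfolding is_spectral_measure_def by simp

lemma projection: "\<Delta> \<in> sets borel \<Longrightarrow> orthogonal_projection (E \<Delta>)"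
  using pvm unfolding projection_valued_measure_def by simp

lemmas inner_E = orthogonal_projection_inner[OF projection]
lemmas E_idem = orthogonal_projection_idem[OF projection]
lemmas inner_E_self = orthogonal_projection_inner_self[OF projection]
lemmas norm_E_le = orthogonal_projection_norm_le[OF projection]

lemma E_UNIV: "E UNIV x = x"
  using pvm unfolding projection_valued_measure_def by simp

lemma E_sums:
  "range S \<subseteq> sets borel \<Longrightarrow> disjoint_family S \<Longrightarrow> (\<lambda>n. E (S n) x) sums E (\<Union>n. S n) x"
  using pvm unfolding projection_valued_measure_def by blast

text \<open>Countable additivity over copies of the empty set makes a constant sequence summable, so
  the constant is 0. Finite additivity depends on this.\<close>

lemma E_empty: "E {} x = 0"
proof -
  have "(\<lambda>n::nat. E {} x) sums E (\<Union>n::nat. {}) x"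
    by (rule E_sums) (auto simp: disjoint_family_on_def)
  then have "(\<lambda>n::nat. E {} x) \<longlonglongrightarrow> 0" by (intro summable_LIMSEQ_zero) (rule sums_summable)
  then show ?thesis by (simp add: LIMSEQ_const_iff)
qed

lemma E_Un:
  assumes "S \<in> sets borel" "T \<in> sets borel" "S \<inter> T = {}"
  shows "E (S \<union> T) x = E S x + E T x"
proof -
  have "(\<lambda>n. E (binaryset S T n) x) sums E (\<Union>n. binaryset S T n) x"
    by (rule E_sums) (use assms in \<open>auto simp: range_binaryset_eq disjoint_family_on_def binaryset_def\<close>)
  moreover have "(\<lambda>n. E (binaryset S T n) x) sums (E S x + E T x)"
    by (rule binaryset_sums[where f = "\<lambda>S. E S x"]) (rule E_empty)
  ultimately show ?thesis by (simp add: UN_binaryset_eq sums_unique2)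
qed

lemma E_Compl: "S \<in> sets borel \<Longrightarrow> E (- S) x = x - E S x"
  using E_Un[of S "- S" x] by (simp add: E_UNIV borel_comp) (metis add_diff_cancel_left')

text \<open>Multiplicativity is not part of the definition, but additivity forces it: for u in the
  range of \<open>E T\<close>, the form of \<open>E (S \<union> T)\<close> at u is |E S u|^2 +
  |u|^2, and for a projection it cannot exceed |u|^2.\<close>

lemma E_disjoint:
  assumes "S \<in> sets borel" "T \<in> sets borel" "S \<inter> T = {}"
  shows "E S (E T x) = 0"
proof -
  define u where "u = E T x"
  have u: "E T u = u" by (simp add: u_def E_idem assms)
  have "(norm (E S u))^2 + (norm u)^2 = inner u (E (S \<union> T) u)"
    by (simp add: E_Un assms inner_add_right inner_E_self u power2_norm_eq_inner[of u])
  also have "\<dots> \<le> norm u * norm (E (S \<union> T) u)" by (rule norm_cauchy_schwarz)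
  also have "\<dots> \<le> norm u * norm u" using assms by (intro mult_left_mono norm_E_le) auto
  finally have "(norm (E S u))^2 \<le> 0" by (simp add: power2_eq_square)
  then show ?thesis by (simp add: u_def)
qed

lemma E_E:
  assumes "S \<in> sets borel" "T \<in> sets borel"
  shows "E S (E T x) = E (S \<inter> T) x"
proof -
  have "E T x = E (S \<inter> T) x + E (T - S) x"
    using E_Un[of "S \<inter> T" "T - S" x] assms by (simp add: Int_Diff_Un Un_Diff_Int Int_commute Int_Diff_disjoint sets.Diff sets.Int) (smt (verit) Diff_disjoint Int_Diff_Un Int_Diff_disjoint Int_commute)
  moreover have "E S (E (T - S) x) = 0" using assms by (intro E_disjoint) auto
  moreover have "E S (E (S \<inter> T) x) = E (S \<inter> T) x"
  proof -
    have "E S y = E (S \<inter> T) y + E (S - T) y" for y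
    proof -
      have "S = (S \<inter> T) \<union> (S - T)" by auto
      then show ?thesis using E_Un[of "S \<inter> T" "S - T" y] assms by auto
    qed
    moreover have "E (S - T) (E (S \<inter> T) x) = 0" using assms by (intro E_disjoint) auto
    ultimately show ?thesis using assms by (simp add: E_idem)
  qed
  ultimately show ?thesis by (simp add: blinfun.add_right)
qed

lemma E_mono:
  assumes "S \<in> sets borel" "T \<in> sets borel" "S \<subseteq> T" "E S x = x"
  shows "E T x = x"
proof -
  have "E T (E S x) = E S x" using assms(1-3) by (simp add: E_E Int_absorb1)
  then show ?thesis unfolding assms(4) .
qed

lemma E_UN:
  assumes "finite J" "\<And>j. j \<in> J \<Longrightarrow> S j \<in> sets borel" "disjoint_family_on S J"
  shows "E (\<Union>j\<in>J. S j) x = (\<Sum>j\<in>J. E (S j) x)"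
  using assms
proof (induction J rule: finite_induct)
  case (insert j J)
  have "S j \<inter> (\<Union>j\<in>J. S j) = {}" using insert by (auto simp: disjoint_family_on_def)
  then have "E (S j \<union> (\<Union>j\<in>J. S j)) x = E (S j) x + E (\<Union>j\<in>J. S j) x"
    using insert by (intro E_Un) auto
  then show ?case using insert by (simp add: disjoint_family_on_def)
qed (simp add: E_empty)

abbreviation \<mu> :: "'a \<Rightarrow> real measure" where "\<mu> x \<equiv> scalar_measure E x"

lemma sets_scalar_measure [simp, measurable_cong]: "sets (\<mu> x) = sets borel"
  unfolding scalar_measure_def by (simp add: sets.sigma_sets_eq[of borel, simplified])

lemma space_scalar_measure [simp]: "space (\<mu> x) = UNIV"
  unfolding scalar_measure_def by (simp add: space_measure_of_conv)

lemma emeasure_scalar_measure: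
  assumes "\<Delta> \<in> sets borel"
  shows "emeasure (\<mu> x) \<Delta> = ennreal ((norm (E \<Delta> x))^2)"
proof -
  have "emeasure (\<mu> x) \<Delta> = ennreal (Re (cinner x (E \<Delta> x)))"
  proof (rule emeasure_measure_of[OF scalar_measure_def])
    show "positive (sets (\<mu> x)) (\<lambda>\<Delta>. ennreal (Re (cinner x (E \<Delta> x))))"
      by (simp add: positive_def Re_cinner E_empty)
    show "countably_additive (sets (\<mu> x)) (\<lambda>\<Delta>. ennreal (Re (cinner x (E \<Delta> x))))"
    proof (rule countably_additiveI)
      fix S :: "nat \<Rightarrow> real set"
      assume S: "range S \<subseteq> sets (\<mu> x)" "disjoint_family S"
      then have "(\<lambda>n. inner x (E (S n) x)) sums inner x (E (\<Union>n. S n) x)"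
        by (intro bounded_linear.sums[OF bounded_linear_inner_right] E_sums) simp_all
      then show "(\<Sum>n. ennreal (Re (cinner x (E (S n) x)))) = ennreal (Re (cinner x (E (\<Union>n. S n) x)))"
        unfolding Re_cinner using S by (intro suminf_ennreal_eq) (auto simp: inner_E_self)
    qed
  qed (use assms in auto)
  then show ?thesis using assms by (simp add: Re_cinner inner_E_self)
qed

lemma finite_scalar_measure: "finite_measure (\<mu> x)"
  by (rule finite_measureI) (simp add: emeasure_scalar_measure)

lemma measure_scalar_measure: "\<Delta> \<in> sets borel \<Longrightarrow> measure (\<mu> x) \<Delta> = (norm (E \<Delta> x))^2"
  by (simp add: measure_def emeasure_scalar_measure)

section \<open>The quadratic form of \<open>B\<close> on spectral subspaces\<close>

lemma has_integral_quadratic_form: "has_bochner_integral (\<mu> x) (\<lambda>t. t) (inner x (B x))"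
proof -
  have "has_bochner_integral (\<mu> x) complex_of_real (cinner x (B x))"
    using resolution unfolding is_spectral_measure_def by simp
  from has_bochner_integral_bounded_linear[OF bounded_linear_Re this]
  show ?thesis by (simp add: Re_cinner)
qed

text \<open>Only the diagonal of the form of \<open>B\<close> is given as an integral. All cross
  terms between u and w under \<open>E\<close> vanish, so u + w and u - w have the same scalar
  measure and the same diagonal value; the difference of the two values is four times the cross term
  of \<open>B\<close>.\<close>

lemma inner_B_cross:
  assumes S: "S \<in> sets borel" and u: "E S u = u" and w: "E (- S) w = w"
  shows "inner u (B w) = 0"
proof -
  have cross: "inner u (E \<Delta> w) = 0" if "\<Delta> \<in> sets borel" for \<Delta>
  proof -
    have "inner u (E \<Delta> w) = inner u (E S (E \<Delta> (E (- S) w)))"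
      using inner_E[OF S, of u] u w by simp
    also have "E S (E \<Delta> (E (- S) w)) = E (S \<inter> (\<Delta> \<inter> - S)) w"
      using S that by (simp add: E_E borel_comp)
    also have "S \<inter> (\<Delta> \<inter> - S) = {}" by auto
    finally show ?thesis by (simp add: E_empty)
  qed
  have "\<mu> (u + w) = \<mu> (u - w)"
  proof (rule measure_eqI)
    fix \<Delta> assume "\<Delta> \<in> sets (\<mu> (u + w))"
    then have D: "\<Delta> \<in> sets borel" by simp
    have "inner w (E \<Delta> u) = 0" using cross[OF D] inner_E[OF D, of w u] by (simp add: inner_commute)
    then show "emeasure (\<mu> (u + w)) \<Delta> = emeasure (\<mu> (u - w)) \<Delta>"
      unfolding emeasure_scalar_measure[OF D] inner_E_self[OF D, symmetric]
      by (simp add: blinfun.bilinear_simps inner_simps cross[OF D])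
  qed simp
  then have "inner (u + w) (B (u + w)) = inner (u - w) (B (u - w))"
    using has_integral_quadratic_form[of "u + w"] has_integral_quadratic_form[of "u - w"]
    by (metis has_bochner_integral_eq)
  then show ?thesis
    using selfadjoint_op_inner[OF selfadjoint, of u w]
    by (simp add: blinfun.bilinear_simps inner_simps inner_commute)
qed

lemma B_E:
  assumes S: "S \<in> sets borel"
  shows "B (E S x) = E S (B x)"
proof -
  have C: "- S \<in> sets borel" using S by (simp add: borel_comp)
  have 1: "E S (B (E (- S) y)) = 0" for y
  proof -
    have "inner (E S z) (B (E (- S) y)) = 0" for z
      using S C by (intro inner_B_cross[OF S]) (auto simp: E_idem)
    then have "inner z (E S (B (E (- S) y))) = 0" for z using inner_E[OF S] by simp
    then show ?thesis by (metis inner_eq_zero_iff)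
  qed
  have 2: "E (- S) (B (E S y)) = 0" for y
  proof -
    have "inner (E (- S) z) (B (E S y)) = 0" for z
      using S C by (intro inner_B_cross[OF C]) (auto simp: E_idem)
    then have "inner z (E (- S) (B (E S y))) = 0" for z using inner_E[OF C] by simp
    then show ?thesis by (metis inner_eq_zero_iff)
  qed
  show ?thesis
    using 1[of x] 2[of x] by (simp add: E_Compl[OF S] blinfun.bilinear_simps)
qed

lemma AE_in_E_range:
  assumes S: "S \<in> sets borel" and u: "E S u = u"
  shows "AE t in \<mu> u. t \<in> S"
proof (rule AE_I[of _ _ "- S"])
  show "emeasure (\<mu> u) (- S) = 0"
    using S u by (simp add: emeasure_scalar_measure borel_comp E_Compl)
qed (use S in \<open>auto simp: borel_comp\<close>)

lemma integral_quadratic_form: "(\<integral>t. t \<partial>\<mu> u) = inner u (B u)"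
  and integrable_quadratic_form: "integrable (\<mu> u) (\<lambda>t. t)"
  using has_integral_quadratic_form[of u] by (simp_all add: has_bochner_integral_iff)

lemma integral_const: "(\<integral>t. a \<partial>\<mu> u) = a * (norm u)^2"
  using measure_scalar_measure[of UNIV u] by (simp add: E_UNIV mult.commute)

lemma inner_B_ge:
  assumes "S \<in> sets borel" "E S u = u" "\<And>t. t \<in> S \<Longrightarrow> a \<le> t"
  shows "a * (norm u)^2 \<le> inner u (B u)"
  unfolding integral_const[symmetric] integral_quadratic_form[symmetric]
  using AE_in_E_range[OF assms(1,2)] assms(3)
  by (intro integral_mono_AE integrable_quadratic_form finite_measure.integrable_const finite_scalar_measure) auto

lemma inner_B_le:
  assumes "S \<in> sets borel" "E S u = u" "\<And>t. t \<in> S \<Longrightarrow> t \<le> a"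
  shows "inner u (B u) \<le> a * (norm u)^2"
  unfolding integral_const[symmetric] integral_quadratic_form[symmetric]
  using AE_in_E_range[OF assms(1,2)] assms(3)
  by (intro integral_mono_AE integrable_quadratic_form finite_measure.integrable_const finite_scalar_measure) auto

text \<open>On the range of \<open>E S\<close>, which \<open>B\<close> leaves invariant, the form of
  B - c lies between -r and r times the squared norm; for a symmetric operator this bounds the
  norm.\<close>

lemma norm_B_minus_le:
  assumes S: "S \<in> sets borel" and u: "E S u = u" and r: "\<And>t. t \<in> S \<Longrightarrow> \<bar>t - c\<bar> \<le> r"
  shows "norm (B u - c *\<^sub>R u) \<le> r * norm u"
proof (rule norm_le_numerical_radius[of "{v. E S v = v}"])
  show "subspace {v. E S v = v}"
    by (auto simp: subspace_def blinfun.bilinear_simps)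
  show "linear (\<lambda>u. B u - c *\<^sub>R u)"
    by (intro linearI) (auto simp: blinfun.bilinear_simps algebra_simps)
  show "inner (B x - c *\<^sub>R x) y = inner x (B y - c *\<^sub>R y)" for x y
    by (simp add: inner_simps selfadjoint_op_inner[OF selfadjoint])
  show "B v - c *\<^sub>R v \<in> {v. E S v = v}" if "v \<in> {v. E S v = v}" for v
    using that B_E[OF S, of v] by (simp add: blinfun.bilinear_simps)
  show "\<bar>inner v (B v - c *\<^sub>R v)\<bar> \<le> r * (norm v)^2" if "v \<in> {v. E S v = v}" for v
  proof -
    have v: "E S v = v" using that by simp
    have "t \<le> c + r" "c - r \<le> t" if "t \<in> S" for t using r[OF that] by linarith+
    then have "inner v (B v) \<le> (c + r) * (norm v)^2" "(c - r) * (norm v)^2 \<le> inner v (B v)"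
      using inner_B_le[OF S v] inner_B_ge[OF S v] by blast+
    then show ?thesis by (simp add: inner_simps power2_norm_eq_inner algebra_simps abs_le_iff)
  qed
qed (use u in simp)

text \<open>To the right of c the form of B - c is at least r, to the left at most -r, and
  Cauchy-Schwarz turns each of these into a lower bound for the norm. The images of the two pieces
  stay orthogonal because \<open>B\<close> commutes with \<open>E\<close>, so the squares add. First
  moments of the scalar measures thus suffice.\<close>

lemma norm_B_minus_ge:
  assumes S: "S \<in> sets borel" and u: "E S u = u" and r: "\<And>t. t \<in> S \<Longrightarrow> r \<le> \<bar>t - c\<bar>" "0 < r"
  shows "r * norm u \<le> norm (B u - c *\<^sub>R u)"
proof -
  define S1 S2 where "S1 = S \<inter> {c + r..}" and "S2 = S \<inter> {..c - r}"
  have b: "S1 \<in> sets borel" "S2 \<in> sets borel" using S by (auto simp: S1_def S2_def)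
  define u1 u2 where "u1 = E S1 u" and "u2 = E S2 u"
  define w1 w2 where "w1 = B u1 - c *\<^sub>R u1" and "w2 = B u2 - c *\<^sub>R u2"
  have e: "E S1 u1 = u1" "E S2 u2 = u2" using b by (auto simp: u1_def u2_def E_idem)
  have dis: "S1 \<inter> S2 = {}" using r by (auto simp: S1_def S2_def)
  have "t \<in> S1 \<union> S2" if "t \<in> S" for t using r(1)[OF that] that by (auto simp: S1_def S2_def)
  then have "S = S1 \<union> S2" by (auto simp: S1_def S2_def)
  then have us: "u = u1 + u2" using E_Un[OF b dis, of u] u by (simp add: u1_def u2_def)
  have ew: "E S1 w1 = w1" "E S2 w2 = w2"
    unfolding w1_def w2_def using B_E[OF b(1), of u1] B_E[OF b(2), of u2] e by (simp_all add: blinfun.bilinear_simps)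
  have orth: "inner x y = 0" if "E S1 x = x" "E S2 y = y" for x y
  proof -
    have "inner x y = inner x (E S1 (E S2 y))" using inner_E[OF b(1), of x y] that by simp
    then show ?thesis using E_disjoint[OF b dis] by simp
  qed
  have "(c + r) * (norm u1)^2 \<le> inner u1 (B u1)"
    by (rule inner_B_ge[OF b(1) e(1)]) (simp add: S1_def)
  then have "r * (norm u1)^2 \<le> inner u1 w1"
    by (simp add: w1_def inner_simps power2_norm_eq_inner algebra_simps)
  also have "\<dots> \<le> norm u1 * norm w1" by (rule norm_cauchy_schwarz)
  finally have 1: "r * norm u1 \<le> norm w1"
    by (cases "u1 = 0") (auto simp: power2_eq_square mult_ac)
  have "inner u2 (B u2) \<le> (c - r) * (norm u2)^2"
    by (rule inner_B_le[OF b(2) e(2)]) (simp add: S2_def)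
  then have "r * (norm u2)^2 \<le> inner u2 (- w2)"
    by (simp add: w2_def inner_simps power2_norm_eq_inner algebra_simps)
  also have "\<dots> \<le> norm u2 * norm w2" by (metis norm_cauchy_schwarz norm_minus_cancel)
  finally have 2: "r * norm u2 \<le> norm w2"
    by (cases "u2 = 0") (auto simp: power2_eq_square mult_ac)
  have "(r * norm u)^2 = (r * norm u1)^2 + (r * norm u2)^2"
    unfolding us using orth[OF e]
    by (simp add: power_mult_distrib power2_norm_eq_inner inner_simps inner_commute algebra_simps)
  also have "\<dots> \<le> (norm w1)^2 + (norm w2)^2"
    using 1 2 r(2) by (intro add_mono power_mono) auto
  also have "\<dots> = (norm (w1 + w2))^2"
    using orth[OF ew] by (simp add: power2_norm_eq_inner inner_simps inner_commute)
  also have "w1 + w2 = B u - c *\<^sub>R u"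
    unfolding us w1_def w2_def by (simp add: blinfun.bilinear_simps algebra_simps)
  finally show ?thesis by (rule power2_le_imp_le) simp
qed

lemma E_bounded:
  assumes "norm B < K"
  shows "E {-K<..<K} x = x"
proof -
  have K: "0 < K" using assms norm_ge_zero[of B] by linarith
  define u where "u = E (- {-K<..<K}) x"
  have "K * norm u \<le> norm (B u - 0 *\<^sub>R u)"
    using K by (intro norm_B_minus_ge[of "- {-K<..<K}"]) (auto simp: u_def E_idem borel_comp)
  also have "\<dots> \<le> norm B * norm u" using norm_blinfun[of B u] by simp
  finally have "(K - norm B) * norm u \<le> 0" by (simp add: left_diff_distrib)
  then have "u = 0" using assms by (simp add: mult_le_0_iff)
  then show ?thesis by (simp add: u_def E_Compl)
qed

text \<open>The null balls form an uncountable cover; by Lindelof countably many of them cover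
  \<open>U\<close>.\<close>

lemma E_zero_of_locally_zero:
  assumes U: "U \<in> sets borel" and loc: "\<And>t. t \<in> U \<Longrightarrow> \<exists>e>0. \<forall>x. E (ball t e) x = 0"
  shows "E U x = 0"
proof -
  from loc obtain e where e: "\<And>t. t \<in> U \<Longrightarrow> 0 < e t" "\<And>t x. t \<in> U \<Longrightarrow> E (ball t (e t)) x = 0" by metis
  obtain F where F: "F \<subseteq> (\<lambda>t. ball t (e t)) ` U" "countable F" "\<Union>F = (\<Union>t\<in>U. ball t (e t))"
    by (rule Lindelof[of "(\<lambda>t. ball t (e t)) ` U"]) auto
  have "(\<Union>S\<in>F. S) \<in> null_sets (\<mu> x)"
  proof (rule null_sets_UN'[OF F(2)])
    fix S assume "S \<in> F"
    then obtain t where "t \<in> U" "S = ball t (e t)" using F(1) by auto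
    then show "S \<in> null_sets (\<mu> x)" using e(2) by (simp add: null_sets_def emeasure_scalar_measure)
  qed
  moreover have "U \<subseteq> (\<Union>S\<in>F. S)"
  proof
    fix t assume t: "t \<in> U"
    then have "t \<in> ball t (e t)" using e(1) by simp
    then have "t \<in> \<Union>F" unfolding F(3) using t by blast
    then show "t \<in> (\<Union>S\<in>F. S)" by simp
  qed
  ultimately have "U \<in> null_sets (\<mu> x)" using U by (rule_tac null_sets_subset) simp_all
  then show ?thesis using U by (simp add: null_sets_def emeasure_scalar_measure)
qed

end

section \<open>Separated spectral subspaces and uniqueness of spectral measures\<close>

definition bin :: "real \<Rightarrow> int \<Rightarrow> real set" where
  "bin h i = {h * of_int i..<h * (of_int i + 1)}"

lemma bin_borel [simp, measurable]: "bin h i \<in> sets borel"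
  by (simp add: bin_def)

lemma bin_disjoint:
  assumes "h > 0" "i \<noteq> j"
  shows "bin h i \<inter> bin h j = {}"
proof (rule ccontr)
  assume "bin h i \<inter> bin h j \<noteq> {}"
  then obtain t where "t \<in> bin h i" "t \<in> bin h j" by blast
  then have "h * of_int i < h * (of_int j + 1)" "h * of_int j < h * (of_int i + 1)"
    unfolding bin_def atLeastLessThan_iff by linarith+
  then have "real_of_int i < of_int j + 1" "real_of_int j < of_int i + 1"
    using assms(1) by (auto simp only: mult_less_cancel_left_pos)
  then have "i < j + 1" "j < i + 1" by linarith+
  then show False using assms(2) by simp
qed

context spectral_resolution
begin

text \<open>Rounding \<open>B\<close> down to a grid makes the spectrum integral after division by
  \<open>h\<close>, which is the setting of \<open>sylvester_sum_bound\<close>.\<close>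

definition discretization :: "real \<Rightarrow> int set \<Rightarrow> 'a \<Rightarrow> 'a" where
  "discretization h J x = (\<Sum>i\<in>J. (h * of_int i) *\<^sub>R E (bin h i) x)"

lemma linear_discretization: "linear (discretization h J)"
  unfolding discretization_def
  by (intro linearI) (simp_all add: blinfun.bilinear_simps scaleR_add_right sum.distrib scaleR_sum_right mult_ac)

lemma E_bin_bin: "h > 0 \<Longrightarrow> E (bin h i) (E (bin h j) x) = (if i = j then E (bin h i) x else 0)"
  by (auto simp: E_idem intro!: E_disjoint bin_disjoint)

lemma inner_E_bin: "h > 0 \<Longrightarrow> i \<noteq> j \<Longrightarrow> inner (E (bin h i) x) (E (bin h j) y) = 0"
  by (simp add: inner_E E_bin_bin)

lemma discretization_E_bin:
  assumes "h > 0" "finite J" "i \<in> J"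
  shows "discretization h J (E (bin h i) x) = (h * of_int i) *\<^sub>R E (bin h i) x"
proof -
  have "discretization h J (E (bin h i) x) = (\<Sum>j\<in>J. if j = i then (h * of_int i) *\<^sub>R E (bin h i) x else 0)"
    unfolding discretization_def by (intro sum.cong refl) (simp add: E_bin_bin[OF assms(1)])
  then show ?thesis using assms by simp
qed

lemma inner_E_bin_discretization:
  assumes "h > 0" "finite J" "i \<in> J"
  shows "inner (E (bin h i) x) (discretization h J y) = h * of_int i * inner (E (bin h i) x) y"
proof -
  have "inner (E (bin h i) x) (discretization h J y) = (\<Sum>j\<in>J. if j = i then h * of_int i * inner (E (bin h i) x) y else 0)"
    unfolding discretization_def inner_sum_right
    using inner_E_bin[OF assms(1)] inner_E[OF bin_borel, of h i "E (bin h i) x" y]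
    by (intro sum.cong refl) (auto simp: E_idem)
  then show ?thesis using assms by simp
qed

lemma E_bins:
  assumes h: "h > 0" and n: "norm B < h * real n"
  shows "(\<Sum>i=- int n..int n. E (bin h i) x) = x"
proof -
  have "{- (h * real n)<..<h * real n} \<subseteq> (\<Union>i\<in>{- int n..int n}. bin h i)"
  proof
    fix t assume t: "t \<in> {- (h * real n)<..<h * real n}"
    define i where "i = \<lfloor>t / h\<rfloor>"
    have "of_int i \<le> t / h" "t / h < of_int i + 1" unfolding i_def by linarith+
    then have 1: "t \<in> bin h i" using h by (simp add: bin_def field_simps)
    have "- real n < t / h" "t / h < real n" using t h by (auto simp: field_simps)
    then have "- int n \<le> i" "i \<le> int n" unfolding i_def by linarith+
    with 1 show "t \<in> (\<Union>i\<in>{- int n..int n}. bin h i)" by auto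
  qed
  then have "E (\<Union>i\<in>{- int n..int n}. bin h i) x = x"
    using E_mono[OF _ _ _ E_bounded[OF n]] by auto
  moreover have "E (\<Union>i\<in>{- int n..int n}. bin h i) x = (\<Sum>i=- int n..int n. E (bin h i) x)"
    by (rule E_UN) (auto simp: disjoint_family_on_def bin_disjoint[OF h])
  ultimately show ?thesis by simp
qed

text \<open>The error maps every bin subspace into itself with norm at most \<open>h\<close>, since
  the points of a bin are within \<open>h\<close> of its left end. Errors of different bins are
  orthogonal, so they do not accumulate.\<close>

lemma norm_B_discretization_le:
  assumes h: "h > 0" and n: "norm B < h * real n"
  shows "norm (B x - discretization h {- int n..int n} x) \<le> h * norm x"
proof -
  define J where "J = {- int n..int n}"
  define u where "u i = E (bin h i) x" for i
  define w where "w i = B (u i) - (h * of_int i) *\<^sub>R u i" for i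
  have xs: "x = (\<Sum>i\<in>J. u i)" unfolding u_def J_def using E_bins[OF assms] by simp
  have J: "finite J" by (simp add: J_def)
  have "B x = (\<Sum>i\<in>J. B (u i))" by (subst xs) (simp add: blinfun.sum_right)
  then have D: "B x - discretization h J x = (\<Sum>i\<in>J. w i)"
    by (simp add: discretization_def w_def u_def sum_subtractf)
  have Ew: "E (bin h i) (w i) = w i" for i
    unfolding w_def u_def by (simp add: blinfun.bilinear_simps B_E[symmetric] E_idem)
  have "inner (w i) (w j) = 0" if "i \<noteq> j" for i j
    using inner_E_bin[OF h that, of "w i" "w j"] by (simp add: Ew)
  then have "(norm (\<Sum>i\<in>J. w i))^2 = (\<Sum>i\<in>J. (norm (w i))^2)"
    by (intro norm_sum_orthogonal J) auto
  also have "\<dots> \<le> (\<Sum>i\<in>J. (h * norm (u i))^2)"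
  proof (intro sum_mono power_mono)
    fix i
    show "norm (w i) \<le> h * norm (u i)"
      unfolding w_def
      by (rule norm_B_minus_le[of "bin h i"]) (auto simp: u_def E_idem bin_def algebra_simps)
  qed auto
  also have "\<dots> = h^2 * (\<Sum>i\<in>J. (norm (u i))^2)" by (simp add: power_mult_distrib sum_distrib_left)
  also have "(\<Sum>i\<in>J. (norm (u i))^2) = (norm (\<Sum>i\<in>J. u i))^2"
    by (rule norm_sum_orthogonal[symmetric, OF J]) (auto simp: u_def inner_E_bin[OF h])
  finally have "(norm (\<Sum>i\<in>J. w i))^2 \<le> (h * norm x)^2" using xs by (simp add: power_mult_distrib)
  then have "norm (\<Sum>i\<in>J. w i) \<le> h * norm x"
    by (rule power2_le_imp_le) (use h in auto)
  then show ?thesis using D by (simp add: J_def)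
qed

end

text \<open>With mesh h = \<delta> / (N + 1) the rounded spectra of the two subspaces stay at least
  N cells apart, and the rounded difference is within 2 h of A - B. The Sylvester bound then reads
  pi / (2 N) * (v + 2 h) / h, and letting N grow removes the effect of the rounding.\<close>

lemma spectral_subspaces_inner_le:
  fixes A B :: "'a::chilbert_space \<Rightarrow>\<^sub>L 'a"
  assumes A: "spectral_resolution A E" and B: "spectral_resolution B F"
    and ST: "S \<in> sets borel" "T \<in> sets borel"
    and \<delta>: "\<delta> > 0" "\<And>s t. s \<in> S \<Longrightarrow> t \<in> T \<Longrightarrow> \<delta> \<le> \<bar>s - t\<bar>"
    and x: "E S x = x" and y: "F T y = y"
  shows "\<bar>inner x y\<bar> \<le> pi / 2 * (norm (A - B) / \<delta>) * norm x * norm y"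
proof -
  interpret A: spectral_resolution A E by (rule A)
  interpret B: spectral_resolution B F by (rule B)
  define v where "v = norm (A - B)"
  have bound: "\<bar>inner x y\<bar> \<le> pi / (2 * real N) * ((v + 2 * h) / h) * norm x * norm y"
    if N: "N > 0" and h: "h = \<delta> / (real N + 1)" for N h
  proof -
    have h0: "h > 0" using h \<delta> by simp
    have hN: "\<delta> = h * (real N + 1)" using h by (simp add: field_simps add_pos_pos)
    obtain n where n: "max (norm A) (norm B) / h < real n" using reals_Archimedean2 by blast
    then have nA: "norm A < h * real n" and nB: "norm B < h * real n"
      using h0 by (auto simp: pos_divide_less_eq mult.commute)
    define J where "J = {- int n..int n}"
    have J: "finite J" by (simp add: J_def)
    define u w where "u i = E (bin h i) x" and "w i = F (bin h i) y" for i
    define Z where "Z z = (1 / h) *\<^sub>R (A.discretization h J z - B.discretization h J z)" for z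
    have xs: "(\<Sum>i\<in>J. u i) = x" unfolding u_def J_def by (rule A.E_bins[OF h0 nA])
    have ys: "(\<Sum>i\<in>J. w i) = y" unfolding w_def J_def by (rule B.E_bins[OF h0 nB])
    have "\<bar>inner (\<Sum>i\<in>J. u i) (\<Sum>j\<in>J. w j)\<bar>
      \<le> pi / (2 * real N) * ((v + 2 * h) / h) * norm (\<Sum>i\<in>J. u i) * norm (\<Sum>j\<in>J. w j)"
    proof (rule sylvester_sum_bound[OF J N])
      show "inner (u i) (u j) = 0" "inner (w i) (w j) = 0" if "i \<noteq> j" for i j
        using that by (simp_all add: u_def w_def A.inner_E_bin[OF h0] B.inner_E_bin[OF h0])
      show "linear Z"
        unfolding Z_def
        by (intro linear_compose_scale_right linear_compose_sub A.linear_discretization B.linear_discretization)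
      show "norm (Z z) \<le> (v + 2 * h) / h * norm z" for z
      proof -
        have "A.discretization h J z - B.discretization h J z
          = (A - B) z - (A z - A.discretization h J z) + (B z - B.discretization h J z)"
          by (simp add: blinfun.bilinear_simps)
        also have "norm \<dots> \<le> norm ((A - B) z) + norm (A z - A.discretization h J z) + norm (B z - B.discretization h J z)"
          by (intro order_trans[OF norm_triangle_ineq] add_right_mono norm_triangle_ineq4)
        also have "\<dots> \<le> v * norm z + h * norm z + h * norm z"
          unfolding v_def J_def
          by (intro add_mono norm_blinfun A.norm_B_discretization_le B.norm_B_discretization_le h0 nA nB)
        finally have "norm (A.discretization h J z - B.discretization h J z) \<le> (v + 2 * h) * norm z"
          by (simp add: algebra_simps)
        then have "norm (A.discretization h J z - B.discretization h J z) / h \<le> (v + 2 * h) * norm z / h"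
          using h0 by (intro divide_right_mono) auto
        then show ?thesis unfolding Z_def using h0 by simp
      qed
      show "inner (u i) (Z (w j)) = of_int (i - j) * inner (u i) (w j)" if "i \<in> J" "j \<in> J" for i j
      proof -
        have "B.discretization h J (w j) = (h * of_int j) *\<^sub>R w j"
          unfolding w_def by (rule B.discretization_E_bin[OF h0 J that(2)])
        moreover have "inner (u i) (A.discretization h J (w j)) = h * of_int i * inner (u i) (w j)"
          unfolding u_def by (rule A.inner_E_bin_discretization[OF h0 J that(1)])
        ultimately show ?thesis unfolding Z_def using h0 by (simp add: inner_diff_right field_simps)
      qed
      show "int N \<le> \<bar>i - j\<bar>" if "u i \<noteq> 0" "w j \<noteq> 0" for i j
      proof -
        have "u i = E (bin h i \<inter> S) x" using A.E_E[OF bin_borel ST(1), of h i x] unfolding x u_def by simp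
        with that(1) have "bin h i \<inter> S \<noteq> {}" by (intro notI) (simp add: A.E_empty)
        then obtain s where s: "s \<in> bin h i" "s \<in> S" by blast
        have "w j = F (bin h j \<inter> T) y" using B.E_E[OF bin_borel ST(2), of h j y] unfolding y w_def by simp
        with that(2) have "bin h j \<inter> T \<noteq> {}" by (intro notI) (simp add: B.E_empty)
        then obtain t where t: "t \<in> bin h j" "t \<in> T" by blast
        \<comment> \<open>Offsets inside bins lie in [0, h), so rounding changes s - t by less than
          h. Of the gap (N + 1) h more than N h remains.\<close>
        have "\<bar>s - t - h * of_int (i - j)\<bar> < h" using s(1) t(1) by (simp add: bin_def algebra_simps abs_less_iff)
        moreover have "\<delta> \<le> \<bar>s - t\<bar>" by (rule \<delta>(2)[OF s(2) t(2)])
        ultimately have "h * real N < \<bar>h * of_int (i - j)\<bar>" unfolding hN by (simp add: distrib_left)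
        also have "\<dots> = h * of_int \<bar>i - j\<bar>" using h0 by (simp add: abs_mult)
        finally have "real N < of_int \<bar>i - j\<bar>" using h0 by simp
        then show ?thesis by linarith
      qed
    qed
    then show ?thesis by (simp add: xs ys)
  qed
  have "\<bar>inner x y\<bar> \<le> pi / 2 * (v * (1 + inverse (real (Suc n))) / \<delta> + 2 * inverse (real (Suc n))) * norm x * norm y" for n
  proof -
    define N where "N = real (Suc n)"
    have *: "pi / (2 * N) * ((v + 2 * (\<delta> / (N + 1))) / (\<delta> / (N + 1))) = pi / 2 * (v * (1 + inverse N) / \<delta> + 2 * inverse N)"
    proof -
      have "N > 0" by (simp add: N_def)
      then have nz: "N + 1 \<noteq> 0" "N \<noteq> 0" "\<delta> \<noteq> 0" using \<delta> by auto
      have "(v + 2 * c) / c = v / c + 2" if "c \<noteq> 0" for c :: real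
        using that by (simp add: add_divide_distrib)
      from this[of "\<delta> / (N + 1)"] have "(v + 2 * (\<delta> / (N + 1))) / (\<delta> / (N + 1)) = v * (N + 1) / \<delta> + 2"
        using nz by simp
      then show ?thesis using nz by (simp only:) (simp add: field_simps)
    qed
    have "\<bar>inner x y\<bar> \<le> pi / (2 * N) * ((v + 2 * (\<delta> / (N + 1))) / (\<delta> / (N + 1))) * norm x * norm y"
      unfolding N_def by (rule bound) simp_all
    then show ?thesis unfolding * unfolding N_def .
  qed
  moreover have "(\<lambda>n. pi / 2 * (v * (1 + inverse (real (Suc n))) / \<delta> + 2 * inverse (real (Suc n))) * norm x * norm y)
    \<longlonglongrightarrow> pi / 2 * (v * (1 + 0) / \<delta> + 2 * 0) * norm x * norm y"
    by (intro tendsto_intros LIMSEQ_inverse_real_of_nat) (use \<delta> in auto)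
  ultimately have "\<bar>inner x y\<bar> \<le> pi / 2 * (v * (1 + 0) / \<delta> + 2 * 0) * norm x * norm y"
    by (intro LIMSEQ_le_const) auto
  then show ?thesis by (simp add: v_def)
qed

text \<open>The complement of a closed set is a countable union of sets at positive distance from
  it, and on each of these \<open>F\<close> annihilates the range of \<open>E S\<close>. This is why
  uniqueness starts with closed sets.\<close>

lemma spectral_resolution_closed_le:
  assumes "spectral_resolution B E" "spectral_resolution B F" "closed S"
  shows "F S (E S x) = E S x"
proof (cases "S = {}")
  \<comment> \<open>\<open>infdist\<close> to the empty set is 0, so the distance sets used below
    would not cover the complement in this case.\<close>
  case True
  then show ?thesis by (simp add: spectral_resolution.E_empty[OF assms(1)] blinfun.zero_right)
next
  case False
  interpret E: spectral_resolution B E by (rule assms(1))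
  interpret F: spectral_resolution B F by (rule assms(2))
  have S: "S \<in> sets borel" using assms(3) by simp
  define T where "T n = {t. inverse (real (Suc n)) \<le> infdist t S}" for n
  have Tm: "T n \<in> sets borel" for n
    unfolding T_def by (intro borel_closed closed_Collect_le continuous_intros)
  define u where "u = E S x"
  have z: "F (T n) u = 0" for n
  proof -
    have "\<bar>inner u (F (T n) u)\<bar> \<le> pi / 2 * (norm (B - B) / inverse (real (Suc n))) * norm u * norm (F (T n) u)"
    proof (rule spectral_subspaces_inner_le[OF assms(1,2) S Tm])
      show "inverse (real (Suc n)) \<le> \<bar>s - t\<bar>" if "s \<in> S" "t \<in> T n" for s t
        using that infdist_le[of s S t] by (auto simp: T_def dist_real_def)
    qed (use S Tm in \<open>auto simp: u_def E.E_idem F.E_idem\<close>)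
    then show ?thesis using F.inner_E_self[OF Tm, of u] by simp
  qed
  have "- S = (\<Union>n. T n)"
  proof (intro set_eqI iffI)
    fix t assume "t \<in> - S"
    then have "0 < infdist t S"
      using in_closed_iff_infdist_zero[OF assms(3) False, of t] infdist_nonneg[of t S] by (simp add: less_le)
    then obtain n where "inverse (real (Suc n)) < infdist t S" using reals_Archimedean by blast
    then show "t \<in> (\<Union>n. T n)" by (auto simp: T_def intro: less_imp_le)
  next
    fix t assume "t \<in> (\<Union>n. T n)"
    then obtain n where "inverse (real (Suc n)) \<le> infdist t S" by (auto simp: T_def)
    then show "t \<in> - S" using infdist_zero[of t S] by (auto simp: le_less_trans[of _ 0])
  qed
  moreover have "(\<Union>n. T n) \<in> null_sets (F.\<mu> u)"
    by (intro null_sets_UN) (simp add: null_sets_def F.emeasure_scalar_measure Tm z)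
  ultimately have "emeasure (F.\<mu> u) (- S) = 0" by (simp add: null_sets_def)
  then have "F (- S) u = 0" using S by (simp add: F.emeasure_scalar_measure borel_comp)
  then show ?thesis using S by (simp add: F.E_Compl u_def)
qed

text \<open>The inclusion of ranges holds in both directions, and passing to adjoints turns it into
  equality on closed sets. Half-lines determine the finite scalar measures, and these determine the
  projections through their quadratic forms.\<close>

lemma spectral_resolution_unique:
  assumes "spectral_resolution B E" "spectral_resolution B F" "\<Delta> \<in> sets borel"
  shows "E \<Delta> = F \<Delta>"
proof -
  interpret E: spectral_resolution B E by (rule assms(1))
  interpret F: spectral_resolution B F by (rule assms(2))
  have closed: "E S x = F S x" if "closed S" for S x
  proof -
    have S: "S \<in> sets borel" using that by simp
    have "inner (E S x) y = inner (F S x) y" for y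
    proof -
      have "inner (E S x) y = inner (F S (E S x)) y"
        by (simp add: spectral_resolution_closed_le[OF assms(1,2) that])
      also have "\<dots> = inner x (E S (F S y))" using S by (simp add: E.inner_E F.inner_E)
      also have "\<dots> = inner (F S x) y"
        using S by (simp add: spectral_resolution_closed_le[OF assms(2,1) that] F.inner_E)
      finally show ?thesis .
    qed
    then show ?thesis by (metis inner_eq_zero_iff inner_diff_left right_minus_eq)
  qed
  have "E.\<mu> x = F.\<mu> x" for x
  proof (rule measure_eqI_lessThan)
    fix a :: real
    have "E {a<..} x = F {a<..} x"
      using E.E_Compl[of "{..a}" x] F.E_Compl[of "{..a}" x] closed[of "{..a}" x] by (simp add: Compl_atMost)
    then show "emeasure (E.\<mu> x) {a<..} = emeasure (F.\<mu> x) {a<..}"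
      by (simp add: E.emeasure_scalar_measure F.emeasure_scalar_measure)
    show "emeasure (E.\<mu> x) {a<..} < \<infinity>" by (simp add: E.emeasure_scalar_measure)
  qed simp_all
  then have "(norm (E \<Delta> x))^2 = (norm (F \<Delta> x))^2" for x
    by (metis E.measure_scalar_measure F.measure_scalar_measure assms(3))
  then show ?thesis
    using E.projection[OF assms(3)] F.projection[OF assms(3)]
    by (intro selfadjoint_op_eqI)
       (auto simp: orthogonal_projection_inner_self orthogonal_projection_def[of "E \<Delta>"] orthogonal_projection_def[of "F \<Delta>"])
qed

lemma (in spectral_resolution) spectral_projection_eq:
  assumes "\<Delta> \<in> sets borel"
  shows "spectral_projection B \<Delta> = E \<Delta>"
  unfolding spectral_projection_def
proof (rule the_equality)
  show "\<exists>F. is_spectral_measure B F \<and> E \<Delta> = F \<Delta>" using resolution by blast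
  fix P assume "\<exists>F. is_spectral_measure B F \<and> P = F \<Delta>"
  then obtain F where F: "is_spectral_measure B F" "P = F \<Delta>" by blast
  then have "spectral_resolution B F" using selfadjoint by (simp add: spectral_resolution_def)
  then show "P = E \<Delta>" using spectral_resolution_unique[OF _ _ assms] F(2) spectral_resolution_axioms by blast
qed

section \<open>Polynomials of operators\<close>

lemma norm_scaleC: "norm (c *\<^sub>C x) = cmod c * norm (x::'a::chilbert_space)"
proof -
  have "cinner (c *\<^sub>C x) (c *\<^sub>C x) = c * cnj (c * cinner x x)"
    using cinner_commute[of "c *\<^sub>C x" x] by (simp add: cinner_scaleC_right)
  also have "\<dots> = complex_of_real ((cmod c)^2) * cinner x x"
    using cinner_commute[of x x] complex_norm_square[of c] by simp
  finally have "Re (cinner (c *\<^sub>C x) (c *\<^sub>C x)) = (cmod c)^2 * Re (cinner x x)"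
    by (simp del: of_real_power)
  then have "(norm (c *\<^sub>C x))^2 = (cmod c * norm x)^2"
    by (simp add: Re_cinner power2_norm_eq_inner power_mult_distrib)
  then show ?thesis by (simp add: power2_eq_iff_nonneg)
qed

lemma bounded_linear_scaleC: "bounded_linear (\<lambda>x::'a::chilbert_space. c *\<^sub>C x)"
proof (rule bounded_linear_intro)
  show "c *\<^sub>C (r *\<^sub>R x) = r *\<^sub>R (c *\<^sub>C x)" for r and x :: 'a
    by (metis mult.commute scaleC_of_real scaleC_scaleC)
  show "norm (c *\<^sub>C x) \<le> norm x * cmod c" for x :: 'a by (simp add: norm_scaleC mult.commute)
qed (rule scaleC_add_right)

text \<open>The imaginary part of \<open>cinner x y\<close> is minus the real inner product of x
  with i y. Real symmetry and complex linearity together therefore give complex symmetry, and the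
  rest of the proof can stay with \<open>inner\<close>.\<close>

lemma selfadjoint_opI:
  assumes "clinear_op T" "\<And>x y. inner (T x) y = inner x (T y)"
  shows "selfadjoint_op T"
proof -
  have im: "Im (cinner x y) = - inner x (\<i> *\<^sub>C y)" for x y :: 'a
    using Re_cinner[of x "\<i> *\<^sub>C y"] by (simp add: cinner_scaleC_right)
  have "cinner (T x) y = cinner x (T y)" for x y
    using assms by (simp add: complex_eq_iff Re_cinner im clinear_op_def)
  then show ?thesis using assms(1) by (simp add: selfadjoint_op_def)
qed

definition op_poly :: "('a::real_normed_vector \<Rightarrow>\<^sub>L 'a) \<Rightarrow> real poly \<Rightarrow> 'a \<Rightarrow>\<^sub>L 'a" where
  "op_poly B p = fold_coeffs (\<lambda>a T. a *\<^sub>R id_blinfun + (B o\<^sub>L T)) p 0"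

lemma op_poly_0 [simp]: "op_poly B 0 = 0"
  by (simp add: op_poly_def)

lemma op_poly_pCons [simp]: "op_poly B (pCons a p) x = a *\<^sub>R x + B (op_poly B p x)"
  by (cases "p = 0 \<and> a = 0") (auto simp: op_poly_def blinfun.bilinear_simps)

lemma op_poly_add [simp]: "op_poly B (p + q) x = op_poly B p x + op_poly B q x"
  by (induction p q rule: poly_induct2) (simp_all add: blinfun.bilinear_simps algebra_simps)

lemma op_poly_smult [simp]: "op_poly B (smult c p) x = c *\<^sub>R op_poly B p x"
  by (induction p) (simp_all add: blinfun.bilinear_simps algebra_simps)

lemma op_poly_diff [simp]: "op_poly B (p - q) x = op_poly B p x - op_poly B q x"
proof -
  have "p - q = p + smult (- 1) q" by simp
  then show ?thesis by (simp only: op_poly_add op_poly_smult) simp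
qed

lemma op_poly_1 [simp]: "op_poly B 1 x = x"
  by (simp add: one_pCons blinfun.bilinear_simps)

lemma op_poly_sum: "op_poly B (\<Sum>i\<in>I. f i) x = (\<Sum>i\<in>I. op_poly B (f i) x)"
  by (induction I rule: infinite_finite_induct) (simp_all add: blinfun.bilinear_simps)

lemma op_poly_mult: "op_poly B (p * q) x = op_poly B p (op_poly B q x)"
  by (induction p) (simp_all add: blinfun.bilinear_simps)

lemma op_poly_pcompose_linear:
  "op_poly C (pcompose p [:a, b:]) x = op_poly (a *\<^sub>R id_blinfun + b *\<^sub>R C) p x"
  by (induction p arbitrary: x) (simp_all add: pcompose_pCons op_poly_mult blinfun.bilinear_simps)

lemma selfadjoint_op_poly:
  fixes B :: "'a::chilbert_space \<Rightarrow>\<^sub>L 'a"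
  assumes "selfadjoint_op B"
  shows "selfadjoint_op (op_poly B p)"
proof (rule selfadjoint_opI)
  have "op_poly B p (c *\<^sub>C x) = c *\<^sub>C op_poly B p x" for c x
    using assms
    by (induction p) (simp_all add: selfadjoint_op_def clinear_op_def scaleC_add_right blinfun.bilinear_simps
        linear_0[OF bounded_linear.linear[OF bounded_linear_scaleC]]
        linear_scale[OF bounded_linear.linear[OF bounded_linear_scaleC]])
  then show "clinear_op (op_poly B p)" by (simp add: clinear_op_def)
  have comm: "B (op_poly B p x) = op_poly B p (B x)" for p x
    by (induction p) (simp_all add: blinfun.bilinear_simps)
  show "inner (op_poly B p x) y = inner x (op_poly B p y)" for x y
    by (induction p arbitrary: x y)
       (simp_all add: blinfun.bilinear_simps inner_simps selfadjoint_op_inner[OF assms] comm)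
qed

section \<open>Bernstein polynomials\<close>

definition bernstein_poly :: "nat \<Rightarrow> nat \<Rightarrow> real poly" where
  "bernstein_poly n j = smult (real (n choose j)) ([:0, 1:] ^ j * [:1, -1:] ^ (n - j))"

text \<open>Weights \<open>j choose i\<close>, unlike powers of j / n, give an exact identity: after
  regrouping the product of binomials, what remains is the expansion of (X + (1 - X))^(n - i) = 1.
  The case i = 0 is the partition of unity.\<close>

lemma sum_choose_bernstein_poly:
  assumes "i \<le> n"
  shows "(\<Sum>j\<le>n. smult (real (j choose i)) (bernstein_poly n j)) = smult (real (n choose i)) ([:0, 1:] ^ i)"
proof -
  define X Y :: "real poly" where "X = [:0, 1:]" and "Y = [:1, -1:]"
  have XY: "X + Y = 1" by (simp add: X_def Y_def one_pCons)
  have "(\<Sum>j\<le>n. smult (real (j choose i)) (bernstein_poly n j))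
    = (\<Sum>j=i..n. smult (real ((n choose j) * (j choose i))) (X ^ j * Y ^ (n - j)))"
    unfolding bernstein_poly_def X_def[symmetric] Y_def[symmetric]
    by (rule sum.mono_neutral_cong_right) (auto simp: mult.commute)
  also have "\<dots> = (\<Sum>j=i..n. smult (real ((n choose i) * ((n - i) choose (j - i)))) (X ^ j * Y ^ (n - j)))"
    by (intro sum.cong refl) (simp add: choose_mult)
  also have "\<dots> = (\<Sum>l\<le>n - i. smult (real ((n choose i) * ((n - i) choose l))) (X ^ (l + i) * Y ^ (n - (l + i))))"
    by (rule sum.reindex_bij_witness[of _ "\<lambda>l. l + i" "\<lambda>j. j - i"]) (use assms in auto)
  also have "\<dots> = (\<Sum>l\<le>n - i. smult (real (n choose i)) (X ^ i) * (of_nat ((n - i) choose l) * X ^ l * Y ^ (n - i - l)))"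
    by (intro sum.cong refl) (simp add: power_add mult_ac of_nat_poly diff_commute add.commute)
  also have "\<dots> = smult (real (n choose i)) (X ^ i) * (X + Y) ^ (n - i)"
    unfolding binomial_ring sum_distrib_left ..
  finally have "(\<Sum>j\<le>n. smult (real (j choose i)) (bernstein_poly n j)) = smult (real (n choose i)) (X ^ i)"
    unfolding XY power_one mult_1_right .
  then show ?thesis unfolding X_def .
qed

text \<open>This compares sampling without and with replacement. Passing from i to i + 1 multiplies
  one side by (j - i) / (n - i) and the other by j / n, which differ by at most i / n while i \<le>
  j. For i > j the binomial ratio is 0, and the induction hypothesis already bounds the
  power.\<close>

lemma choose_ratio_approx:
  assumes "j \<le> n" "i \<le> n" "n > 0"
  shows "\<bar>real (j choose i) / real (n choose i) - (real j / real n) ^ i\<bar> \<le> (real i)^2 / real n"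
  using assms(2)
proof (induction i)
  case (Suc i)
  define a c where "a = real (j choose i) / real (n choose i)" and "c = (real j / real n) ^ i"
  define b d where "b = (real j - real i) / (real n - real i)" and "d = real j / real n"
  have IH: "\<bar>a - c\<bar> \<le> (real i)^2 / real n" using Suc by (simp add: a_def c_def)
  have i: "real i < real n" using Suc.prems by simp
  have n: "real n > 0" using assms by simp
  have rec: "real (m choose Suc i) = real (m choose i) * (real m - real i) / (real i + 1)" for m
  proof (cases "i \<le> m")
    case True
    have "real (Suc i * (m choose Suc i)) = real ((m - i) * (m choose i))"
      by (metis Suc_times_binomial_add binomial_absorb_comp binomial_absorption mult.commute)
    then show ?thesis using True by (simp add: of_nat_diff field_simps)
  qed (simp add: binomial_eq_0)
  have a': "real (j choose Suc i) / real (n choose Suc i) = a * b"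
    unfolding rec a_def b_def using i by simp
  have c01: "0 \<le> c" "c \<le> 1" and d01: "0 \<le> d" "d \<le> 1"
    using assms n by (auto simp: c_def d_def intro!: power_le_one)
  have "\<bar>a * b - c * d\<bar> \<le> (real i)^2 / real n + real i / real n"
  proof (cases "i \<le> j")
    case True
    have b01: "0 \<le> b" "b \<le> 1" unfolding b_def using True i assms by auto
    have "b - d = - (real i * (real n - real j) / ((real n - real i) * real n))"
      unfolding b_def d_def using i n by (simp add: field_simps)
    also have "\<bar>\<dots>\<bar> = real i / real n * ((real n - real j) / (real n - real i))"
      using i n assms by (simp add: abs_mult abs_divide)
    also have "\<dots> \<le> real i / real n * 1"
      using i n True by (intro mult_left_mono) auto
    finally have bd: "\<bar>b - d\<bar> \<le> real i / real n" by simp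
    have "a * b - c * d = (a - c) * b + c * (b - d)" by (simp add: algebra_simps)
    also have "\<bar>\<dots>\<bar> \<le> \<bar>a - c\<bar> * b + c * \<bar>b - d\<bar>"
      using b01 c01 by (intro order_trans[OF abs_triangle_ineq]) (simp add: abs_mult)
    also have "\<dots> \<le> \<bar>a - c\<bar> * 1 + 1 * \<bar>b - d\<bar>"
      using b01 c01 by (intro add_mono mult_left_mono mult_right_mono) auto
    finally show ?thesis by (intro order_trans[OF _ add_mono[OF IH bd]]) simp
  next
    case False
    then have "a = 0" by (simp add: a_def binomial_eq_0)
    then have "\<bar>a * b - c * d\<bar> = c * d" "c \<le> (real i)^2 / real n" using IH c01 d01 by auto
    moreover have "c * d \<le> c * 1" using c01 d01 by (intro mult_left_mono)
    moreover have "0 \<le> real i / real n" by simp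
    ultimately show ?thesis by linarith
  qed
  also have "\<dots> \<le> (real (Suc i))^2 / real n"
    using n by (simp add: add_divide_distrib[symmetric] power2_eq_square divide_right_mono algebra_simps)
  finally show ?case unfolding a' by (simp add: c_def d_def mult.commute)
qed simp

text \<open>No square roots of operators are needed: the even parts of the exponents are absorbed as
  p * p * q, which inherits positivity from q. What remains is 1, X, Y or X Y, and the last equals X
  X Y + Y Y X because X + Y = 1.\<close>

lemma op_bernstein_poly_nonneg:
  fixes C :: "'a::chilbert_space \<Rightarrow>\<^sub>L 'a"
  assumes C: "selfadjoint_op C" and C0: "\<And>x. 0 \<le> inner x (C x)" and C1: "\<And>x. inner x (C x) \<le> (norm x)^2"
  shows "0 \<le> inner x (op_poly C (bernstein_poly n j) x)"
proof -
  define pos where "pos p \<longleftrightarrow> (\<forall>x. 0 \<le> inner x (op_poly C p x))" for p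
  define X Y :: "real poly" where "X = [:0, 1:]" and "Y = [:1, -1:]"
  have sq: "pos (p * p * q)" if "pos q" for p q
    unfolding pos_def
  proof
    fix x
    have "p * p * q = p * (q * p)" by (simp add: mult_ac)
    then have "inner x (op_poly C (p * p * q) x) = inner (op_poly C p x) (op_poly C q (op_poly C p x))"
      by (simp only: op_poly_mult selfadjoint_op_inner[OF selfadjoint_op_poly[OF C]])
    then show "0 \<le> inner x (op_poly C (p * p * q) x)" using that by (simp add: pos_def)
  qed
  have add: "pos (p + q)" if "pos p" "pos q" for p q
    using that by (simp add: pos_def inner_simps)
  have p1: "pos 1" by (simp add: pos_def)
  have pX: "pos X" using C0 by (simp add: pos_def X_def blinfun.bilinear_simps)
  have pY: "pos Y" using C1 by (simp add: pos_def Y_def blinfun.bilinear_simps inner_simps power2_norm_eq_inner)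
  have XY: "X + Y = 1" by (simp add: X_def Y_def one_pCons)
  have "X * Y = X * Y * (X + Y)" by (simp add: XY)
  also have "\<dots> = X * X * Y + Y * Y * X" by (simp add: algebra_simps)
  finally have pXY: "pos (X * Y)" using add[OF sq[OF pY] sq[OF pX]] by simp
  have "pos (X ^ a * Y ^ b)" for a b
  proof -
    have r: "pos (X ^ (a mod 2) * Y ^ (b mod 2))"
      using p1 pX pY pXY
      by (cases "even a"; cases "even b") (simp_all add: even_iff_mod_2_eq_zero odd_iff_mod_2_eq_one)
    have s: "Z ^ m = Z ^ (m div 2) * Z ^ (m div 2) * Z ^ (m mod 2)" for Z :: "real poly" and m :: nat
      by (metis div_mult_mod_eq mult_2_right power_add)
    have "X ^ a * Y ^ b = (X ^ (a div 2) * Y ^ (b div 2)) * (X ^ (a div 2) * Y ^ (b div 2)) * (X ^ (a mod 2) * Y ^ (b mod 2))"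
      by (subst s[of X a], subst s[of Y b]) (simp only: mult_ac)
    then show ?thesis using sq[OF r] by simp
  qed
  then show ?thesis by (simp add: bernstein_poly_def pos_def X_def Y_def)
qed

lemma op_poly_altdef: "op_poly C p x = (\<Sum>i\<le>degree p. coeff p i *\<^sub>R op_poly C ([:0, 1:] ^ i) x)"
proof -
  have "op_poly C p x = op_poly C (\<Sum>i\<le>degree p. smult (coeff p i) ([:0, 1:] ^ i)) x"
    using poly_as_sum_of_monoms[of p] by (simp add: monom_altdef)
  then show ?thesis by (simp add: op_poly_sum)
qed

section \<open>Moment measures\<close>

text \<open>The nodes are j / n. The interval starts at -1 and not at 0 because \<open>tight\<close>
  uses intervals open on the left and 0 is one of the nodes.\<close>

lemma bernstein_moment_measure:
  fixes C :: "'a::chilbert_space \<Rightarrow>\<^sub>L 'a"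
  assumes C: "selfadjoint_op C" and C0: "\<And>x. 0 \<le> inner x (C x)" and C1: "\<And>x. inner x (C x) \<le> (norm x)^2"
    and x: "norm x = 1"
  obtains \<nu> where "real_distribution \<nu>"
    "\<And>f. f \<in> borel_measurable borel \<Longrightarrow>
      (\<integral>t. f t \<partial>\<nu>) = (\<Sum>j\<le>n. inner x (op_poly C (bernstein_poly n j) x) *\<^sub>R (f (real j / real n) :: real))"
    "measure \<nu> {-1<..1} = 1"
proof -
  define c where "c j = inner x (op_poly C (bernstein_poly n j) x)" for j
  define P where "P = point_measure {..n} (\<lambda>j. ennreal (c j))"
  define \<nu> where "\<nu> = distr P borel (\<lambda>j. real j / real n)"
  have c0: "0 \<le> c j" for j unfolding c_def by (rule op_bernstein_poly_nonneg[OF C C0 C1])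
  have "(\<Sum>j\<le>n. op_poly C (bernstein_poly n j) x) = op_poly C (\<Sum>j\<le>n. smult (real (j choose 0)) (bernstein_poly n j)) x"
    by (simp add: op_poly_sum)
  also have "\<dots> = x" unfolding sum_choose_bernstein_poly[OF le0] by simp
  finally have c1: "(\<Sum>j\<le>n. c j) = 1"
    using x by (simp add: c_def inner_sum_right[symmetric] power2_norm_eq_inner[symmetric])
  have mp: "(\<lambda>j. real j / real n) \<in> measurable P borel" by (simp add: P_def)
  have emP: "emeasure P {..n} = 1"
    unfolding P_def by (subst emeasure_point_measure_finite) (simp_all add: sum_ennreal c0 c1)
  have spP: "space P = {..n}" by (simp add: P_def space_point_measure)
  have "prob_space P" by (intro prob_spaceI) (simp add: spP emP)
  then have "prob_space \<nu>" unfolding \<nu>_def by (rule prob_space.prob_space_distr) (rule mp)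
  then have "real_distribution \<nu>"
    by (auto simp: real_distribution_def real_distribution_axioms_def \<nu>_def)
  moreover have "(\<integral>t. f t \<partial>\<nu>) = (\<Sum>j\<le>n. c j *\<^sub>R f (real j / real n))"
    if "f \<in> borel_measurable borel" for f :: "real \<Rightarrow> real"
    unfolding \<nu>_def using that c0
    by (subst integral_distr[OF mp that]) (simp add: P_def lebesgue_integral_point_measure_finite)
  moreover have "measure \<nu> {-1<..1} = 1"
  proof -
    have "(\<lambda>j. real j / real n) -` {-1<..1} \<inter> space P = {..n}"
    proof -
      have "- 1 < real j / real n" "real j / real n \<le> 1" if "j \<le> n" for j
        using that by (auto simp: divide_le_eq_1 intro: less_le_trans[of _ 0])
      then show ?thesis by (auto simp: spP)
    qed
    then have "emeasure \<nu> {-1<..1} = 1"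
      unfolding \<nu>_def by (subst emeasure_distr[OF mp]) (simp_all add: emP)
    then show ?thesis by (simp add: measure_def)
  qed
  ultimately show thesis using that unfolding c_def by blast
qed

lemma moment_measure_unit:
  fixes C :: "'a::chilbert_space \<Rightarrow>\<^sub>L 'a"
  assumes C: "selfadjoint_op C" and C0: "\<And>x. 0 \<le> inner x (C x)" and C1: "\<And>x. inner x (C x) \<le> (norm x)^2"
    and x: "norm x = 1"
  obtains M where "real_distribution M" "AE t in M. t \<in> {0..1}"
    "\<And>p. (\<integral>t. poly p t \<partial>M) = inner x (op_poly C p x)"
proof -
  define c where "c n j = inner x (op_poly C (bernstein_poly n j) x)" for n j
  define P where "P n \<nu> \<longleftrightarrow> real_distribution \<nu> \<and> (\<forall>f. f \<in> borel_measurable borel \<longrightarrow>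
      (\<integral>t. f t \<partial>\<nu>) = (\<Sum>j\<le>n. c n j *\<^sub>R (f (real j / real n) :: real))) \<and> measure \<nu> {-1<..1} = 1" for n \<nu>
  have "\<exists>\<nu>. P n \<nu>" for n
    using bernstein_moment_measure[OF C C0 C1 x, of n] unfolding P_def c_def by metis
  then have "\<forall>n. \<exists>\<nu>. P n \<nu>" by blast
  from choice[OF this] obtain \<nu> where \<nu>': "\<forall>n. P n (\<nu> n)" ..
  have \<nu>: "real_distribution (\<nu> n)"
    "f \<in> borel_measurable borel \<Longrightarrow> (\<integral>t. f t \<partial>\<nu> n) = (\<Sum>j\<le>n. c n j *\<^sub>R (f (real j / real n) :: real))"
    "measure (\<nu> n) {-1<..1} = 1" for n f
    using \<nu>'[rule_format, of n] unfolding P_def by blast+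
  have c0: "0 \<le> c n j" for n j unfolding c_def by (rule op_bernstein_poly_nonneg[OF C C0 C1])
  have cm: "(\<Sum>j\<le>n. c n j * real (j choose i)) = real (n choose i) * inner x (op_poly C ([:0, 1:] ^ i) x)"
    if "i \<le> n" for i n
  proof -
    have "(\<Sum>j\<le>n. c n j * real (j choose i)) = inner x (op_poly C (\<Sum>j\<le>n. smult (real (j choose i)) (bernstein_poly n j)) x)"
      by (simp add: op_poly_sum inner_sum_right c_def mult.commute)
    then show ?thesis unfolding sum_choose_bernstein_poly[OF that] by simp
  qed
  have c1: "(\<Sum>j\<le>n. c n j) = 1" for n
    using cm[of 0 n] x by (simp add: power2_norm_eq_inner[symmetric])
  have "tight \<nu>"
    unfolding tight_def
  proof (intro conjI allI impI)
    fix e :: real assume "e > 0"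
    then have "(-1::real) < 1 \<and> (\<forall>n. 1 - e < measure (\<nu> n) {-1<..1})" by (simp add: \<nu>(3))
    then show "\<exists>a b. a < b \<and> (\<forall>n. 1 - e < measure (\<nu> n) {a<..b})" by blast
  qed (rule \<nu>(1))
  from tight_imp_convergent_subsubsequence[OF this strict_mono_id]
  obtain r M where r: "strict_mono (r :: nat \<Rightarrow> nat)" and M: "real_distribution M"
    and w: "weak_conv_m (\<nu> \<circ> id \<circ> r) M" by blast
  interpret M: real_distribution M by (rule M)
  have conv: "(\<lambda>n. \<integral>t. f t \<partial>\<nu> (r n)) \<longlonglongrightarrow> (\<integral>t. f t \<partial>M)"
    if "continuous_on UNIV f" "\<And>t. \<bar>f t\<bar> \<le> b" for f :: "real \<Rightarrow> real" and b
  proof -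
    have w': "weak_conv_m (\<lambda>n. \<nu> (r n)) M" using w by (simp add: o_def)
    show ?thesis
    proof (rule weak_conv_imp_integral_bdd_continuous_conv)
      show "isCont f t" for t using that(1) by (simp add: continuous_on_eq_continuous_at)
    qed (use w' \<nu>(1) M that(2) in auto)
  qed
  \<comment> \<open>Weak convergence is tested on bounded continuous functions; clipping to [0, 1]
    makes powers bounded and changes nothing at the nodes.\<close>
  define \<phi> where "\<phi> t = max 0 (min 1 t)" for t :: real
  have \<phi>c: "continuous_on UNIV \<phi>" unfolding \<phi>_def by (intro continuous_intros)
  have \<phi>01: "0 \<le> \<phi> t" "\<phi> t \<le> 1" for t by (auto simp: \<phi>_def)
  have \<phi>j: "\<phi> (real j / real n) = real j / real n" if "j \<le> n" for j n
  proof -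
    have "real j / real n \<le> 1" using that by (cases "n = 0") auto
    then show ?thesis by (simp add: \<phi>_def min_def)
  qed
  have AE01: "AE t in M. t \<in> {0..1}"
  proof -
    \<comment> \<open>The capped distance to [0, 1] has integral 0 for every approximating measure,
      hence for the limit, which confines \<open>M\<close> to [0, 1].\<close>
    define g where "g t = min 1 \<bar>t - \<phi> t\<bar>" for t
    have gc: "continuous_on UNIV g" unfolding g_def by (intro continuous_intros \<phi>c)
    then have gm: "g \<in> borel_measurable borel" by (rule borel_measurable_continuous_onI)
    have "(\<integral>t. g t \<partial>\<nu> n) = 0" for n
      unfolding \<nu>(2)[OF gm] by (intro sum.neutral) (simp add: g_def \<phi>j)
    moreover have "(\<lambda>n. \<integral>t. g t \<partial>\<nu> (r n)) \<longlonglongrightarrow> (\<integral>t. g t \<partial>M)"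
      by (rule conv[OF gc, of 1]) (simp add: g_def)
    ultimately have "(\<integral>t. g t \<partial>M) = 0" by (simp add: LIMSEQ_const_iff)
    moreover have "integrable M g"
      by (rule M.integrable_const_bound[of _ 1]) (use gm in \<open>auto simp: g_def\<close>)
    ultimately have "AE t in M. g t = 0"
      by (subst (asm) integral_nonneg_eq_0_iff_AE) (auto simp: g_def)
    then show ?thesis
    proof (rule AE_mp, intro AE_I2 impI)
      fix t assume "g t = 0"
      then have "t = \<phi> t" by (auto simp: g_def min_def split: if_splits)
      then show "t \<in> {0..1}" using \<phi>01[of t] by simp
    qed
  qed
  have mom: "(\<integral>t. \<phi> t ^ i \<partial>M) = inner x (op_poly C ([:0, 1:] ^ i) x)" for i
  proof -
    define L where "L = inner x (op_poly C ([:0, 1:] ^ i) x)"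
    have fc: "continuous_on UNIV (\<lambda>t. \<phi> t ^ i)" by (intro continuous_intros \<phi>c)
    then have fm: "(\<lambda>t. \<phi> t ^ i) \<in> borel_measurable borel" by (rule borel_measurable_continuous_onI)
    have 1: "(\<lambda>n. \<integral>t. \<phi> t ^ i \<partial>\<nu> (r n)) \<longlonglongrightarrow> (\<integral>t. \<phi> t ^ i \<partial>M)"
      by (rule conv[OF fc, of 1]) (simp add: \<phi>01 power_le_one)
    \<comment> \<open>The exact identity is about binomial ratios; replacing them by powers costs at
      most i^2 / n, uniformly in j.\<close>
    have bd: "\<bar>(\<integral>t. \<phi> t ^ i \<partial>\<nu> n) - L\<bar> \<le> (real i)^2 / real n" if "i \<le> n" "n > 0" for n
    proof -
      have nz: "real (n choose i) \<noteq> 0" using that by simp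
      have "(\<integral>t. \<phi> t ^ i \<partial>\<nu> n) = (\<Sum>j\<le>n. c n j * (real j / real n) ^ i)"
        unfolding \<nu>(2)[OF fm] by (intro sum.cong) (simp_all add: \<phi>j)
      moreover have "L = (\<Sum>j\<le>n. c n j * (real (j choose i) / real (n choose i)))"
        using cm[OF that(1)] nz unfolding L_def times_divide_eq_right sum_divide_distrib[symmetric] by simp
      ultimately have "\<bar>(\<integral>t. \<phi> t ^ i \<partial>\<nu> n) - L\<bar>
        = \<bar>\<Sum>j\<le>n. c n j * ((real j / real n) ^ i - real (j choose i) / real (n choose i))\<bar>"
        by (simp add: sum_subtractf right_diff_distrib)
      also have "\<dots> \<le> (\<Sum>j\<le>n. c n j * \<bar>(real j / real n) ^ i - real (j choose i) / real (n choose i)\<bar>)"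
        by (rule order_trans[OF sum_abs]) (simp add: abs_mult c0)
      also have "\<dots> \<le> (\<Sum>j\<le>n. c n j * ((real i)^2 / real n))"
        using choose_ratio_approx[OF _ that]
        by (intro sum_mono mult_left_mono c0) (simp add: abs_minus_commute)
      also have "\<dots> = (real i)^2 / real n" unfolding sum_distrib_right[symmetric] c1 by simp
      finally show ?thesis .
    qed
    have "(\<lambda>n. (\<integral>t. \<phi> t ^ i \<partial>\<nu> n) - L) \<longlonglongrightarrow> 0"
    proof (rule Lim_null_comparison)
      show "\<forall>\<^sub>F n in sequentially. norm ((\<integral>t. \<phi> t ^ i \<partial>\<nu> n) - L) \<le> (real i)^2 / real n"
        using eventually_ge_at_top[of "Suc i"] by eventually_elim (use bd in auto)
      show "(\<lambda>n. (real i)^2 / real n) \<longlonglongrightarrow> 0" by (rule lim_const_over_n)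
    qed
    then have "(\<lambda>n. \<integral>t. \<phi> t ^ i \<partial>\<nu> n) \<longlonglongrightarrow> L" by (rule LIM_zero_cancel)
    then have "(\<lambda>n. \<integral>t. \<phi> t ^ i \<partial>\<nu> (r n)) \<longlonglongrightarrow> L"
      using LIMSEQ_subseq_LIMSEQ[OF _ r] by (simp add: o_def)
    with 1 show ?thesis unfolding L_def by (rule LIMSEQ_unique)
  qed
  have "(\<integral>t. poly p t \<partial>M) = inner x (op_poly C p x)" for p
  proof -
    have \<phi>m: "\<phi> \<in> borel_measurable borel" using \<phi>c by (rule borel_measurable_continuous_onI)
    have "(\<integral>t. poly p t \<partial>M) = (\<integral>t. poly p (\<phi> t) \<partial>M)"
    proof (rule integral_cong_AE)
      show "AE t in M. poly p t = poly p (\<phi> t)"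
        using AE01 by (rule AE_mp) (auto simp: \<phi>_def)
      have pm: "poly p \<in> borel_measurable borel"
        by (intro borel_measurable_continuous_onI continuous_intros)
      then show "(\<lambda>t. poly p t) \<in> borel_measurable M" by simp
      show "(\<lambda>t. poly p (\<phi> t)) \<in> borel_measurable M"
        using measurable_compose[OF \<phi>m pm] by simp
    qed
    also have "\<dots> = (\<integral>t. (\<Sum>i\<le>degree p. coeff p i * \<phi> t ^ i) \<partial>M)" by (simp add: poly_altdef)
    also have "\<dots> = (\<Sum>i\<le>degree p. coeff p i * (\<integral>t. \<phi> t ^ i \<partial>M))"
    proof -
      have "integrable M (\<lambda>t. \<phi> t ^ i)" for i
        by (rule M.integrable_const_bound[of _ 1]) (use \<phi>m in \<open>auto simp: \<phi>01 power_le_one\<close>)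
      then show ?thesis by simp
    qed
    also have "\<dots> = inner x (op_poly C p x)"
      by (simp add: mom op_poly_altdef[of C p x] inner_sum_right)
    finally show ?thesis .
  qed
  with M AE01 show thesis by (rule that)
qed

lemma moment_measure:
  fixes B :: "'a::chilbert_space \<Rightarrow>\<^sub>L 'a"
  assumes B: "selfadjoint_op B"
  obtains \<mu> where "finite_measure \<mu>" "sets \<mu> = sets borel" "AE t in \<mu>. \<bar>t\<bar> \<le> norm B + 1"
    "\<And>p. (\<integral>t. poly p t \<partial>\<mu>) = inner x (op_poly B p x)"
proof (cases "x = 0")
  case True
  show thesis
  proof (rule that[of "null_measure borel"])
    show "(\<integral>t. poly p t \<partial>null_measure borel) = inner x (op_poly B p x)" for p
      using True by (simp add: blinfun.zero_right integral_null_measure)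
  qed (auto intro!: finite_measureI AE_I[of _ _ UNIV] simp: emeasure_null_measure)
next
  case False
  \<comment> \<open>The summand 1 keeps \<open>K\<close> positive for B = 0, so that B + K can be
    rescaled to an operator \<open>C\<close> between 0 and 1.\<close>
  define K where "K = norm B + 1"
  have K: "K > 0" unfolding K_def using norm_ge_zero[of B] by linarith
  define C where "C = (1 / (2 * K)) *\<^sub>R (B + K *\<^sub>R id_blinfun)"
  have Cx: "C y = (1 / (2 * K)) *\<^sub>R (B y + K *\<^sub>R y)" for y
    by (simp add: C_def blinfun.bilinear_simps)
  have cB: "B (c *\<^sub>C y) = c *\<^sub>C B y" for c y using B by (simp add: selfadjoint_op_def clinear_op_def)
  note lin = bounded_linear.linear[OF bounded_linear_scaleC]
  have C: "selfadjoint_op C"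
  proof (rule selfadjoint_opI)
    show "clinear_op C"
      unfolding clinear_op_def Cx by (simp add: cB linear_add[OF lin] linear_scale[OF lin])
    show "inner (C y) z = inner y (C z)" for y z
      unfolding Cx by (simp add: inner_simps selfadjoint_op_inner[OF B])
  qed
  have bB: "\<bar>inner y (B y)\<bar> \<le> K * (norm y)^2" for y
  proof -
    have "\<bar>inner y (B y)\<bar> \<le> norm y * norm (B y)" by (rule Cauchy_Schwarz_ineq2)
    also have "\<dots> \<le> norm y * (norm B * norm y)" by (intro mult_left_mono norm_blinfun) auto
    also have "\<dots> \<le> norm y * (K * norm y)" by (intro mult_left_mono mult_right_mono) (auto simp: K_def)
    finally show ?thesis by (simp add: power2_eq_square mult_ac)
  qed
  have iC: "inner y (C y) = (inner y (B y) + K * (norm y)^2) / (2 * K)" for y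
    unfolding Cx by (simp add: inner_simps power2_norm_eq_inner)
  have C0: "0 \<le> inner y (C y)" for y using bB[of y] K by (simp add: iC)
  have C1: "inner y (C y) \<le> (norm y)^2" for y using bB[of y] K by (simp add: iC divide_le_eq)
  define e where "e = x /\<^sub>R norm x"
  have e: "norm e = 1" using False by (simp add: e_def)
  obtain M where M: "real_distribution M" "AE t in M. t \<in> {0..1}"
    and mom: "\<And>p. (\<integral>t. poly p t \<partial>M) = inner e (op_poly C p e)"
    using moment_measure_unit[OF C C0 C1 e] by blast
  interpret M: real_distribution M by (rule M(1))
  \<comment> \<open>The measure of the unit vector is given total mass (norm x)^2 and then carried
    from [0, 1] back to [-K, K].\<close>
  define N where "N = density M (\<lambda>_. ennreal ((norm x)^2))"
  define \<mu> where "\<mu> = distr N borel (\<lambda>t. 2 * K * t - K)"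
  have mN: "(\<lambda>t. 2 * K * t - K) \<in> measurable N borel" by (simp add: N_def)
  show thesis
  proof (rule that[of \<mu>])
    show "sets \<mu> = sets borel" by (simp add: \<mu>_def)
    show "finite_measure \<mu>"
    proof (rule finite_measureI)
      have "emeasure \<mu> UNIV = emeasure N UNIV"
        unfolding \<mu>_def by (subst emeasure_distr[OF mN]) (simp_all add: N_def)
      also have "\<dots> = ennreal ((norm x)^2) * emeasure M UNIV"
        unfolding N_def by (subst emeasure_density) simp_all
      finally show "emeasure \<mu> (space \<mu>) \<noteq> \<infinity>"
        using M.emeasure_finite[of UNIV] by (simp add: \<mu>_def ennreal_mult_eq_top_iff)
    qed
    have "AE t in N. \<bar>2 * K * t - K\<bar> \<le> K"
      unfolding N_def
    proof (subst AE_density)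
      show "AE t in M. 0 < ennreal ((norm x)^2) \<longrightarrow> \<bar>2 * K * t - K\<bar> \<le> K"
        using M(2)
      proof (rule AE_mp, intro AE_I2 impI)
        fix t :: real assume "t \<in> {0..1}"
        then have "0 \<le> K * t" "K * t \<le> K * 1" using K by (auto intro!: mult_left_mono)
        then show "\<bar>2 * K * t - K\<bar> \<le> K" by (simp add: abs_le_iff)
      qed
    qed simp
    then show "AE t in \<mu>. \<bar>t\<bar> \<le> norm B + 1"
      unfolding \<mu>_def K_def[symmetric] by (subst AE_distr_iff[OF mN]) simp_all
    fix p
    have pm: "poly q \<in> borel_measurable borel" for q :: "real poly"
      by (intro borel_measurable_continuous_onI continuous_intros)
    have "(\<integral>t. poly p t \<partial>\<mu>) = (\<integral>t. poly p (2 * K * t - K) \<partial>N)"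
      unfolding \<mu>_def by (rule integral_distr[OF mN pm])
    also have "\<dots> = (\<integral>t. poly (pcompose p [:- K, 2 * K:]) t \<partial>N)"
      by (simp add: poly_pcompose algebra_simps)
    also have "\<dots> = (\<integral>t. (norm x)^2 *\<^sub>R poly (pcompose p [:- K, 2 * K:]) t \<partial>M)"
      unfolding N_def using pm by (intro integral_density) simp_all
    also have "\<dots> = (norm x)^2 * inner e (op_poly C (pcompose p [:- K, 2 * K:]) e)"
      by (simp add: mom)
    also have "op_poly C (pcompose p [:- K, 2 * K:]) e = op_poly B p e"
      unfolding op_poly_pcompose_linear
      by (rule arg_cong[where f = "\<lambda>T. blinfun_apply (op_poly T p) e"])
         (use K in \<open>auto intro!: blinfun_eqI simp: C_def blinfun.bilinear_simps\<close>)
    also have "(norm x)^2 * inner e (op_poly B p e) = inner x (op_poly B p x)"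
      unfolding e_def using False by (simp add: blinfun.bilinear_simps power2_eq_square field_simps)
    finally show "(\<integral>t. poly p t \<partial>\<mu>) = inner x (op_poly B p x)" .
  qed
qed

section \<open>Existence of spectral measures\<close>

lemma eq_of_abs_diff_le_linear:
  fixes a b C :: real
  assumes "\<And>e. 0 < e \<Longrightarrow> e \<le> 1 \<Longrightarrow> \<bar>a - b\<bar> \<le> C * e"
  shows "a = b"
proof -
  have "\<bar>a - b\<bar> \<le> C * inverse (real (Suc n))" for n
    by (rule assms) (simp_all add: inverse_eq_divide)
  moreover have "(\<lambda>n. C * inverse (real (Suc n))) \<longlonglongrightarrow> C * 0"
    by (intro tendsto_intros LIMSEQ_inverse_real_of_nat)
  ultimately have "\<bar>a - b\<bar> \<le> C * 0" by (intro LIMSEQ_le_const) auto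
  then show ?thesis by simp
qed

text \<open>The measures are chosen separately for each vector; what ties them together is that
  their moments come from the same operators \<open>op_poly B p\<close>. A Borel functional calculus
  is built from this alone.\<close>

locale moment_family =
  fixes B :: "'a::chilbert_space \<Rightarrow>\<^sub>L 'a" and \<mu> :: "'a \<Rightarrow> real measure" and K :: real
  assumes selfadjoint: "selfadjoint_op B"
    and finite_measure: "finite_measure (\<mu> x)"
    and sets_eq [simp, measurable_cong]: "sets (\<mu> x) = sets borel"
    and support: "AE t in \<mu> x. \<bar>t\<bar> \<le> K"
    and moments: "(\<integral>t. poly p t \<partial>\<mu> x) = inner x (op_poly B p x)"
begin

section \<open>Functional calculus for Borel functions bounded on the support\<close>

lemma space_eq [simp]: "space (\<mu> x) = UNIV"
  using sets_eq_imp_space_eq[OF sets_eq] by simp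

lemma measure_UNIV: "measure (\<mu> x) UNIV = (norm x)^2"
  using moments[of x 1] by (simp add: power2_norm_eq_inner)

text \<open>Boundedness is required only on the support, so that polynomials qualify.\<close>

definition admissible :: "(real \<Rightarrow> real) \<Rightarrow> bool" where
  "admissible f \<longleftrightarrow> f \<in> borel_measurable borel \<and> (\<exists>M. \<forall>t. \<bar>t\<bar> \<le> K \<longrightarrow> \<bar>f t\<bar> \<le> M)"

lemma admissibleI: "f \<in> borel_measurable borel \<Longrightarrow> (\<And>t. \<bar>t\<bar> \<le> K \<Longrightarrow> \<bar>f t\<bar> \<le> M) \<Longrightarrow> admissible f"
  by (auto simp: admissible_def)

lemma admissible_measurable: "admissible f \<Longrightarrow> f \<in> borel_measurable borel"
  by (simp add: admissible_def)

lemma admissible_poly: "admissible (poly p)"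
proof -
  have c: "continuous_on S (poly p)" for S :: "real set" by (intro continuous_intros)
  have "compact (poly p ` {-K..K})" by (intro compact_continuous_image c) simp
  then have "bounded (poly p ` {-K..K})" by (rule compact_imp_bounded)
  then obtain M where "\<forall>t\<in>{-K..K}. \<bar>poly p t\<bar> \<le> M" unfolding bounded_iff by auto
  then show ?thesis by (intro admissibleI[of _ M] borel_measurable_continuous_onI c) (auto simp: abs_le_iff)
qed

lemma admissible_const: "admissible (\<lambda>t. c)"
  by (rule admissibleI[of _ "\<bar>c\<bar>"]) auto

lemma admissible_add: 
  assumes "admissible f" "admissible g"
  shows "admissible (\<lambda>t. f t + g t)"
proof -
  obtain M N where MN: "\<And>t. \<bar>t\<bar> \<le> K \<Longrightarrow> \<bar>f t\<bar> \<le> M" "\<And>t. \<bar>t\<bar> \<le> K \<Longrightarrow> \<bar>g t\<bar> \<le> N"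
    using assms by (auto simp: admissible_def)
  show ?thesis
  proof (rule admissibleI[of _ "M + N"])
    show "\<bar>f t + g t\<bar> \<le> M + N" if "\<bar>t\<bar> \<le> K" for t
      using MN[OF that] by linarith
  qed (intro borel_measurable_add admissible_measurable assms)
qed

lemma admissible_mult: 
  assumes "admissible f" "admissible g"
  shows "admissible (\<lambda>t. f t * g t)"
proof -
  obtain M N where MN: "\<And>t. \<bar>t\<bar> \<le> K \<Longrightarrow> \<bar>f t\<bar> \<le> M" "\<And>t. \<bar>t\<bar> \<le> K \<Longrightarrow> \<bar>g t\<bar> \<le> N"
    using assms by (auto simp: admissible_def)
  show ?thesis
  proof (rule admissibleI[of _ "M * N"])
    show "\<bar>f t * g t\<bar> \<le> M * N" if "\<bar>t\<bar> \<le> K" for t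
      using MN[OF that] unfolding abs_mult by (intro mult_mono) auto
  qed (intro borel_measurable_times admissible_measurable assms)
qed

lemma admissible_diff: "admissible f \<Longrightarrow> admissible g \<Longrightarrow> admissible (\<lambda>t. f t - g t)"
  using admissible_add[of f "\<lambda>t. - 1 * g t"] admissible_mult[OF admissible_const, of g "- 1"] by simp

lemma admissible_power2: "admissible f \<Longrightarrow> admissible (\<lambda>t. (f t)^2)"
  using admissible_mult[of f f] by (simp add: power2_eq_square)

lemma admissible_abs: "admissible f \<Longrightarrow> admissible (\<lambda>t. \<bar>f t\<bar>)"
  by (auto simp: admissible_def)

lemmas admissible_intros = admissible_poly admissible_const admissible_add admissible_mult admissible_diff
  admissible_power2 admissible_abs

lemma integrable_admissible:
  assumes "admissible f"
  shows "integrable (\<mu> x) f"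
proof -
  interpret finite_measure "\<mu> x" by (rule finite_measure)
  obtain M where "\<And>t. \<bar>t\<bar> \<le> K \<Longrightarrow> \<bar>f t\<bar> \<le> M" using assms by (auto simp: admissible_def)
  then show ?thesis
    using support[of x] admissible_measurable[OF assms]
    by (intro integrable_const_bound[of _ M]) auto
qed

lemma integral_mono_admissible:
  assumes "admissible f" "admissible g" "\<And>t. \<bar>t\<bar> \<le> K \<Longrightarrow> f t \<le> g t"
  shows "(\<integral>t. f t \<partial>\<mu> x) \<le> (\<integral>t. g t \<partial>\<mu> x)"
  using support[of x] assms(3) by (intro integral_mono_AE integrable_admissible assms) auto

lemma norm_op_poly: "(norm (op_poly B p x))^2 = (\<integral>t. (poly p t)^2 \<partial>\<mu> x)"
proof -
  have "(norm (op_poly B p x))^2 = inner x (op_poly B (p * p) x)"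
    by (simp only: power2_norm_eq_inner op_poly_mult selfadjoint_op_inner[OF selfadjoint_op_poly[OF selfadjoint]])
  moreover have "(\<lambda>t. (poly p t)^2) = poly (p * p)" by (simp add: fun_eq_iff power2_eq_square)
  ultimately show ?thesis by (simp only: moments)
qed

text \<open>A squared distance, which is why its triangle inequality carries factors 2.\<close>

definition l2dist :: "'a \<Rightarrow> (real \<Rightarrow> real) \<Rightarrow> (real \<Rightarrow> real) \<Rightarrow> real" where
  "l2dist x f g = (\<integral>t. (f t - g t)^2 \<partial>\<mu> x)"

lemma l2dist_triangle:
  assumes "admissible f" "admissible g" "admissible h"
  shows "l2dist x f h \<le> 2 * l2dist x f g + 2 * l2dist x g h"
proof -
  have "l2dist x f h \<le> (\<integral>t. 2 * (f t - g t)^2 + 2 * (g t - h t)^2 \<partial>\<mu> x)"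
    unfolding l2dist_def
  proof (intro integral_mono_admissible admissible_intros assms)
    fix t
    have "0 \<le> ((f t - g t) - (g t - h t))^2" by simp
    then show "(f t - h t)^2 \<le> 2 * (f t - g t)^2 + 2 * (g t - h t)^2"
      by (simp add: power2_eq_square algebra_simps)
  qed
  then show ?thesis
    using assms by (simp add: l2dist_def integrable_admissible admissible_intros)
qed

lemma l2dist_commute: "l2dist x f g = l2dist x g f"
  by (simp add: l2dist_def power2_commute)

lemma norm_op_poly_diff: "(norm (op_poly B p x - op_poly B q x))^2 = l2dist x (poly p) (poly q)"
  using norm_op_poly[of "p - q" x] by (simp add: l2dist_def)

text \<open>This expresses T = f(B). Sending p to \<open>op_poly B p x\<close> is isometric for the
  L2 norm of \<open>\<mu> x\<close>, and T x should be the value at f of the continuous extension;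
  asking for one polynomial close to both f and T x records this without constructing L2.\<close>

definition represents :: "(real \<Rightarrow> real) \<Rightarrow> ('a \<Rightarrow>\<^sub>L 'a) \<Rightarrow> bool" where
  "represents f T \<longleftrightarrow> admissible f \<and> selfadjoint_op T \<and>
    (\<forall>x. \<forall>e>0. \<exists>p. norm (T x - op_poly B p x) \<le> e \<and> l2dist x f (poly p) \<le> e^2)"

lemma represents_admissible: "represents f T \<Longrightarrow> admissible f"
  and represents_selfadjoint: "represents f T \<Longrightarrow> selfadjoint_op T"
  by (simp_all add: represents_def)

lemma represents_poly: "represents (poly p) (op_poly B p)"
  unfolding represents_def using admissible_poly selfadjoint_op_poly[OF selfadjoint]
  by (auto simp: l2dist_def intro!: exI[of _ p])

text \<open>The values c = 1 and c = -1 serve partial unions and complements; with modulus 1 the two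
  error terms enter symmetrically.\<close>

lemma represents_add:
  assumes f: "represents f S" and g: "represents g T" and c: "\<bar>c\<bar> = 1"
  shows "represents (\<lambda>t. f t + c * g t) (S + c *\<^sub>R T)"
  unfolding represents_def
proof (intro conjI allI impI)
  note af = represents_admissible[OF f] and ag = represents_admissible[OF g]
  show "admissible (\<lambda>t. f t + c * g t)" by (intro admissible_intros af ag)
  note sa = represents_selfadjoint[OF f] represents_selfadjoint[OF g]
  have cl: "S (z *\<^sub>C x) = z *\<^sub>C S x" "T (z *\<^sub>C x) = z *\<^sub>C T x" for z x
    using sa by (auto simp: selfadjoint_op_def clinear_op_def)
  note lin = bounded_linear.linear[OF bounded_linear_scaleC]
  show "selfadjoint_op (S + c *\<^sub>R T)"
    by (rule selfadjoint_opI)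
       (simp_all add: clinear_op_def blinfun.bilinear_simps inner_simps cl selfadjoint_op_inner[OF sa(1)]
         selfadjoint_op_inner[OF sa(2)] linear_add[OF lin] linear_scale[OF lin])
  fix x and e :: real assume "e > 0"
  then have e: "e / 2 > 0" by simp
  obtain p where p: "norm (S x - op_poly B p x) \<le> e / 2" "l2dist x f (poly p) \<le> (e / 2)^2"
    using f e unfolding represents_def by meson
  obtain q where q: "norm (T x - op_poly B q x) \<le> e / 2" "l2dist x g (poly q) \<le> (e / 2)^2"
    using g e unfolding represents_def by meson
  show "\<exists>p. norm ((S + c *\<^sub>R T) x - op_poly B p x) \<le> e \<and> l2dist x (\<lambda>t. f t + c * g t) (poly p) \<le> e^2"
  proof (intro exI conjI)
    have "(S + c *\<^sub>R T) x - op_poly B (p + smult c q) x = (S x - op_poly B p x) + c *\<^sub>R (T x - op_poly B q x)"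
      by (simp add: blinfun.bilinear_simps algebra_simps)
    also have "norm \<dots> \<le> norm (S x - op_poly B p x) + \<bar>c\<bar> * norm (T x - op_poly B q x)"
      by (rule order_trans[OF norm_triangle_ineq]) simp
    finally show "norm ((S + c *\<^sub>R T) x - op_poly B (p + smult c q) x) \<le> e" using p q c by simp
    have c2: "c^2 = 1" using c by (metis power2_abs one_power2)
    have "l2dist x (\<lambda>t. f t + c * g t) (poly (p + smult c q))
      \<le> (\<integral>t. 2 * (f t - poly p t)^2 + 2 * (g t - poly q t)^2 \<partial>\<mu> x)"
      unfolding l2dist_def
    proof (intro integral_mono_admissible admissible_intros af ag)
      fix t
      define a b where "a = f t - poly p t" and "b = g t - poly q t"
      have "0 \<le> (a - c * b)^2" by simp
      moreover have "(c * b)^2 = b^2" using c2 by (simp add: power_mult_distrib)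
      ultimately have "(a + c * b)^2 \<le> 2 * a^2 + 2 * b^2" by (simp add: power2_sum power2_diff)
      then show "(f t + c * g t - poly (p + smult c q) t)^2 \<le> 2 * (f t - poly p t)^2 + 2 * (g t - poly q t)^2"
        by (simp add: a_def b_def algebra_simps)
    qed
    also have "\<dots> = 2 * l2dist x f (poly p) + 2 * l2dist x g (poly q)"
      by (simp add: l2dist_def integrable_admissible admissible_intros af ag)
    also have "\<dots> \<le> e^2" using p q by (simp add: power_divide)
    finally show "l2dist x (\<lambda>t. f t + c * g t) (poly (p + smult c q)) \<le> e^2" .
  qed
qed

text \<open>The factor 4 comes from applying the squared triangle inequality twice. Only uniqueness
  and the Cauchy property are drawn from this bound, so its size is harmless.\<close>

lemma represents_norm_diff_le:
  assumes f: "represents f S" and g: "represents g T"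
  shows "(norm (S x - T x))^2 \<le> 4 * l2dist x f g"
proof -
  note af = represents_admissible[OF f] and ag = represents_admissible[OF g]
  have I0: "0 \<le> l2dist x f g" by (simp add: l2dist_def)
  have "norm (S x - T x) \<le> 2 * e + sqrt (6 * e^2 + 4 * l2dist x f g)" if e: "e > 0" for e
  proof -
    obtain p where p: "norm (S x - op_poly B p x) \<le> e" "l2dist x f (poly p) \<le> e^2"
      using f e unfolding represents_def by meson
    obtain q where q: "norm (T x - op_poly B q x) \<le> e" "l2dist x g (poly q) \<le> e^2"
      using g e unfolding represents_def by meson
    have "l2dist x (poly p) (poly q) \<le> 2 * l2dist x (poly p) f + 2 * l2dist x f (poly q)"
      by (intro l2dist_triangle af admissible_poly)
    also have "\<dots> \<le> 2 * e^2 + 2 * (2 * l2dist x f g + 2 * l2dist x g (poly q))"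
      using p(2) l2dist_triangle[OF af ag admissible_poly, of x q] by (simp add: l2dist_commute)
    also have "\<dots> \<le> 6 * e^2 + 4 * l2dist x f g" using q(2) by simp
    finally have "norm (op_poly B p x - op_poly B q x) \<le> sqrt (6 * e^2 + 4 * l2dist x f g)"
      by (intro real_le_rsqrt) (simp add: norm_op_poly_diff)
    moreover have "norm (S x - T x) \<le> norm (S x - op_poly B p x) + norm (op_poly B p x - op_poly B q x) + norm (op_poly B q x - T x)"
    proof -
      have "S x - T x = (S x - op_poly B p x) + (op_poly B p x - op_poly B q x) + (op_poly B q x - T x)" by simp
      then show ?thesis by (metis (no_types) norm_triangle_mono norm_triangle_ineq order_refl)
    qed
    ultimately show ?thesis using p(1) q(1) by (simp add: norm_minus_commute)
  qed
  then have "norm (S x - T x) \<le> 2 * inverse (real (Suc n)) + sqrt (6 * (inverse (real (Suc n)))^2 + 4 * l2dist x f g)" for n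
    by simp
  moreover have "(\<lambda>n. 2 * inverse (real (Suc n)) + sqrt (6 * (inverse (real (Suc n)))^2 + 4 * l2dist x f g))
      \<longlonglongrightarrow> 2 * 0 + sqrt (6 * 0^2 + 4 * l2dist x f g)"
    by (intro tendsto_intros LIMSEQ_inverse_real_of_nat)
  ultimately have "norm (S x - T x) \<le> 2 * 0 + sqrt (6 * 0^2 + 4 * l2dist x f g)"
    by (intro LIMSEQ_le_const) auto
  then have "norm (S x - T x) \<le> sqrt (4 * l2dist x f g)" by simp
  then have "(norm (S x - T x))^2 \<le> (sqrt (4 * l2dist x f g))^2" by (intro power_mono) auto
  then show ?thesis using I0 by simp
qed

lemma represents_unique:
  assumes "represents f S" "represents f T"
  shows "S = T"
proof (rule blinfun_eqI)
  fix x
  have "(norm (S x - T x))^2 \<le> 0"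
    using represents_norm_diff_le[OF assms, of x] by (simp add: l2dist_def)
  then show "S x = T x" by simp
qed

text \<open>The pointwise inequality a \<le> e / 2 + a^2 / (2 e) trades the L2 bound for an L1 bound
  that is still linear in e.\<close>

lemma integral_abs_diff_le:
  assumes "admissible f" "admissible g" "l2dist x f g \<le> e^2" "e > 0"
  shows "(\<integral>t. \<bar>f t - g t\<bar> \<partial>\<mu> x) \<le> e * ((norm x)^2 + 1) / 2"
proof -
  have "(\<integral>t. \<bar>f t - g t\<bar> \<partial>\<mu> x) \<le> (\<integral>t. e / 2 + (1 / (2 * e)) * (f t - g t)^2 \<partial>\<mu> x)"
  proof (intro integral_mono_admissible admissible_intros assms)
    fix t
    define a where "a = \<bar>f t - g t\<bar>"
    have "0 \<le> (a - e)^2" by simp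
    then have "2 * e * a \<le> e^2 + a^2" by (simp add: power2_diff algebra_simps)
    then have "a \<le> (e^2 + a^2) / (2 * e)" using assms(4) by (simp add: field_simps)
    also have "\<dots> = e / 2 + (1 / (2 * e)) * a^2" using assms(4) by (simp add: field_simps power2_eq_square)
    finally show "\<bar>f t - g t\<bar> \<le> e / 2 + (1 / (2 * e)) * (f t - g t)^2" by (simp add: a_def)
  qed
  also have "\<dots> = e / 2 * (norm x)^2 + (1 / (2 * e)) * l2dist x f g"
    using assms by (simp add: l2dist_def integrable_admissible admissible_intros measure_UNIV)
  also have "\<dots> \<le> e / 2 * (norm x)^2 + (1 / (2 * e)) * e^2"
    using assms by (intro add_left_mono mult_left_mono) auto
  finally show ?thesis using assms(4) by (simp add: power2_eq_square field_simps)
qed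

lemma represents_inner:
  assumes f: "represents f T"
  shows "inner x (T x) = (\<integral>t. f t \<partial>\<mu> x)"
proof (rule eq_of_abs_diff_le_linear)
  fix e :: real assume e: "0 < e" "e \<le> 1"
  note af = represents_admissible[OF f]
  obtain p where p: "norm (T x - op_poly B p x) \<le> e" "l2dist x f (poly p) \<le> e^2"
    using f e unfolding represents_def by meson
  have "\<bar>inner x (T x) - inner x (op_poly B p x)\<bar> \<le> norm x * norm (T x - op_poly B p x)"
    by (metis Cauchy_Schwarz_ineq2 inner_diff_right)
  also have "\<dots> \<le> norm x * e" using p(1) by (intro mult_left_mono) auto
  finally have 1: "\<bar>inner x (T x) - inner x (op_poly B p x)\<bar> \<le> norm x * e" .
  have "\<bar>(\<integral>t. f t \<partial>\<mu> x) - inner x (op_poly B p x)\<bar> = \<bar>\<integral>t. f t - poly p t \<partial>\<mu> x\<bar>"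
    unfolding moments[symmetric] by (simp add: integrable_admissible admissible_poly af)
  also have "\<dots> \<le> (\<integral>t. \<bar>f t - poly p t\<bar> \<partial>\<mu> x)" by (rule integral_abs_bound)
  also have "\<dots> \<le> e * ((norm x)^2 + 1) / 2"
    by (rule integral_abs_diff_le[OF af admissible_poly p(2) e(1)])
  finally have "\<bar>inner x (T x) - (\<integral>t. f t \<partial>\<mu> x)\<bar> \<le> norm x * e + e * ((norm x)^2 + 1) / 2"
    using 1 by linarith
  then show "\<bar>inner x (T x) - (\<integral>t. f t \<partial>\<mu> x)\<bar> \<le> (norm x + ((norm x)^2 + 1) / 2) * e"
    by (simp add: field_simps)
qed

lemma represents_norm:
  assumes f: "represents f T"
  shows "(norm (T x))^2 = (\<integral>t. (f t)^2 \<partial>\<mu> x)"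
proof -
  note af = represents_admissible[OF f]
  from af obtain M where M': "\<forall>t. \<bar>t\<bar> \<le> K \<longrightarrow> \<bar>f t\<bar> \<le> M"
    unfolding admissible_def by (elim conjE exE)
  have M: "\<bar>f t\<bar> \<le> \<bar>M\<bar>" if "\<bar>t\<bar> \<le> K" for t
    by (rule order_trans[OF M'[rule_format, OF that] abs_ge_self])
  show ?thesis
  proof (rule eq_of_abs_diff_le_linear)
    fix e :: real assume e: "0 < e" "e \<le> 1"
    obtain p where p: "norm (T x - op_poly B p x) \<le> e" "l2dist x f (poly p) \<le> e^2"
      using f e unfolding represents_def by meson
    define a b where "a = norm (T x)" and "b = norm (op_poly B p x)"
    have ab: "\<bar>a - b\<bar> \<le> e" using p(1) unfolding a_def b_def by (rule order_trans[OF norm_triangle_ineq3])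
    have "\<bar>a^2 - b^2\<bar> = \<bar>a - b\<bar> * (a + b)"
      by (simp add: a_def b_def power2_eq_square square_diff_square_factored abs_mult)
    also have "\<dots> \<le> e * (2 * a + 1)" using ab e by (intro mult_mono) (auto simp: a_def b_def)
    finally have 1: "\<bar>a^2 - b^2\<bar> \<le> e * (2 * a + 1)" .
    have "\<bar>(\<integral>t. (f t)^2 \<partial>\<mu> x) - b^2\<bar> = \<bar>\<integral>t. (f t)^2 - (poly p t)^2 \<partial>\<mu> x\<bar>"
      unfolding b_def norm_op_poly by (simp add: integrable_admissible admissible_intros af)
    also have "\<dots> \<le> (\<integral>t. \<bar>(f t)^2 - (poly p t)^2\<bar> \<partial>\<mu> x)" by (rule integral_abs_bound)
    also have "\<dots> \<le> (\<integral>t. (f t - poly p t)^2 + 2 * \<bar>M\<bar> * \<bar>f t - poly p t\<bar> \<partial>\<mu> x)"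
    proof (intro integral_mono_admissible admissible_intros af)
      fix t assume t: "\<bar>t\<bar> \<le> K"
      define u where "u = f t - poly p t"
      have "(f t)^2 - (poly p t)^2 = 2 * f t * u - u^2"
        by (simp add: u_def power2_eq_square algebra_simps)
      then have "\<bar>(f t)^2 - (poly p t)^2\<bar> \<le> \<bar>2 * f t * u\<bar> + u^2"
        using abs_triangle_ineq4[of "2 * f t * u" "u^2"] by simp
      also have "\<bar>2 * f t * u\<bar> \<le> 2 * \<bar>M\<bar> * \<bar>u\<bar>"
        using M[OF t] by (simp add: abs_mult mult_right_mono)
      finally show "\<bar>(f t)^2 - (poly p t)^2\<bar> \<le> (f t - poly p t)^2 + 2 * \<bar>M\<bar> * \<bar>f t - poly p t\<bar>"
        by (simp add: u_def)
    qed
    also have "\<dots> = l2dist x f (poly p) + 2 * \<bar>M\<bar> * (\<integral>t. \<bar>f t - poly p t\<bar> \<partial>\<mu> x)"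
      by (simp add: l2dist_def integrable_admissible admissible_intros af)
    also have "\<dots> \<le> e * 1 + 2 * \<bar>M\<bar> * (e * ((norm x)^2 + 1) / 2)"
    proof (intro add_mono mult_left_mono)
      show "l2dist x f (poly p) \<le> e * 1"
      proof -
        have "e * e \<le> e * 1" using e by (intro mult_left_mono) auto
        then show ?thesis using p(2) by (simp add: power2_eq_square)
      qed
      show "(\<integral>t. \<bar>f t - poly p t\<bar> \<partial>\<mu> x) \<le> e * ((norm x)^2 + 1) / 2"
        by (rule integral_abs_diff_le[OF af admissible_poly p(2) e(1)])
    qed simp
    finally have 2: "\<bar>(\<integral>t. (f t)^2 \<partial>\<mu> x) - b^2\<bar> \<le> e * 1 + 2 * \<bar>M\<bar> * (e * ((norm x)^2 + 1) / 2)" .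
    have "\<bar>a^2 - (\<integral>t. (f t)^2 \<partial>\<mu> x)\<bar> \<le> e * (2 * a + 1) + (e * 1 + 2 * \<bar>M\<bar> * (e * ((norm x)^2 + 1) / 2))"
      using 1 2 by (smt (verit))
    also have "\<dots> = (2 * a + 2 + \<bar>M\<bar> * ((norm x)^2 + 1)) * e" by (simp add: algebra_simps)
    finally show "\<bar>(norm (T x))^2 - (\<integral>t. (f t)^2 \<partial>\<mu> x)\<bar> \<le> (2 * a + 2 + \<bar>M\<bar> * ((norm x)^2 + 1)) * e"
      by (simp add: a_def)
  qed
qed

text \<open>Dominated convergence makes \<open>f n\<close> converge to g in L2 of every
  \<open>\<mu> x\<close>, and \<open>represents_norm_diff_le\<close> turns this into strong
  convergence of \<open>T n\<close>. Closure under bounded pointwise limits carries the calculus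
  from polynomials to Borel sets.\<close>

lemma represents_limit:
  assumes rep: "\<And>n. represents (f n) (T n)" and g: "g \<in> borel_measurable borel"
    and bd: "\<And>n t. \<bar>t\<bar> \<le> K \<Longrightarrow> \<bar>f n t\<bar> \<le> M"
    and lim: "\<And>t. \<bar>t\<bar> \<le> K \<Longrightarrow> (\<lambda>n. f n t) \<longlonglongrightarrow> g t"
  obtains S where "represents g S" "\<And>x. (\<lambda>n. T n x) \<longlonglongrightarrow> S x"
proof -
  note af = represents_admissible[OF rep]
  have gM: "\<bar>g t\<bar> \<le> M" if "\<bar>t\<bar> \<le> K" for t
    by (rule LIMSEQ_le_const2[OF tendsto_rabs[OF lim[OF that]]]) (simp add: bd[OF that])
  have ag: "admissible g" by (rule admissibleI[OF g gM])
  have l2: "(\<lambda>n. l2dist x (f n) g) \<longlonglongrightarrow> 0" for x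
  proof -
    interpret finite_measure "\<mu> x" by (rule finite_measure)
    have "(\<lambda>n. \<integral>t. (f n t - g t)^2 \<partial>\<mu> x) \<longlonglongrightarrow> (\<integral>t. 0 \<partial>\<mu> x)"
    proof (rule integral_dominated_convergence[where w = "\<lambda>_. (2 * M)^2"])
      show "(\<lambda>t. (f n t - g t)^2) \<in> borel_measurable (\<mu> x)" for n
        using admissible_measurable[OF af] g by simp
      show "AE t in \<mu> x. (\<lambda>n. (f n t - g t)^2) \<longlonglongrightarrow> 0"
        using support[of x]
      proof (rule AE_mp, intro AE_I2 impI)
        fix t assume "\<bar>t\<bar> \<le> K"
        from tendsto_power[OF tendsto_diff[OF lim[OF this] tendsto_const[of "g t"]], of 2]
        show "(\<lambda>n. (f n t - g t)^2) \<longlonglongrightarrow> 0" by simp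
      qed
      show "AE t in \<mu> x. norm ((f n t - g t)^2) \<le> (2 * M)^2" for n
        using support[of x]
      proof (rule AE_mp, intro AE_I2 impI)
        fix t assume t: "\<bar>t\<bar> \<le> K"
        have "\<bar>f n t - g t\<bar> \<le> \<bar>2 * M\<bar>" using bd[OF t, of n] gM[OF t] by linarith
        then show "norm ((f n t - g t)^2) \<le> (2 * M)^2" by (simp add: abs_le_square_iff)
      qed
    qed simp_all
    then show ?thesis by (simp add: l2dist_def)
  qed
  have Cauchy: "Cauchy (\<lambda>n. T n x)" for x
  proof (rule metric_CauchyI)
    fix e :: real assume e: "e > 0"
    have "\<forall>\<^sub>F n in sequentially. l2dist x (f n) g < e^2 / 16"
      using order_tendstoD(2)[OF l2[of x], of "e^2 / 16"] e by simp
    then obtain N where N: "\<And>n. n \<ge> N \<Longrightarrow> l2dist x (f n) g < e^2 / 16"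
      by (auto simp: eventually_sequentially)
    have "dist (T m x) (T n x) < e" if "m \<ge> N" "n \<ge> N" for m n
    proof -
      have "(norm (T m x - T n x))^2 \<le> 4 * l2dist x (f m) (f n)" by (rule represents_norm_diff_le[OF rep rep])
      also have "\<dots> \<le> 4 * (2 * l2dist x (f m) g + 2 * l2dist x g (f n))"
        by (intro mult_left_mono l2dist_triangle af ag) simp
      also have "\<dots> < e^2" using N[OF that(1)] N[OF that(2)] by (simp add: l2dist_commute)
      finally show ?thesis using e by (simp add: dist_norm power2_less_imp_less)
    qed
    then show "\<exists>N. \<forall>m\<ge>N. \<forall>n\<ge>N. dist (T m x) (T n x) < e" by blast
  qed
  define s where "s x = lim (\<lambda>n. T n x)" for x
  have conv: "(\<lambda>n. T n x) \<longlonglongrightarrow> s x" for x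
    using Cauchy_convergent[OF Cauchy[of x]] by (simp add: s_def convergent_LIMSEQ_iff)
  have bl: "bounded_linear s"
  proof (rule bounded_linear_intro)
    show "s (x + y) = s x + s y" for x y
      by (rule LIMSEQ_unique[OF conv]) (simp add: blinfun.bilinear_simps tendsto_add conv)
    show "s (r *\<^sub>R x) = r *\<^sub>R s x" for r x
      by (rule LIMSEQ_unique[OF conv]) (simp add: blinfun.bilinear_simps tendsto_scaleR conv)
    show "norm (s x) \<le> norm x * \<bar>M\<bar>" for x
    proof -
      have "norm (T n x) \<le> norm x * \<bar>M\<bar>" for n
      proof (rule power2_le_imp_le)
        have "(norm (T n x))^2 = (\<integral>t. (f n t)^2 \<partial>\<mu> x)" by (rule represents_norm[OF rep])
        also have "\<dots> \<le> (\<integral>t. M^2 \<partial>\<mu> x)"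
          using bd by (intro integral_mono_admissible admissible_intros af)
            (metis abs_le_square_iff abs_ge_self order_trans)
        also have "\<dots> = (norm x * \<bar>M\<bar>)^2" by (simp add: measure_UNIV power_mult_distrib)
        finally show "(norm (T n x))^2 \<le> (norm x * \<bar>M\<bar>)^2" .
      qed simp
      then show ?thesis using tendsto_norm[OF conv[of x]] by (intro LIMSEQ_le_const2) auto
    qed
  qed
  define S where "S = Blinfun s"
  have S: "S x = s x" for x unfolding S_def by (simp add: bounded_linear_Blinfun_apply bl)
  note saT = represents_selfadjoint[OF rep]
  have "selfadjoint_op S"
  proof (rule selfadjoint_opI)
    have "S (z *\<^sub>C x) = z *\<^sub>C S x" for z x
    proof (rule LIMSEQ_unique)
      show "(\<lambda>n. T n (z *\<^sub>C x)) \<longlonglongrightarrow> S (z *\<^sub>C x)" unfolding S by (rule conv)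
      have "T n (z *\<^sub>C x) = z *\<^sub>C T n x" for n using saT[of n] by (simp add: selfadjoint_op_def clinear_op_def)
      then show "(\<lambda>n. T n (z *\<^sub>C x)) \<longlonglongrightarrow> z *\<^sub>C S x"
        unfolding S using bounded_linear.tendsto[OF bounded_linear_scaleC conv] by simp
    qed
    then show "clinear_op S" by (simp add: clinear_op_def)
    show "inner (S x) y = inner x (S y)" for x y
    proof (rule LIMSEQ_unique)
      show "(\<lambda>n. inner (T n x) y) \<longlonglongrightarrow> inner (S x) y" unfolding S by (intro tendsto_intros conv)
      show "(\<lambda>n. inner (T n x) y) \<longlonglongrightarrow> inner x (S y)"
        unfolding S selfadjoint_op_inner[OF saT] by (intro tendsto_intros conv)
    qed
  qed
  moreover have "\<exists>p. norm (S x - op_poly B p x) \<le> e \<and> l2dist x g (poly p) \<le> e^2" if e: "e > 0" for x e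
  proof -
    have e2: "e / 2 > 0" using e by (rule half_gt_zero)
    have "\<forall>\<^sub>F n in sequentially. l2dist x (f n) g < e^2 / 4"
      using order_tendstoD(2)[OF l2[of x], of "e^2 / 4"] e by simp
    moreover have "\<forall>\<^sub>F n in sequentially. dist (T n x) (S x) < e / 2"
      unfolding S by (rule tendstoD[OF conv e2])
    ultimately have "\<forall>\<^sub>F n in sequentially. l2dist x (f n) g < e^2 / 4 \<and> dist (T n x) (S x) < e / 2"
      by (rule eventually_conj)
    then obtain n where n: "l2dist x (f n) g < e^2 / 4" "dist (T n x) (S x) < e / 2"
      by (auto simp: eventually_sequentially)
    obtain p where p: "norm (T n x - op_poly B p x) \<le> e / 2" "l2dist x (f n) (poly p) \<le> (e / 2)^2"
      using rep[of n] e2 unfolding represents_def by meson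
    have "norm (S x - op_poly B p x) \<le> norm (S x - T n x) + norm (T n x - op_poly B p x)"
      by (rule norm_diff_triangle_le[OF order_refl order_refl])
    then have "norm (S x - op_poly B p x) \<le> e" using n p by (simp add: dist_norm norm_minus_commute)
    moreover have "l2dist x g (poly p) \<le> 2 * l2dist x g (f n) + 2 * l2dist x (f n) (poly p)"
      by (intro l2dist_triangle af ag admissible_poly)
    then have "l2dist x g (poly p) \<le> e^2" using n(1) p(2) by (simp add: l2dist_commute power_divide)
    ultimately show ?thesis by blast
  qed
  ultimately have "represents g S" using ag by (simp add: represents_def)
  then show thesis using that conv S by simp
qed

lemma represents_continuous:
  assumes f: "continuous_on UNIV f"
  obtains S where "represents f S"
proof -
  have "\<exists>p. \<forall>t\<in>{-K..K}. \<bar>f t - poly p t\<bar> < inverse (real (Suc n))" for n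
  proof -
    have "\<exists>g. (\<exists>p. g = poly p) \<and> (\<forall>t\<in>{-K..K}. \<bar>f t - g t\<bar> < inverse (real (Suc n)))"
    proof (rule Stone_Weierstrass_HOL)
      show "\<exists>p. (\<lambda>t. c) = poly p" for c :: real by (intro exI[of _ "[:c:]"]) (simp add: fun_eq_iff)
      show "continuous_on {-K..K} g" if "\<exists>p. g = poly p" for g :: "real \<Rightarrow> real"
        using that by (auto intro!: continuous_intros)
      show "\<exists>p. (\<lambda>t. g t + h t) = poly p" if gh: "(\<exists>p. g = poly p) \<and> (\<exists>p. h = poly p)" for g h :: "real \<Rightarrow> real"
      proof -
        from gh obtain p q where "g = poly p" "h = poly q" by blast
        then show ?thesis by (intro exI[of _ "p + q"]) (simp add: fun_eq_iff)
      qed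
      show "\<exists>p. (\<lambda>t. g t * h t) = poly p" if gh: "(\<exists>p. g = poly p) \<and> (\<exists>p. h = poly p)" for g h :: "real \<Rightarrow> real"
      proof -
        from gh obtain p q where "g = poly p" "h = poly q" by blast
        then show ?thesis by (intro exI[of _ "p * q"]) (simp add: fun_eq_iff)
      qed
      show "\<exists>g. (\<exists>p. g = poly p) \<and> g s \<noteq> g t" if "s \<in> {-K..K} \<and> t \<in> {-K..K} \<and> s \<noteq> t" for s t
        using that by (intro exI[of _ "poly [:0, 1:]"]) auto
    qed (use f in \<open>auto intro: continuous_on_subset\<close>)
    then show ?thesis by blast
  qed
  then have "\<forall>n. \<exists>p. \<forall>t\<in>{-K..K}. \<bar>f t - poly p t\<bar> < inverse (real (Suc n))" by blast
  from choice[OF this] obtain p where p: "\<forall>n. \<forall>t\<in>{-K..K}. \<bar>f t - poly (p n) t\<bar> < inverse (real (Suc n))" ..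
  have close: "\<bar>f t - poly (p n) t\<bar> < inverse (real (Suc n))" if "\<bar>t\<bar> \<le> K" for n t
    using p[rule_format, of t n] that by (simp add: abs_le_iff)
  have "compact (f ` {-K..K})"
    by (intro compact_continuous_image continuous_on_subset[OF f]) auto
  then have "bounded (f ` {-K..K})" by (rule compact_imp_bounded)
  then obtain M where M: "\<forall>t\<in>{-K..K}. \<bar>f t\<bar> \<le> M" unfolding bounded_iff by auto
  show thesis
  proof (rule represents_limit)
    show "represents (poly (p n)) (op_poly B (p n))" for n by (rule represents_poly)
    show "f \<in> borel_measurable borel" by (rule borel_measurable_continuous_onI[OF f])
    show "\<bar>poly (p n) t\<bar> \<le> M + 1" if t: "\<bar>t\<bar> \<le> K" for n t
    proof -
      have "inverse (real (Suc n)) \<le> 1" by (simp add: inverse_eq_divide)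
      then have "\<bar>f t - poly (p n) t\<bar> < 1" using close[OF t, of n] by linarith
      moreover have "\<bar>f t\<bar> \<le> M" using M t by (simp add: abs_le_iff)
      ultimately show ?thesis by linarith
    qed
    show "(\<lambda>n. poly (p n) t) \<longlonglongrightarrow> f t" if t: "\<bar>t\<bar> \<le> K" for t
    proof -
      have "(\<lambda>n. poly (p n) t - f t) \<longlonglongrightarrow> 0"
      proof (rule Lim_null_comparison[OF always_eventually LIMSEQ_inverse_real_of_nat], intro allI)
        show "norm (poly (p n) t - f t) \<le> inverse (real (Suc n))" for n
          using close[OF t, of n] by (simp add: abs_minus_commute)
      qed
      then show ?thesis by (rule LIM_zero_cancel)
    qed
  qed (rule that)
qed

section \<open>Indicators and the spectral family\<close>

lemma represents_const_1: "represents (\<lambda>t. 1) id_blinfun"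
proof -
  have "poly 1 = (\<lambda>t::real. 1)" by (simp add: fun_eq_iff)
  moreover have "op_poly B 1 = id_blinfun" by (rule blinfun_eqI) simp
  ultimately show ?thesis using represents_poly[of 1] by simp
qed

lemma represents_zero: "represents (\<lambda>t. 0) 0"
proof -
  have "poly 0 = (\<lambda>t::real. 0)" by (simp add: fun_eq_iff)
  then show ?thesis using represents_poly[of 0] by simp
qed

lemma represents_indicator_sum:
  fixes S :: "nat \<Rightarrow> real set"
  assumes "\<And>i. represents (indicator (S i)) (T i)"
  shows "represents (\<lambda>t. \<Sum>i<n. indicator (S i) t) (\<Sum>i<n. T i)"
proof (induction n)
  case 0
  show ?case using represents_zero by simp
next
  case (Suc n)
  show ?case using represents_add[OF Suc assms[of n], of 1] by simp
qed

lemma represents_disjoint_union: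
  fixes S :: "nat \<Rightarrow> real set"
  assumes rep: "\<And>i. represents (indicator (S i)) (T i)" and dis: "disjoint_family S" and S: "range S \<subseteq> sets borel"
  obtains U where "represents (indicator (\<Union>i. S i)) U" "\<And>x. (\<lambda>i. T i x) sums U x"
proof -
  have ind: "(\<lambda>i. indicator (S i) t :: real) sums indicator (\<Union>i. S i) t" for t
    using dis by (intro indicator_sums) (auto simp: disjoint_family_on_def)
  show thesis
  proof (rule represents_limit[OF represents_indicator_sum[OF rep]])
    show "indicator (\<Union>i. S i) \<in> borel_measurable borel" using S by (intro borel_measurable_indicator) auto
    show "\<bar>\<Sum>i<n. indicator (S i) t :: real\<bar> \<le> 1" for n t
    proof -
      have "(\<Sum>i<n. indicator (S i) t :: real) \<le> indicator (\<Union>i. S i) t"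
        unfolding sums_unique[OF ind]
        by (rule sum_le_suminf[OF sums_summable[OF ind]]) auto
      also have "\<dots> \<le> 1" by (rule indicator_le_1)
      finally show ?thesis by (simp add: sum_nonneg)
    qed
    show "(\<lambda>n. \<Sum>i<n. indicator (S i) t) \<longlonglongrightarrow> (indicator (\<Union>i. S i) t :: real)" for t
      using ind[of t] by (simp add: sums_def)
    show thesis if "represents (indicator (\<Union>i. S i)) U" "\<And>x. (\<lambda>n. (\<Sum>i<n. T i) x) \<longlonglongrightarrow> U x" for U
      using that(1) \<open>\<And>U. represents (indicator (\<Union>i. S i)) U \<Longrightarrow> (\<And>x. (\<lambda>i. T i x) sums U x) \<Longrightarrow> thesis\<close> that(2)
      by (simp add: sums_def blinfun.sum_left)
  qed
qed

text \<open>A half-line is a limit of continuous ramps of slope -n, and the sets with representable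
  indicator are closed under complements and disjoint unions; half-lines being stable under
  intersection, the Dynkin argument reaches all Borel sets.\<close>

lemma represents_indicator:
  assumes "S \<in> sets borel"
  shows "\<exists>T. represents (indicator S) T"
proof -
  have "Int_stable (range (\<lambda>a::real. {..a}))" by (auto simp: Int_stable_def min_def)
  moreover have "range (\<lambda>a::real. {..a}) \<subseteq> Pow UNIV" by simp
  moreover have "S \<in> sigma_sets UNIV (range (\<lambda>a::real. {..a}))"
    using assms by (simp add: borel_eq_atMost)
  ultimately show ?thesis
  proof (induction S rule: sigma_sets_induct_disjoint)
    case (basic S)
    then obtain a where a: "S = {..a}" by auto
    define f where "f n t = max 0 (min 1 (1 - real n * (t - a)))" for n :: nat and t
    have "continuous_on UNIV (f n)" for n unfolding f_def by (intro continuous_intros)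
    then have "\<forall>n. \<exists>T. represents (f n) T" by (blast elim: represents_continuous)
    from choice[OF this] obtain T where T: "\<forall>n. represents (f n) (T n)" ..
    obtain U where "represents (indicator S) U"
    proof (rule represents_limit)
      show "represents (f n) (T n)" for n using T by blast
      show "indicator S \<in> borel_measurable borel" unfolding a by simp
      show "\<bar>f n t\<bar> \<le> 1" for n t by (simp add: f_def)
      show "(\<lambda>n. f n t) \<longlonglongrightarrow> indicator S t" for t
      proof (cases "t \<le> a")
        case True
        then have "real n * (t - a) \<le> 0" for n by (simp add: mult_nonneg_nonpos)
        then have "f n t = 1" for n by (simp add: f_def max_def min_def)
        then show ?thesis using True by (simp add: a)
      next
        case False
        obtain N where N: "1 / (t - a) < real N" using reals_Archimedean2 by blast
        have "f n t = 0" if "n \<ge> N" for n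
        proof -
          have "1 / (t - a) < real n" using N that by linarith
          then have "1 < real n * (t - a)" using False by (simp add: pos_divide_less_eq)
          then show ?thesis by (simp add: f_def max_def min_def)
        qed
        then have "\<forall>\<^sub>F n in sequentially. f n t = 0" by (auto simp: eventually_sequentially)
        then show ?thesis using False by (simp add: a tendsto_eventually)
      qed
    qed blast
    then show ?case by blast
  next
    case empty
    show ?case using represents_zero by (simp add: indicator_def[abs_def] exI)
  next
    case (compl S)
    then obtain T where T: "represents (indicator S) T" by blast
    have "(\<lambda>t. 1 + (- 1) * indicator S t) = (indicator (UNIV - S) :: real \<Rightarrow> real)"
      by (auto simp: fun_eq_iff indicator_def)
    then show ?case using represents_add[OF represents_const_1 T, of "- 1"] by auto
  next
    case (union S)
    then have "\<forall>i. \<exists>T. represents (indicator (S i)) T" by blast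
    from choice[OF this] obtain T where T: "\<forall>i. represents (indicator (S i)) (T i)" ..
    have "range S \<subseteq> sets borel" using union by (simp add: borel_eq_atMost)
    then obtain U where "represents (indicator (\<Union>i. S i)) U"
      using represents_disjoint_union[OF T[rule_format] union(1)] by blast
    then show ?case by blast
  qed
qed

text \<open>By \<open>represents_unique\<close> there is at most one candidate, so the choices made
  for different sets fit together.\<close>

definition spectral_family :: "real set \<Rightarrow> 'a \<Rightarrow>\<^sub>L 'a" where
  "spectral_family S = (SOME T. represents (indicator S) T)"

lemma represents_spectral_family: "S \<in> sets borel \<Longrightarrow> represents (indicator S) (spectral_family S)"
  unfolding spectral_family_def by (rule someI_ex) (rule represents_indicator)

lemma inner_spectral_family:
  assumes "S \<in> sets borel"
  shows "inner x (spectral_family S x) = measure (\<mu> x) S"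
  using represents_inner[OF represents_spectral_family[OF assms], of x] assms by simp

text \<open>An indicator equals its square, so |T x|^2 and the form of T at x are the same integral.
  Hence T T and T are self-adjoint with equal quadratic forms.\<close>

lemma orthogonal_projection_spectral_family:
  assumes S: "S \<in> sets borel"
  shows "orthogonal_projection (spectral_family S)"
proof -
  note rep = represents_spectral_family[OF S]
  note sa = represents_selfadjoint[OF rep]
  define T where "T = spectral_family S"
  have i: "inner (T x) y = inner x (T y)" for x y unfolding T_def by (rule selfadjoint_op_inner[OF sa])
  have "(\<lambda>t. (indicator S t)^2) = (indicator S :: real \<Rightarrow> real)" by (auto simp: indicator_def fun_eq_iff)
  then have n: "(norm (T x))^2 = inner x (T x)" for x
    unfolding T_def represents_norm[OF rep] represents_inner[OF rep] by simp
  have sq: "selfadjoint_op (T o\<^sub>L T)"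
    using sa unfolding T_def selfadjoint_op_def clinear_op_def by simp
  have "T o\<^sub>L T = T"
  proof (rule selfadjoint_op_eqI[OF sq])
    show "selfadjoint_op T" unfolding T_def by (rule sa)
    show "inner x ((T o\<^sub>L T) x) = inner x (T x)" for x
      using n[of x] i[of x "T x"] by (simp add: power2_norm_eq_inner)
  qed
  then show ?thesis using sa by (simp add: orthogonal_projection_def T_def)
qed

lemma spectral_family_sums:
  assumes "range S \<subseteq> sets borel" "disjoint_family (S :: nat \<Rightarrow> real set)"
  shows "(\<lambda>n. spectral_family (S n) x) sums spectral_family (\<Union>n. S n) x"
proof -
  have b: "S i \<in> sets borel" for i using assms(1) by auto
  then have "(\<Union>n. S n) \<in> sets borel" by auto
  note U = represents_spectral_family[OF this]
  show ?thesis
  proof (rule represents_disjoint_union[OF represents_spectral_family[OF b] assms(2,1)])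
    fix V assume "represents (indicator (\<Union>i. S i)) V" "\<And>x. (\<lambda>i. spectral_family (S i) x) sums V x"
    then show ?thesis using represents_unique[OF U] by simp
  qed
qed

lemma scalar_measure_spectral_family: "scalar_measure spectral_family x = \<mu> x"
proof -
  interpret finite_measure "\<mu> x" by (rule finite_measure)
  have sg: "sigma_sets UNIV (sets borel) = (sets borel :: real set set)"
    using sets.sigma_sets_eq[of borel] by simp
  have "scalar_measure spectral_family x = measure_of UNIV (sets borel) (emeasure (\<mu> x))"
    unfolding scalar_measure_def
    by (rule measure_of_eq) (auto simp: sg Re_cinner inner_spectral_family emeasure_eq_measure)
  also have "\<dots> = \<mu> x" using measure_of_of_measure[of "\<mu> x"] by simp
  finally show ?thesis .
qed

lemma is_spectral_measure_spectral_family: "is_spectral_measure B spectral_family"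
  unfolding is_spectral_measure_def projection_valued_measure_def
proof (intro conjI ballI allI impI)
  show "orthogonal_projection (spectral_family S)" if "S \<in> sets borel" for S
    by (rule orthogonal_projection_spectral_family[OF that])
  have "indicator UNIV = (\<lambda>t::real. 1 :: real)" by (simp add: fun_eq_iff)
  then have "represents (\<lambda>t. 1) (spectral_family UNIV)"
    using represents_spectral_family[of UNIV] by simp
  then show "spectral_family UNIV = id_blinfun" by (rule represents_unique[OF _ represents_const_1])
  show "(\<lambda>n. spectral_family (S n) x) sums spectral_family (\<Union>n. S n) x"
    if "range S \<subseteq> sets borel" "disjoint_family S" for S :: "nat \<Rightarrow> real set" and x
    by (rule spectral_family_sums[OF that])
  fix x
  have X: "poly [:0, 1:] = (\<lambda>t::real. t)" by (simp add: fun_eq_iff)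
  have "has_bochner_integral (\<mu> x) (\<lambda>t. t) (inner x (B x))"
    using moments[of x "[:0, 1:]"] integrable_admissible[OF admissible_poly, of x "[:0, 1:]"]
    by (simp add: X has_bochner_integral_iff blinfun.bilinear_simps)
  then have "has_bochner_integral (\<mu> x) complex_of_real (complex_of_real (inner x (B x)))"
    by (rule has_bochner_integral_of_real)
  also have "complex_of_real (inner x (B x)) = cinner x (B x)"
  proof -
    have "cinner x (B x) = cnj (cinner x (B x))"
      using selfadjoint cinner_commute[of x "B x"] by (simp add: selfadjoint_op_def)
    then have "Im (cinner x (B x)) = 0" by (metis cnj.simps(2) equal_neg_zero)
    then show ?thesis by (simp add: complex_eq_iff Re_cinner)
  qed
  finally show "has_bochner_integral (scalar_measure spectral_family x) complex_of_real (cinner x (B x))"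
    by (simp add: scalar_measure_spectral_family)
qed

end

theorem spectral_theorem:
  fixes B :: "'a::chilbert_space \<Rightarrow>\<^sub>L 'a"
  assumes "selfadjoint_op B"
  obtains E where "spectral_resolution B E"
proof -
  define P where "P x \<mu> \<longleftrightarrow> finite_measure \<mu> \<and> sets \<mu> = sets borel \<and> (AE t in \<mu>. \<bar>t\<bar> \<le> norm B + 1) \<and>
    (\<forall>p. (\<integral>t. poly p t \<partial>\<mu>) = inner x (op_poly B p x))" for x and \<mu> :: "real measure"
  have "\<exists>\<mu>. P x \<mu>" for x unfolding P_def by (rule moment_measure[OF assms, of x]) blast
  then have "\<forall>x. \<exists>\<mu>. P x \<mu>" by blast
  from choice[OF this] obtain \<mu> where \<mu>: "\<forall>x. P x (\<mu> x)" ..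
  have \<mu>': "finite_measure (\<mu> x)" "sets (\<mu> x) = sets borel" "AE t in \<mu> x. \<bar>t\<bar> \<le> norm B + 1"
    "(\<integral>t. poly p t \<partial>\<mu> x) = inner x (op_poly B p x)" for x p
    using \<mu>[rule_format, of x] unfolding P_def by blast+
  interpret moment_family B \<mu> "norm B + 1"
    by (rule moment_family.intro) (rule assms \<mu>')+
  show thesis
    by (rule that[OF spectral_resolution.intro]) (rule assms is_spectral_measure_spectral_family)+
qed

section \<open>Angles between projections\<close>

text \<open>After removal of the components along y, the remainders of x and z have lengths sin
  \<alpha> and sin \<beta>, and Cauchy-Schwarz produces the addition formula. This is the triangle
  inequality for angles on the unit sphere.\<close>

lemma inner_ge_cos_add:
  fixes x y z :: "'a::real_inner"
  assumes "norm x = 1" "norm y = 1" "norm z = 1" "0 \<le> a" "0 \<le> b" "a + b \<le> pi"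
    and "cos a \<le> inner x y" "cos b \<le> inner y z"
  shows "cos (a + b) \<le> inner x z"
proof -
  define p q where "p = inner x y" and "q = inner y z"
  have "\<bar>p\<bar> \<le> 1" "\<bar>q\<bar> \<le> 1"
    unfolding p_def q_def using Cauchy_Schwarz_ineq2[of x y] Cauchy_Schwarz_ineq2[of y z] assms by simp_all
  then have pq: "-1 \<le> p" "p \<le> 1" "-1 \<le> q" "q \<le> 1" by linarith+
  define \<alpha> \<beta> where "\<alpha> = arccos p" and "\<beta> = arccos q"
  have ab: "0 \<le> \<alpha>" "0 \<le> \<beta>" unfolding \<alpha>_def \<beta>_def using pq by (auto intro: arccos_lbound)
  have ap: "a \<le> pi" "b \<le> pi" using assms by auto
  have "\<alpha> \<le> arccos (cos a)"
    unfolding \<alpha>_def using pq assms by (intro arccos_le_arccos) (auto simp: p_def)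
  then have "\<alpha> \<le> a" using assms ap by (simp add: arccos_cos)
  have "\<beta> \<le> arccos (cos b)"
    unfolding \<beta>_def using pq assms by (intro arccos_le_arccos) (auto simp: q_def)
  then have "\<beta> \<le> b" using assms ap by (simp add: arccos_cos)
  define u w where "u = x - p *\<^sub>R y" and "w = z - q *\<^sub>R y"
  have n1: "inner x x = 1" "inner y y = 1" "inner z z = 1"
    using assms by (simp_all add: power2_norm_eq_inner[symmetric])
  have "(norm u)^2 = 1 - p^2"
    unfolding u_def power2_norm_eq_inner by (simp add: inner_simps n1 p_def inner_commute power2_eq_square)
  then have nu: "norm u = sin \<alpha>" unfolding \<alpha>_def using pq
    by (simp add: sin_arccos) (metis norm_ge_zero real_sqrt_unique)
  have "(norm w)^2 = 1 - q^2"
    unfolding w_def power2_norm_eq_inner by (simp add: inner_simps n1 q_def inner_commute power2_eq_square)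
  then have nw: "norm w = sin \<beta>" unfolding \<beta>_def using pq
    by (simp add: sin_arccos) (metis norm_ge_zero real_sqrt_unique)
  have "inner x z = p * q + inner u w"
    unfolding u_def w_def by (simp add: inner_simps n1 p_def q_def inner_commute)
  moreover have "\<bar>inner u w\<bar> \<le> sin \<alpha> * sin \<beta>" using Cauchy_Schwarz_ineq2[of u w] by (simp add: nu nw)
  moreover have "cos \<alpha> = p" "cos \<beta> = q" unfolding \<alpha>_def \<beta>_def using pq by (simp_all add: cos_arccos)
  ultimately have "cos (\<alpha> + \<beta>) \<le> inner x z" by (simp add: cos_add)
  moreover have "cos (a + b) \<le> cos (\<alpha> + \<beta>)"
    using \<open>\<alpha> \<le> a\<close> \<open>\<beta> \<le> b\<close> ab assms by (intro cos_monotone_0_pi_le) auto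
  ultimately show ?thesis by linarith
qed

lemma orthogonal_projection_pythagoras:
  fixes P :: "'a::chilbert_space \<Rightarrow>\<^sub>L 'a"
  assumes "orthogonal_projection P"
  shows "(norm (P x))^2 + (norm (x - P x))^2 = (norm x)^2"
  using orthogonal_projection_inner_self[OF assms, of x]
  by (simp add: power2_norm_eq_inner inner_simps inner_commute)

text \<open>Write (P - R) x as P (x - R x) minus (R x - P (R x)). The two pieces are orthogonal, and
  they are at most s times the orthogonal parts x - R x and R x of x. Both one-sided bounds matter:
  if the range of P lies strictly inside that of R, the first holds even with s = 0.\<close>

lemma norm_projection_diff_le:
  fixes P R :: "'a::chilbert_space \<Rightarrow>\<^sub>L 'a"
  assumes P: "orthogonal_projection P" and R: "orthogonal_projection R" and s: "0 \<le> s"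
    and PR: "\<And>x. P x = x \<Longrightarrow> norm (x - R x) \<le> s * norm x"
    and RP: "\<And>x. R x = x \<Longrightarrow> norm (x - P x) \<le> s * norm x"
  shows "norm (P - R) \<le> s"
proof (rule norm_blinfun_bound[OF s])
  fix x
  define w where "w = x - R x"
  define a b where "a = P w" and "b = R x - P (R x)"
  have "norm b \<le> s * norm (R x)"
    unfolding b_def by (rule RP) (rule orthogonal_projection_idem[OF R])
  \<comment> \<open>\<open>PR\<close> controls R on the range of P; the bound needed here, for P on
    the complement of the range of R, is its adjoint and follows by pairing \<open>a\<close> with
    \<open>w\<close>.\<close>
  have "norm a \<le> s * norm w"
  proof (cases "a = 0")
    case False
    have "R w = 0" by (simp add: w_def blinfun.bilinear_simps orthogonal_projection_idem[OF R])
    then have "inner (R a) w = 0" by (simp add: orthogonal_projection_inner[OF R])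
    then have "(norm a)^2 = inner (a - R a) w"
      using orthogonal_projection_inner_self[OF P, of w] by (simp add: a_def inner_simps inner_commute)
    also have "\<dots> \<le> norm (a - R a) * norm w" by (rule norm_cauchy_schwarz)
    also have "\<dots> \<le> (s * norm a) * norm w"
      by (intro mult_right_mono PR) (simp_all add: a_def orthogonal_projection_idem[OF P])
    finally show ?thesis using False by (simp add: power2_eq_square mult_ac)
  qed (use s in simp)
  have "inner a b = 0"
    unfolding a_def b_def orthogonal_projection_inner[OF P]
    by (simp add: blinfun.bilinear_simps orthogonal_projection_idem[OF P])
  then have "(norm (a - b))^2 = (norm a)^2 + (norm b)^2"
    by (simp add: power2_norm_eq_inner inner_simps inner_commute)
  also have "\<dots> \<le> (s * norm w)^2 + (s * norm (R x))^2"
    using \<open>norm a \<le> s * norm w\<close> \<open>norm b \<le> s * norm (R x)\<close> by (intro add_mono power_mono) auto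
  also have "\<dots> = s^2 * ((norm (R x))^2 + (norm (x - R x))^2)"
    by (simp add: w_def power_mult_distrib algebra_simps)
  also have "\<dots> = (s * norm x)^2"
    by (simp only: orthogonal_projection_pythagoras[OF R] power_mult_distrib)
  finally have "norm (a - b) \<le> s * norm x" by (rule power2_le_imp_le) (use s in simp)
  moreover have "(P - R) x = a - b" by (simp add: a_def b_def w_def blinfun.bilinear_simps)
  ultimately show "norm ((P - R) x) \<le> s * norm x" by simp
qed

lemma norm_projection_ge_cos:
  fixes P Q :: "'a::chilbert_space \<Rightarrow>\<^sub>L 'a"
  assumes P: "orthogonal_projection P" and Q: "orthogonal_projection Q"
    and a: "0 \<le> a" "a \<le> pi / 2" and PQ: "norm (P - Q) \<le> sin a" and x: "P x = x" "norm x = 1"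
  shows "cos a \<le> norm (Q x)"
proof -
  have "norm (x - Q x) \<le> norm (P - Q) * norm x"
    using norm_blinfun[of "P - Q" x] x(1) by (simp add: blinfun.bilinear_simps)
  also have "\<dots> \<le> sin a" using PQ x(2) by simp
  finally have "(norm (x - Q x))^2 \<le> (sin a)^2" by (intro power_mono) auto
  then have "(cos a)^2 \<le> (norm (Q x))^2"
    using orthogonal_projection_pythagoras[OF Q, of x] x(2) by (simp add: cos_squared_eq)
  then show ?thesis by (rule power2_le_imp_le) simp
qed

text \<open>A unit vector of the range of P is projected to the range of Q and from there to that of
  R, turning by at most a and then b. Since a + b is below pi / 2 the cosines are positive, so the
  projected vectors can be normalized.\<close>

lemma norm_projection_diff_sin_add:
  fixes P Q R :: "'a::chilbert_space \<Rightarrow>\<^sub>L 'a"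
  assumes proj: "orthogonal_projection P" "orthogonal_projection Q" "orthogonal_projection R"
    and ab: "0 \<le> a" "0 \<le> b" "a + b < pi / 2"
    and le: "norm (P - Q) \<le> sin a" "norm (Q - R) \<le> sin b"
  shows "norm (P - R) \<le> sin (a + b)"
proof -
  have half: "norm (x - R x) \<le> sin (a + b) * norm x"
    if proj: "orthogonal_projection P" "orthogonal_projection Q" "orthogonal_projection R"
    and ab: "0 \<le> a" "0 \<le> b" "a + b < pi / 2"
    and le: "norm (P - Q) \<le> sin a" "norm (Q - R) \<le> sin b" and Px: "P x = x"
    for P Q R :: "'a \<Rightarrow>\<^sub>L 'a" and a b and x
  proof (cases "x = 0")
    case False
    define e where "e = x /\<^sub>R norm x"
    have e: "norm e = 1" "P e = e" using False by (simp_all add: e_def blinfun.bilinear_simps Px)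
    have ca: "cos a \<le> norm (Q e)"
      by (rule norm_projection_ge_cos[OF proj(1,2) _ _ le(1) e(2,1)]) (use ab in auto)
    have "0 < cos a" "0 < cos b" using ab by (auto intro!: cos_gt_zero_pi)
    define y where "y = Q e /\<^sub>R norm (Q e)"
    have nQ: "norm (Q e) > 0" using ca \<open>0 < cos a\<close> by linarith
    have y: "norm y = 1" "Q y = y"
      using nQ by (simp_all add: y_def blinfun.bilinear_simps orthogonal_projection_idem[OF proj(2)])
    have ey: "inner e y = norm (Q e)"
      using nQ orthogonal_projection_inner_self[OF proj(2), of e] by (simp add: y_def power2_eq_square)
    have cb: "cos b \<le> norm (R y)"
      by (rule norm_projection_ge_cos[OF proj(2,3) _ _ le(2) y(2,1)]) (use ab in auto)
    have nR: "norm (R y) > 0" using cb \<open>0 < cos b\<close> by linarith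
    define z where "z = R y /\<^sub>R norm (R y)"
    have z: "norm z = 1" "R z = z"
      using nR by (simp_all add: z_def blinfun.bilinear_simps orthogonal_projection_idem[OF proj(3)])
    have yz: "inner y z = norm (R y)"
      using nR orthogonal_projection_inner_self[OF proj(3), of y] by (simp add: z_def power2_eq_square)
    have "cos (a + b) \<le> inner e z"
      by (rule inner_ge_cos_add[OF e(1) y(1) z(1)]) (use ab ca cb ey yz in auto)
    also have "\<dots> = inner (R e) z" using orthogonal_projection_inner[OF proj(3), of e z] z(2) by simp
    also have "\<dots> \<le> norm (R e)" using norm_cauchy_schwarz[of "R e" z] z(1) by simp
    finally have "cos (a + b) \<le> norm (R e)" .
    moreover have "0 \<le> cos (a + b)" using ab by (intro cos_ge_zero) auto
    ultimately have "(cos (a + b))^2 \<le> (norm (R e))^2" by (intro power_mono)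
    then have "(norm (e - R e))^2 \<le> (sin (a + b))^2"
      using orthogonal_projection_pythagoras[OF proj(3), of e] e(1) by (simp add: sin_squared_eq)
    then have "norm (e - R e) \<le> sin (a + b)"
      by (rule power2_le_imp_le) (use ab in \<open>auto intro!: sin_ge_zero\<close>)
    then have "norm x * norm (e - R e) \<le> norm x * sin (a + b)" by (intro mult_left_mono) auto
    moreover have "x - R x = norm x *\<^sub>R (e - R e)"
      using False by (simp add: e_def blinfun.bilinear_simps scaleR_diff_right)
    ultimately show ?thesis by (simp add: mult.commute)
  qed (simp add: blinfun.zero_right)
  show ?thesis
  proof (rule norm_projection_diff_le[OF proj(1,3)])
    show "0 \<le> sin (a + b)" using ab by (intro sin_ge_zero) auto
    show "norm (x - R x) \<le> sin (a + b) * norm x" if "P x = x" for x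
      by (rule half[OF proj ab le that])
    show "norm (x - P x) \<le> sin (a + b) * norm x" if "R x = x" for x
      using half[OF proj(3,2,1) ab(2,1) _ _ _ that] ab le by (simp add: add.commute norm_minus_commute)
  qed
qed

lemma norm_projection_chain:
  fixes P :: "nat \<Rightarrow> 'a::chilbert_space \<Rightarrow>\<^sub>L 'a"
  assumes proj: "\<And>k. k \<le> n \<Longrightarrow> orthogonal_projection (P k)"
    and step: "\<And>k. k < n \<Longrightarrow> norm (P k - P (Suc k)) \<le> sin a"
    and a: "0 \<le> a" "real n * a < pi / 2"
  shows "norm (P 0 - P n) \<le> sin (real n * a)"
proof -
  have "norm (P 0 - P k) \<le> sin (real k * a)" if "k \<le> n" for k
    using that
  proof (induction k)
    case (Suc k)
    have "real (Suc k) * a \<le> real n * a" using Suc.prems a by (intro mult_right_mono) auto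
    then have lt: "real k * a + a < pi / 2" using a by (simp add: algebra_simps)
    have "norm (P 0 - P (Suc k)) \<le> sin (real k * a + a)"
      by (rule norm_projection_diff_sin_add[of _ "P k"]) (use Suc proj step a lt in auto)
    then show ?case by (simp add: algebra_simps)
  qed simp
  then show ?thesis by simp
qed

text \<open>The quotient (1 - exp (- y)) / (1 + exp (- y)) is tanh (y / 2), the size of one step in
  \<open>norm_path_le\<close> up to the factor pi / 2.\<close>

lemma one_minus_exp_le:
  fixes y :: real
  assumes "0 \<le> y"
  shows "1 - exp (- y) \<le> y / 2 * (1 + exp (- y))"
proof -
  define f where "f y = y / 2 * (1 + exp (- y)) - 1 + exp (- y)" for y :: real
  have "f 0 \<le> f y"
  proof (rule DERIV_nonneg_imp_nondecreasing[OF assms])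
    fix t :: real assume "0 \<le> t" "t \<le> y"
    have "(f has_real_derivative (1 - (1 + t) * exp (- t)) / 2) (at t)"
      unfolding f_def by (auto intro!: derivative_eq_intros simp: field_simps)
    moreover have "(1 + t) * exp (- t) \<le> exp t * exp (- t)"
      by (intro mult_right_mono exp_ge_add_one_self) auto
    then have "0 \<le> (1 - (1 + t) * exp (- t)) / 2" by (simp add: exp_minus)
    ultimately show "\<exists>D. (f has_real_derivative D) (at t) \<and> 0 \<le> D" by blast
  qed
  then show ?thesis by (simp add: f_def)
qed

text \<open>The slope of arcsin at 0 is 1, so replacing the n small sines by their angles costs
  nothing in the limit.\<close>

lemma arcsin_over_n_tendsto: "(\<lambda>n. real n * arcsin (c / real n)) \<longlonglongrightarrow> c"
proof (cases "c = 0")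
  case False
  have "((\<lambda>h. (arcsin (0 + h) - arcsin 0) / h) \<longlongrightarrow> inverse (sqrt (1 - 0^2))) (at 0)"
    using DERIV_arcsin[of 0] by (simp add: DERIV_def)
  then have "((\<lambda>h. arcsin h / h) \<longlongrightarrow> 1) (at 0)" by simp
  moreover have "filterlim (\<lambda>n. c / real n) (at 0) sequentially"
    unfolding filterlim_at
    using False lim_const_over_n[of c] eventually_gt_at_top[of 0]
    by (auto elim!: eventually_mono)
  ultimately have "(\<lambda>n. arcsin (c / real n) / (c / real n)) \<longlonglongrightarrow> 1" by (rule filterlim_compose)
  then have "(\<lambda>n. c * (arcsin (c / real n) / (c / real n))) \<longlonglongrightarrow> c * 1" by (intro tendsto_intros)
  moreover have "c * (arcsin (c / real n) / (c / real n)) = real n * arcsin (c / real n)" for n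
    using False by (cases "n = 0") (simp_all add: field_simps)
  ultimately show ?thesis by simp
qed simp

section \<open>Perturbation of a separated part of the spectrum\<close>

text \<open>With k = \<nu> - \<kappa>, the operator A - \<nu> factors as (A - \<kappa>) (1 - k R),
  and the Banach fixed point theorem inverts 1 - k R for small k. Openness makes the real spectrum
  closed and hence Borel.\<close>

lemma real_resolvent_open:
  fixes A :: "'a::chilbert_space \<Rightarrow>\<^sub>L 'a"
  assumes "complex_of_real \<kappa> \<in> op_resolvent_set A"
  obtains e where "e > 0" "\<forall>\<nu>. \<bar>\<nu> - \<kappa>\<bar> < e \<longrightarrow> complex_of_real \<nu> \<in> op_resolvent_set A"
proof -
  obtain R :: "'a \<Rightarrow>\<^sub>L 'a" where Rc: "clinear_op R" and R1: "\<And>x. R (A x - \<kappa> *\<^sub>R x) = x"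
    and R2: "\<And>x. A (R x) - \<kappa> *\<^sub>R R x = x"
    using assms by (auto simp: op_resolvent_set_def scaleC_of_real)
  define e where "e = inverse (norm R + 1)"
  have Rp: "norm R + 1 > 0" using norm_ge_zero[of R] by linarith
  have "complex_of_real \<nu> \<in> op_resolvent_set A" if \<nu>: "\<bar>\<nu> - \<kappa>\<bar> < e" for \<nu>
  proof -
    define k where "k = \<nu> - \<kappa>"
    define c where "c = \<bar>k\<bar> * norm R"
    have c0: "0 \<le> c" by (simp add: c_def)
    have "c \<le> e * norm R" unfolding c_def k_def using \<nu> by (intro mult_right_mono) auto
    also have "\<dots> < e * (norm R + 1)"
      by (intro mult_strict_left_mono) (use Rp in \<open>simp_all add: e_def\<close>)
    also have "\<dots> = 1" using Rp by (simp add: e_def)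
    finally have c1: "c < 1" .
    have kR: "norm (k *\<^sub>R R z) \<le> c * norm z" for z
      using norm_blinfun[of R z] by (simp add: c_def mult.assoc mult_left_mono)
    have ex: "\<exists>!z. z - k *\<^sub>R R z = y" for y
    proof -
      have "\<exists>!z. y + k *\<^sub>R R z = z"
      proof (rule banach_fix_type[OF c0 c1], intro allI)
        fix u w
        have "dist (y + k *\<^sub>R R u) (y + k *\<^sub>R R w) = norm (k *\<^sub>R R (u - w))"
          by (simp add: dist_norm blinfun.bilinear_simps scaleR_diff_right)
        also have "\<dots> \<le> c * dist u w" unfolding dist_norm by (rule kR)
        finally show "dist (y + k *\<^sub>R R u) (y + k *\<^sub>R R w) \<le> c * dist u w" .
      qed
      moreover have "y + k *\<^sub>R R z = z \<longleftrightarrow> z - k *\<^sub>R R z = y" for z by (auto simp: algebra_simps)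
      ultimately show ?thesis by simp
    qed
    define L where "L y = (THE z. z - k *\<^sub>R R z = y)" for y
    have L: "L y - k *\<^sub>R R (L y) = y" for y unfolding L_def by (rule theI'[OF ex])
    have Lu: "L y = z" if "z - k *\<^sub>R R z = y" for y z using ex L that by blast
    have "bounded_linear L"
    proof (rule bounded_linear_intro)
      show "L (x + y) = L x + L y" for x y
      proof (rule Lu)
        have "L x + L y - k *\<^sub>R R (L x + L y) = (L x - k *\<^sub>R R (L x)) + (L y - k *\<^sub>R R (L y))"
          by (simp add: blinfun.bilinear_simps scaleR_add_right)
        then show "L x + L y - k *\<^sub>R R (L x + L y) = x + y" by (simp only: L)
      qed
      show "L (r *\<^sub>R x) = r *\<^sub>R L x" for r x
      proof (rule Lu)
        have "r *\<^sub>R L x - k *\<^sub>R R (r *\<^sub>R L x) = r *\<^sub>R (L x - k *\<^sub>R R (L x))"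
          by (simp add: blinfun.bilinear_simps scaleR_diff_right mult.commute)
        then show "r *\<^sub>R L x - k *\<^sub>R R (r *\<^sub>R L x) = r *\<^sub>R x" by (simp only: L)
      qed
      show "norm (L x) \<le> norm x * (1 / (1 - c))" for x
      proof -
        have "L x = x + k *\<^sub>R R (L x)" using L[of x] by (simp add: algebra_simps)
        then have "norm (L x) \<le> norm x + c * norm (L x)"
          using norm_triangle_ineq[of x "k *\<^sub>R R (L x)"] kR[of "L x"] by simp
        then have "(1 - c) * norm (L x) \<le> norm x" by (simp add: algebra_simps)
        then show ?thesis using c1 by (simp add: field_simps)
      qed
    qed
    then have Lb: "blinfun_apply (Blinfun L) y = L y" for y by (simp add: bounded_linear_Blinfun_apply)
    define S where "S = R o\<^sub>L Blinfun L"
    have S: "S y = R (L y)" for y by (simp add: S_def Lb)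
    note lin = bounded_linear.linear[OF bounded_linear_scaleC]
    have Lc: "L (z *\<^sub>C y) = z *\<^sub>C L y" for z y
    proof (rule Lu)
      have "z *\<^sub>C L y - k *\<^sub>R R (z *\<^sub>C L y) = z *\<^sub>C (L y - k *\<^sub>R R (L y))"
        using Rc by (simp add: clinear_op_def linear_diff[OF lin] linear_scale[OF lin])
      then show "z *\<^sub>C L y - k *\<^sub>R R (z *\<^sub>C L y) = z *\<^sub>C y" by (simp only: L)
    qed
    have "clinear_op S" using Rc by (simp add: clinear_op_def S Lc)
    moreover have "S (A x - \<nu> *\<^sub>R x) = x" for x
    proof -
      have "L (A x - \<nu> *\<^sub>R x) = A x - \<kappa> *\<^sub>R x"
        by (rule Lu) (simp add: R1 k_def algebra_simps)
      then show ?thesis by (simp add: S R1)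
    qed
    moreover have "A (S x) - \<nu> *\<^sub>R S x = x" for x
    proof -
      have "A (S x) - \<nu> *\<^sub>R S x = (A (R (L x)) - \<kappa> *\<^sub>R R (L x)) - k *\<^sub>R R (L x)"
        by (simp add: S k_def algebra_simps)
      also have "\<dots> = x" by (simp only: R2 L)
      finally show ?thesis .
    qed
    ultimately show ?thesis by (auto simp: op_resolvent_set_def scaleC_of_real)
  qed
  moreover have "e > 0" using Rp by (simp add: e_def)
  ultimately show thesis using that by blast
qed

text \<open>\<open>R\<close> recovers u from (B - \<kappa>) u, so a vector u in the range of
  \<open>E (ball \<kappa> e)\<close> satisfies |u| \<le> norm R * e * |u|; the radius is chosen to
  make this factor less than 1.\<close>

lemma (in spectral_resolution) E_zero_resolvent:
  assumes "complex_of_real \<kappa> \<notin> op_spectrum B"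
  shows "\<exists>e>0. \<forall>x. E (ball \<kappa> e) x = 0"
proof -
  obtain R :: "'a \<Rightarrow>\<^sub>L 'a" where R: "\<And>x. R (B x - \<kappa> *\<^sub>R x) = x"
    using assms by (auto simp: op_spectrum_def op_resolvent_set_def scaleC_of_real)
  define e where "e = inverse (norm R + 1)"
  have Rp: "norm R + 1 > 0" using norm_ge_zero[of R] by linarith
  have "E (ball \<kappa> e) x = 0" for x
  proof -
    define u where "u = E (ball \<kappa> e) x"
    have "norm (B u - \<kappa> *\<^sub>R u) \<le> e * norm u"
      by (rule norm_B_minus_le[of "ball \<kappa> e"]) (auto simp: u_def E_idem dist_real_def)
    then have "norm R * norm (B u - \<kappa> *\<^sub>R u) \<le> norm R * (e * norm u)" by (intro mult_left_mono) auto
    moreover have "norm u \<le> norm R * norm (B u - \<kappa> *\<^sub>R u)"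
      using norm_blinfun[of R "B u - \<kappa> *\<^sub>R u"] by (simp add: R)
    ultimately have "norm u \<le> (norm R * e) * norm u" by simp
    moreover have "norm R * e < 1" using Rp by (simp add: e_def field_simps)
    ultimately have "norm u = 0"
      using mult_strict_right_mono[of "norm R * e" 1 "norm u"] norm_ge_zero[of u] by fastforce
    then show ?thesis by (simp add: u_def)
  qed
  moreover have "e > 0" using Rp by (simp add: e_def)
  ultimately show ?thesis by blast
qed


locale separated_spectrum =
  fixes A V :: "'a::chilbert_space \<Rightarrow>\<^sub>L 'a" and \<omega> \<Omega> :: "real set" and d :: real
  assumes A: "selfadjoint_op A" and V: "selfadjoint_op V"
    and spectrum: "op_spectrum A = complex_of_real ` (\<omega> \<union> \<Omega>)"
    and nonempty: "\<omega> \<noteq> {}" "\<Omega> \<noteq> {}"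
    and setdist: "setdist \<omega> \<Omega> = d" and d: "d > 0"
begin

abbreviation \<sigma> :: "real set" where "\<sigma> \<equiv> \<omega> \<union> \<Omega>"

abbreviation B :: "real \<Rightarrow> 'a \<Rightarrow>\<^sub>L 'a" where "B t \<equiv> A + t *\<^sub>R V"

abbreviation \<O> :: "real set" where "\<O> \<equiv> open_nbhd (d / 2) \<omega>"

lemma selfadjoint_B: "selfadjoint_op (B t)"
proof (rule selfadjoint_opI)
  note lin = bounded_linear.linear[OF bounded_linear_scaleC]
  show "clinear_op (B t)"
    using A V by (simp add: selfadjoint_op_def clinear_op_def blinfun.bilinear_simps linear_add[OF lin] linear_scale[OF lin])
  show "inner (B t x) y = inner x (B t y)" for x y
    by (simp add: blinfun.bilinear_simps inner_simps selfadjoint_op_inner[OF A] selfadjoint_op_inner[OF V])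
qed

lemma gap: "w \<in> \<omega> \<Longrightarrow> m \<in> \<Omega> \<Longrightarrow> d \<le> \<bar>w - m\<bar>"
  using setdist_le_dist[of w \<omega> m \<Omega>] by (simp add: setdist dist_real_def)

lemma not_in_spectrum: "\<kappa> \<notin> \<sigma> \<Longrightarrow> complex_of_real \<kappa> \<notin> op_spectrum A"
  unfolding spectrum by (metis (no_types) imageE of_real_eq_iff)

lemma closed_spectrum: "closed \<sigma>"
proof -
  have "open (- \<sigma>)"
    unfolding open_dist
  proof
    fix \<kappa> assume "\<kappa> \<in> - \<sigma>"
    then have "complex_of_real \<kappa> \<in> op_resolvent_set A"
      using not_in_spectrum[of \<kappa>] by (simp add: op_spectrum_def)
    then obtain e where e: "e > 0" "\<forall>\<nu>. \<bar>\<nu> - \<kappa>\<bar> < e \<longrightarrow> complex_of_real \<nu> \<in> op_resolvent_set A"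
      by (rule real_resolvent_open)
    have "\<nu> \<in> - \<sigma>" if "dist \<nu> \<kappa> < e" for \<nu>
    proof
      assume "\<nu> \<in> \<sigma>"
      then have "complex_of_real \<nu> \<in> op_spectrum A" unfolding spectrum by (rule imageI)
      then show False using e(2)[rule_format, of \<nu>] that by (simp add: op_spectrum_def dist_real_def)
    qed
    then show "\<exists>e>0. \<forall>\<nu>. dist \<nu> \<kappa> < e \<longrightarrow> \<nu> \<in> - \<sigma>" using e(1) by blast
  qed
  then show ?thesis by (simp add: closed_def)
qed

text \<open>With r = t * norm V this closed neighborhood of the unperturbed spectrum carries the
  spectral measure of A + t V.\<close>

definition nbhd :: "real \<Rightarrow> real set" where
  "nbhd r = {\<kappa>. infdist \<kappa> \<sigma> \<le> r}"

lemma closed_nbhd: "closed (nbhd r)"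
  unfolding nbhd_def by (intro closed_Collect_le continuous_intros)

lemma nbhd_borel [simp]: "nbhd r \<in> sets borel"
  using closed_nbhd by (rule borel_closed)

lemma nbhdE:
  assumes "\<kappa> \<in> nbhd r"
  obtains w where "w \<in> \<sigma>" "\<bar>\<kappa> - w\<bar> \<le> r"
proof -
  obtain w where "w \<in> \<sigma>" "infdist \<kappa> \<sigma> = dist \<kappa> w"
    using infdist_attains_inf[OF closed_spectrum, of \<kappa>] nonempty by blast
  then show thesis using that assms by (simp add: nbhd_def dist_real_def)
qed

lemma open_nbhd_iff: "\<kappa> \<in> \<O> \<longleftrightarrow> (\<exists>w\<in>\<omega>. \<bar>\<kappa> - w\<bar> < d / 2)"
  by (auto simp: open_nbhd_def dist_real_def abs_minus_commute)

lemma open_nbhd_borel [simp]: "\<O> \<in> sets borel"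
  by (intro borel_open) (auto simp: open_nbhd_def)

text \<open>A point within d / 2 of \<omega> and within r < d / 2 of \<Omega> would bring the two
  parts closer than d. So the one set \<open>\<O>\<close> splits the spectrum correctly at every
  point of the path.\<close>

lemma nbhd_inter:
  assumes \<kappa>: "\<kappa> \<in> \<O> \<inter> nbhd r" and r: "r < d / 2"
  obtains w where "w \<in> \<omega>" "\<bar>\<kappa> - w\<bar> \<le> r"
proof -
  obtain w where w: "w \<in> \<sigma>" "\<bar>\<kappa> - w\<bar> \<le> r" using \<kappa> by (auto elim: nbhdE)
  obtain w' where w': "w' \<in> \<omega>" "\<bar>\<kappa> - w'\<bar> < d / 2" using \<kappa> by (auto simp: open_nbhd_iff)
  have "w \<notin> \<Omega>"
  proof
    assume "w \<in> \<Omega>"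
    then have "d \<le> \<bar>w' - w\<bar>" by (rule gap[OF w'(1)])
    then show False using w(2) w'(2) r by linarith
  qed
  then show thesis using that w by blast
qed

lemma nbhd_diff:
  assumes \<kappa>: "\<kappa> \<in> nbhd r - \<O>" and r: "r < d / 2"
  obtains m where "m \<in> \<Omega>" "\<bar>\<kappa> - m\<bar> \<le> r"
proof -
  obtain w where w: "w \<in> \<sigma>" "\<bar>\<kappa> - w\<bar> \<le> r" using \<kappa> by (auto elim: nbhdE)
  have "w \<notin> \<omega>"
  proof
    assume "w \<in> \<omega>"
    then have "\<kappa> \<in> \<O>" using w(2) r by (auto simp: open_nbhd_iff intro!: bexI[of _ w])
    then show False using \<kappa> by simp
  qed
  then show thesis using that w by blast
qed

text \<open>Measurability of \<omega> comes from this identity, and it shows that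
  \<open>\<O>\<close> cuts out the right subspace at the start of the path.\<close>

lemma spectrum_inter: "\<O> \<inter> \<sigma> = \<omega>"
proof
  show "\<O> \<inter> \<sigma> \<subseteq> \<omega>"
  proof
    fix \<kappa> assume \<kappa>: "\<kappa> \<in> \<O> \<inter> \<sigma>"
    then have "\<kappa> \<in> \<O> \<inter> nbhd 0" by (auto simp: nbhd_def)
    then obtain w where "w \<in> \<omega>" "\<bar>\<kappa> - w\<bar> \<le> 0" using nbhd_inter d by (metis half_gt_zero)
    then show "\<kappa> \<in> \<omega>" by simp
  qed
  have "w \<in> \<O>" if "w \<in> \<omega>" for w using d that by (auto simp: open_nbhd_iff intro!: bexI[of _ w])
  then show "\<omega> \<subseteq> \<O> \<inter> \<sigma>" by blast
qed

lemma E_spectrum: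
  assumes "spectral_resolution A E"
  shows "E (- \<sigma>) x = 0"
proof -
  interpret spectral_resolution A E by (rule assms)
  show ?thesis
  proof (rule E_zero_of_locally_zero)
    show "- \<sigma> \<in> sets borel" by (intro borel_comp borel_closed closed_spectrum)
    show "\<exists>e>0. \<forall>x. E (ball \<kappa> e) x = 0" if "\<kappa> \<in> - \<sigma>" for \<kappa>
      by (rule E_zero_resolvent[OF not_in_spectrum]) (use that in simp)
  qed
qed

text \<open>A vector u that A + t V localizes within e of \<kappa> satisfies |(A - \<kappa>) u|
  \<le> (e + t |V|) |u|, while the distance r of \<kappa> from the spectrum of A forces at least r
  |u|.\<close>

lemma E_nbhd:
  assumes F: "spectral_resolution (B t) F" and t: "0 \<le> t"
  shows "F (- nbhd (t * norm V)) x = 0"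
proof -
  obtain E where E: "spectral_resolution A E" using spectral_theorem[OF A] .
  interpret E: spectral_resolution A E by (rule E)
  interpret F: spectral_resolution "B t" F by (rule F)
  have \<sigma>b: "\<sigma> \<in> sets borel" using closed_spectrum by (rule borel_closed)
  have E\<sigma>: "E \<sigma> y = y" for y using E_spectrum[OF E, of y] E.E_Compl[OF \<sigma>b] by simp
  show ?thesis
  proof (rule F.E_zero_of_locally_zero)
    fix \<kappa> assume "\<kappa> \<in> - nbhd (t * norm V)"
    then have r: "t * norm V < infdist \<kappa> \<sigma>" by (simp add: nbhd_def)
    define r where "r = infdist \<kappa> \<sigma>"
    \<comment> \<open>Half of the excess of r over t |V|, so that e + t |V| stays below r.\<close>
    define e where "e = (r - t * norm V) / 2"
    have e: "e > 0" using r by (simp add: e_def r_def)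
    have tv: "0 \<le> t * norm V" using t by simp
    have "F (ball \<kappa> e) y = 0" for y
    proof -
      define u where "u = F (ball \<kappa> e) y"
      have "norm (B t u - \<kappa> *\<^sub>R u) \<le> e * norm u"
        by (rule F.norm_B_minus_le[of "ball \<kappa> e"]) (auto simp: u_def F.E_idem dist_real_def)
      moreover have "A u - \<kappa> *\<^sub>R u = (B t u - \<kappa> *\<^sub>R u) - t *\<^sub>R V u"
        by (simp add: blinfun.bilinear_simps)
      then have "norm (A u - \<kappa> *\<^sub>R u) \<le> norm (B t u - \<kappa> *\<^sub>R u) + norm (t *\<^sub>R V u)"
        by (metis norm_triangle_ineq4)
      moreover have "norm (t *\<^sub>R V u) \<le> t * norm V * norm u"
        using t norm_blinfun[of V u] by (simp add: mult.assoc mult_left_mono)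
      moreover have "r * norm u \<le> norm (A u - \<kappa> *\<^sub>R u)"
      proof (rule E.norm_B_minus_ge[OF \<sigma>b E\<sigma>])
        show "r \<le> \<bar>s - \<kappa>\<bar>" if "s \<in> \<sigma>" for s
          using infdist_le[OF that, of \<kappa>] by (simp add: r_def dist_real_def abs_minus_commute)
        show "0 < r" using r tv by (simp add: r_def)
      qed
      ultimately have "r * norm u \<le> (e + t * norm V) * norm u" by (simp add: distrib_right)
      then have "(r - (e + t * norm V)) * norm u \<le> 0" by (simp add: algebra_simps)
      moreover have "r - (e + t * norm V) = e" by (simp add: e_def field_simps)
      ultimately have "e * norm u \<le> 0" by simp
      then show ?thesis using e by (simp add: u_def mult_le_0_iff)
    qed
    then show "\<exists>e>0. \<forall>y. F (ball \<kappa> e) y = 0" using e by blast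
  qed (simp add: borel_comp)
qed

lemma E_inter_nbhd:
  assumes F: "spectral_resolution (B t) F" and t: "0 \<le> t" and S: "S \<in> sets borel" and x: "F S x = x"
  shows "F (S \<inter> nbhd (t * norm V)) x = x"
proof -
  interpret F: spectral_resolution "B t" F by (rule F)
  have "F (nbhd (t * norm V)) x = x"
    using E_nbhd[OF F t, of x] F.E_Compl[OF nbhd_borel] by simp
  then show ?thesis using F.E_E[OF S nbhd_borel, of "t * norm V" x] x by simp
qed

section \<open>Comparison of two points of the path\<close>

lemma norm_diff_proj_le:
  assumes E: "spectral_resolution (B s) E" and F: "spectral_resolution (B t) F"
    and s: "0 \<le> s" "s * norm V < d / 2" and t: "0 \<le> t" "t * norm V < d / 2" and x: "E \<O> x = x"
  shows "norm (x - F \<O> x) \<le> pi / 2 * (\<bar>s - t\<bar> * norm V / (d - (s + t) * norm V)) * norm x"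
proof -
  interpret E: spectral_resolution "B s" E by (rule E)
  interpret F: spectral_resolution "B t" F by (rule F)
  define v where "v = norm V"
  \<comment> \<open>The relevant part of \<open>\<O>\<close> lies within s v of \<omega> and that of
    its complement within t v of \<Omega>, which leaves this much of the gap d.\<close>
  define \<delta> where "\<delta> = d - (s + t) * v"
  have \<delta>: "\<delta> > 0" using s t by (simp add: \<delta>_def v_def distrib_right)
  define y where "y = F (- \<O>) x"
  have Cb: "- \<O> \<in> sets borel" using open_nbhd_borel by (rule borel_comp)
  have y: "F (- \<O>) y = y" unfolding y_def by (rule F.E_idem[OF Cb])
  have "\<bar>inner x y\<bar> \<le> pi / 2 * (norm (B s - B t) / \<delta>) * norm x * norm y"
  proof (rule spectral_subspaces_inner_le[OF E F _ _ \<delta>])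
    show "\<O> \<inter> nbhd (s * v) \<in> sets borel" "- \<O> \<inter> nbhd (t * v) \<in> sets borel"
      by (intro sets.Int nbhd_borel open_nbhd_borel Cb)+
    show "E (\<O> \<inter> nbhd (s * v)) x = x" unfolding v_def by (rule E_inter_nbhd[OF E s(1) _ x]) simp
    show "F (- \<O> \<inter> nbhd (t * v)) y = y" unfolding v_def by (rule E_inter_nbhd[OF F t(1) Cb y])
    fix a b assume a: "a \<in> \<O> \<inter> nbhd (s * v)" and b: "b \<in> - \<O> \<inter> nbhd (t * v)"
    obtain w where w: "w \<in> \<omega>" "\<bar>a - w\<bar> \<le> s * v"
      using nbhd_inter[OF a] s(2) unfolding v_def by blast
    from b have "b \<in> nbhd (t * v) - \<O>" by blast
    then obtain m where m: "m \<in> \<Omega>" "\<bar>b - m\<bar> \<le> t * v"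
      using nbhd_diff t(2) unfolding v_def by blast
    have "d \<le> \<bar>w - m\<bar>" by (rule gap[OF w(1) m(1)])
    then show "\<delta> \<le> \<bar>a - b\<bar>" using w(2) m(2) unfolding \<delta>_def distrib_right by linarith
  qed
  also have "norm (B s - B t) = \<bar>s - t\<bar> * v"
    by (simp add: v_def scaleR_diff_left[symmetric])
  finally have le: "\<bar>inner x y\<bar> \<le> pi / 2 * (\<bar>s - t\<bar> * v / \<delta>) * norm x * norm y" .
  \<comment> \<open>As y is a projection of x, the bound on their inner product bounds the norm of y
    itself.\<close>
  have "inner x y = (norm y)^2" unfolding y_def by (rule F.inner_E_self[OF Cb])
  then have "norm y * norm y \<le> (pi / 2 * (\<bar>s - t\<bar> * v / \<delta>) * norm x) * norm y"
    using le by (simp add: power2_eq_square)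
  moreover have "0 \<le> pi / 2 * (\<bar>s - t\<bar> * v / \<delta>) * norm x" using \<delta> by (simp add: v_def)
  ultimately have "norm y \<le> pi / 2 * (\<bar>s - t\<bar> * v / \<delta>) * norm x"
    by (cases "norm y = 0") (simp, metis mult_le_cancel_right norm_ge_zero order_le_less)
  then show ?thesis by (simp add: y_def F.E_Compl[OF open_nbhd_borel] \<delta>_def v_def)
qed

lemma norm_spectral_projection_diff_le:
  assumes E: "spectral_resolution (B s) E" and F: "spectral_resolution (B t) F"
    and s: "0 \<le> s" "s * norm V < d / 2" and t: "0 \<le> t" "t * norm V < d / 2"
  shows "norm (E \<O> - F \<O>) \<le> pi / 2 * (\<bar>s - t\<bar> * norm V / (d - (s + t) * norm V))"
proof (rule norm_projection_diff_le)
  show "orthogonal_projection (E \<O>)" "orthogonal_projection (F \<O>)"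
    using spectral_resolution.projection[OF E] spectral_resolution.projection[OF F] by simp_all
  have "0 < d - (s + t) * norm V" using s t by (simp add: distrib_right)
  then show "0 \<le> pi / 2 * (\<bar>s - t\<bar> * norm V / (d - (s + t) * norm V))" by simp
  show "norm (x - F \<O> x) \<le> pi / 2 * (\<bar>s - t\<bar> * norm V / (d - (s + t) * norm V)) * norm x"
    if "E \<O> x = x" for x
    by (rule norm_diff_proj_le[OF E F s t that])
  show "norm (x - E \<O> x) \<le> pi / 2 * (\<bar>s - t\<bar> * norm V / (d - (s + t) * norm V)) * norm x"
    if "F \<O> x = x" for x
    using norm_diff_proj_le[OF F E t s that] by (simp add: abs_minus_commute add.commute)
qed

lemma spectral_projection_spectrum_part:
  assumes E: "spectral_resolution A E"
  shows "spectral_projection A \<omega> = E \<O>"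
proof -
  interpret E: spectral_resolution A E by (rule E)
  have \<sigma>b: "\<sigma> \<in> sets borel" using closed_spectrum by (rule borel_closed)
  have \<omega>b: "\<omega> \<in> sets borel" using sets.Int[OF open_nbhd_borel \<sigma>b] by (simp only: spectrum_inter)
  have "E \<omega> x = E \<O> x" for x
  proof -
    have "E \<sigma> x = x" using E_spectrum[OF E, of x] E.E_Compl[OF \<sigma>b] by simp
    then show ?thesis using E.E_E[OF open_nbhd_borel \<sigma>b, of x] unfolding spectrum_inter by simp
  qed
  then have "E \<omega> = E \<O>" by (intro blinfun_eqI)
  then show ?thesis using E.spectral_projection_eq[OF \<omega>b] by simp
qed

text \<open>The points \<open>t k\<close> are placed so that d - 2 (t k) |V| = d exp (- k y): the
  gap shrinks by the same factor in each step, so all steps obey the same bound pi / 2 * tanh (y /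
  2) \<le> \<theta> / n. Equal spacing of the \<open>t k\<close> would give unequal bounds and a
  Riemann sum.\<close>

lemma norm_path_le:
  assumes v: "0 < norm V" "norm V < d / 2" and \<theta>: "\<theta> = pi / 4 * ln (d / (d - 2 * norm V))"
    and n: "0 < n" and a: "0 \<le> a" "\<theta> / real n \<le> sin a" "real n * a < pi / 2"
  shows "norm (spectral_projection A \<omega> - spectral_projection (A + V) \<O>) \<le> sin (real n * a)"
proof -
  define v where "v = norm V"
  have v0: "0 < v" "2 * v < d" using v by (simp_all add: v_def)
  define L where "L = ln (d / (d - 2 * v))"
  have q: "1 < d / (d - 2 * v)" using v0 by (simp add: less_divide_eq)
  then have L: "0 < L" unfolding L_def by simp
  have expL: "exp (- L) = (d - 2 * v) / d" using q v0 unfolding L_def by (simp add: exp_minus)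
  define y where "y = L / real n"
  have y: "0 < y" using L n by (simp add: y_def)
  define e where "e k = exp (- (real k * y))" for k
  define t where "t k = d * (1 - e k) / (2 * v)" for k
  have e: "0 < e k" "e k \<le> 1" for k using y by (auto simp: e_def)
  have en: "e n = (d - 2 * v) / d" unfolding e_def y_def using n by (simp add: expL)
  have tv: "t k * v = d * (1 - e k) / 2" for k unfolding t_def using v0 by simp
  have t0: "0 \<le> t k" for k unfolding t_def using e[of k] v0 d by simp
  have tv2: "t k * norm V < d / 2" for k
    using e(1)[of k] d unfolding v_def[symmetric] tv by (simp add: field_simps)
  \<comment> \<open>The total factor exp (- L) is the ratio of the final to the initial gap, so n
    steps end exactly at A + V.\<close>
  have tn: "t n = 1" unfolding t_def en using v0 d by (simp add: field_simps)
  have "\<forall>k. \<exists>E. spectral_resolution (B (t k)) E" using spectral_theorem[OF selfadjoint_B] by blast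
  from choice[OF this] obtain E where E: "\<forall>k. spectral_resolution (B (t k)) (E k)" ..
  have "norm (E 0 \<O> - E n \<O>) \<le> sin (real n * a)"
  proof (rule norm_projection_chain[OF _ _ a(1,3)])
    show "orthogonal_projection (E k \<O>)" for k
      using spectral_resolution.projection[OF E[rule_format]] by simp
    fix k
    have "norm (E k \<O> - E (Suc k) \<O>)
      \<le> pi / 2 * (\<bar>t k - t (Suc k)\<bar> * norm V / (d - (t k + t (Suc k)) * norm V))"
      by (rule norm_spectral_projection_diff_le[OF E[rule_format] E[rule_format] t0 tv2 t0 tv2])
    also have "\<bar>t k - t (Suc k)\<bar> * norm V / (d - (t k + t (Suc k)) * norm V) = (1 - exp (- y)) / (1 + exp (- y))"
    proof -
      have eS: "e (Suc k) = e k * exp (- y)" by (simp add: e_def exp_add[symmetric] algebra_simps)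
      have "\<bar>t k - t (Suc k)\<bar> * norm V = \<bar>t k * v - t (Suc k) * v\<bar>"
        using v0 by (simp add: v_def abs_mult left_diff_distrib[symmetric])
      also have "\<dots> = \<bar>d / 2 * e k * (exp (- y) - 1)\<bar>"
        unfolding tv eS by (intro arg_cong[of _ _ abs]) (simp add: field_simps)
      also have "\<dots> = d / 2 * e k * (1 - exp (- y))" using d e(1)[of k] y by (simp add: abs_mult)
      finally have 1: "\<bar>t k - t (Suc k)\<bar> * norm V = d / 2 * e k * (1 - exp (- y))" .
      have "d - (t k + t (Suc k)) * norm V = d - (t k * v + t (Suc k) * v)"
        by (simp add: v_def distrib_right)
      also have "\<dots> = d / 2 * e k * (1 + exp (- y))" unfolding tv eS by (simp add: field_simps)
      finally have 2: "d - (t k + t (Suc k)) * norm V = d / 2 * e k * (1 + exp (- y))" .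
      show ?thesis unfolding 1 2 using d e(1)[of k] by simp
    qed
    also have "\<dots> \<le> y / 2"
      using one_minus_exp_le[of y] y by (simp add: divide_le_eq add_pos_pos)
    also have "pi / 2 * (y / 2) = \<theta> / real n" by (simp add: y_def \<theta> L_def v_def)
    also have "\<dots> \<le> sin a" by (rule a(2))
    finally show "norm (E k \<O> - E (Suc k) \<O>) \<le> sin a" by simp
  qed
  moreover have "spectral_projection A \<omega> = E 0 \<O>"
    by (rule spectral_projection_spectrum_part) (use E[rule_format, of 0] in \<open>simp add: t_def e_def\<close>)
  moreover have "spectral_projection (A + V) \<O> = E n \<O>"
    by (rule spectral_resolution.spectral_projection_eq)
       (use E[rule_format, of n] in \<open>simp_all add: tn\<close>)
  ultimately show ?thesis by simp
qed

end

theorem theorem6p1: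
  fixes A V :: "'a::chilbert_space \<Rightarrow>\<^sub>L 'a"
    and \<omega> \<Omega> :: "real set"
    and d :: real
  assumes "separable_space (euclidean :: 'a topology)"
    and "selfadjoint_op A"
    and "selfadjoint_op V"
    and "op_spectrum A = complex_of_real ` (\<omega> \<union> \<Omega>)"
    and "\<omega> \<noteq> {}"
    and "\<Omega> \<noteq> {}"
    and "setdist \<omega> \<Omega> = d"
    and "d > 0"
    and "norm V < sinh 1 / exp 1 * d"
  shows "norm (spectral_projection A \<omega> - spectral_projection (A + V) (open_nbhd (d / 2) \<omega>))
           \<le> sin (pi / 4 * ln (d / (d - 2 * norm V)))
         \<and> sin (pi / 4 * ln (d / (d - 2 * norm V))) < 1"
proof -
  interpret separated_spectrum A V \<omega> \<Omega> d
    by (rule separated_spectrum.intro) (rule assms)+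
  define v where "v = norm V"
  define \<theta> where "\<theta> = pi / 4 * ln (d / (d - 2 * v))"
  have v0: "0 \<le> v" by (simp add: v_def)
  have sinh1: "sinh 1 / exp 1 = (1 - exp (- 2 :: real)) / 2"
    by (simp add: sinh_field_def field_simps exp_add[symmetric])
  have "v < (1 - exp (- 2)) / 2 * d" using assms(9) unfolding v_def sinh1 .
  then have dv: "exp (- 2) * d < d - 2 * v" by (simp add: algebra_simps)
  have "0 < exp (- 2 :: real) * d" using d by simp
  then have dv0: "0 < d - 2 * v" using dv by linarith
  have "d / (d - 2 * v) < exp 2"
  proof -
    have "d = exp 2 * (exp (- 2) * d)" by (simp add: exp_minus)
    also have "\<dots> < exp 2 * (d - 2 * v)" by (rule mult_strict_left_mono[OF dv]) simp
    finally show ?thesis using dv0 by (simp add: divide_less_eq)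
  qed
  then have "ln (d / (d - 2 * v)) < ln (exp 2)" using d dv0 by (subst ln_less_cancel_iff) auto
  then have "ln (d / (d - 2 * v)) < 2" by simp
  then have \<theta>2: "\<theta> < pi / 2" by (simp add: \<theta>_def field_simps)
  have "1 \<le> d / (d - 2 * v)" using dv0 v0 by (simp add: le_divide_eq)
  then have \<theta>0: "0 \<le> \<theta>" by (simp add: \<theta>_def)
  have "sin \<theta> < sin (pi / 2)" using \<theta>0 \<theta>2 by (intro sin_monotone_2pi) auto
  then have lt1: "sin \<theta> < 1" by simp
  have "norm (spectral_projection A \<omega> - spectral_projection (A + V) \<O>) \<le> sin \<theta>"
  proof (cases "v = 0")
    \<comment> \<open>The subdivision in \<open>norm_path_le\<close> divides by norm V, so V = 0 is
      treated directly.\<close>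
    case True
    then have "V = 0" by (simp add: v_def)
    obtain E where E: "spectral_resolution A E" using spectral_theorem[OF A] .
    have "spectral_projection A \<omega> = spectral_projection (A + V) \<O>"
      using spectral_projection_spectrum_part[OF E] spectral_resolution.spectral_projection_eq[OF E open_nbhd_borel]
      by (simp add: \<open>V = 0\<close>)
    then show ?thesis using \<theta>0 \<theta>2 by (simp add: sin_ge_zero)
  next
    case False
    define s where "s n = norm (spectral_projection A \<omega> - spectral_projection (A + V) \<O>)" for n :: nat
    \<comment> \<open>Each of the n steps may turn by arcsin (\<theta> / n); the sum of these angles
      tends to \<theta>.\<close>
    have lim: "(\<lambda>n. real n * arcsin (\<theta> / real n)) \<longlonglongrightarrow> \<theta>" by (rule arcsin_over_n_tendsto)
    have ev: "\<forall>\<^sub>F n in sequentially. s n \<le> sin (real n * arcsin (\<theta> / real n))"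
      using order_tendstoD(2)[OF lim \<theta>2] eventually_ge_at_top[of 2]
    proof eventually_elim
      case (elim n)
      \<comment> \<open>From n = 2 on, \<theta> / n is below pi / 4 and hence in the domain of
        arcsin.\<close>
      have "\<theta> / real n \<le> \<theta> / 2" using elim(2) \<theta>0 by (intro divide_left_mono) auto
      also have "\<dots> \<le> 1" using \<theta>2 pi_less_4 by simp
      finally have le1: "\<theta> / real n \<le> 1" .
      have ge0: "0 \<le> \<theta> / real n" using \<theta>0 by simp
      show ?case unfolding s_def
      proof (rule norm_path_le)
        show "0 < norm V" "norm V < d / 2" using False dv0 by (simp_all add: v_def)
        show "\<theta> = pi / 4 * ln (d / (d - 2 * norm V))" by (simp add: \<theta>_def v_def)
        show "0 < n" using elim(2) by simp
        show "0 \<le> arcsin (\<theta> / real n)" using arcsin_le_arcsin[of 0 "\<theta> / real n"] ge0 le1 by simp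
        show "\<theta> / real n \<le> sin (arcsin (\<theta> / real n))" using ge0 le1 by simp
      qed (rule elim(1))
    qed
    have "(\<lambda>n. sin (real n * arcsin (\<theta> / real n))) \<longlonglongrightarrow> sin \<theta>" by (intro tendsto_intros lim)
    from tendsto_lowerbound[OF this ev[unfolded s_def]] show ?thesis by simp
  qed
  then show ?thesis using lt1 by (simp add: \<theta>_def v_def)
qed

end
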